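(* For $\beta>-1$ let $\eta_\beta$ be a Poisson point process in $\mathbb R^d\times\mathbb R_+$ whose intensity measure has density $(v,h)\mapsto c_{d+1,\beta}h^\beta$, $h\ge0$, with respect to Lebesgue measure, where $$c_{d+1,\beta}=\frac{\Gamma\left(\frac d2+\beta+2\right)}{\pi^{\frac d2+1}\Gamma(\beta+1)} .$$ Let $\gamma_d=\pi^{-\frac d2-1}\Gamma\left(\frac d2+1\right)$ and let $\eta^{\gamma_d}$ be a homogeneous Poisson point process in $\mathbb R^d$ with intensity $\gamma_d$. Then the random closed sets $\mathrm{skel}(\mathcal L(\eta_\beta))$ and $\mathrm{skel}(\mathcal L^*(\eta_\beta))$ converge weakly, as $\beta\to-1$, to $\mathrm{skel}(\mathcal L(\eta^{\gamma_d}))$ and $\mathrm{skel}(\mathcal L^*(\eta^{\gamma_d}))$, respectively.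
   Context: Let $d\ge2$, $\mathbb R_+=[0,\infty)$. Points of $\mathbb R^d\times\mathbb R$ are written $(v,h)$. Put $\mathrm{pow}(w,(v,h))=\|w-v\|^2+h$. For a countable set $A\subset\mathbb R^d\times\mathbb R$ and $(v,h)\in A$ the Laguerre cell is $C((v,h),A)=\{w\in\mathbb R^d:\mathrm{pow}(w,(v,h))\le \mathrm{pow}(w,(v',h'))\ \forall (v',h')\in A\}$, and the Laguerre diagram $\mathcal L(A)$ is the collection of all Laguerre cells with non-empty interior. A tessellation in $\mathbb R^d$ is a locally finite system of convex polytopes (cells) with non-empty, pairwise disjoint interiors covering $\mathbb R^d$, such that the intersection of two distinct cells is empty or a face of both. It is normal if each $k$-dimensional face is contained in precisely $d+1-k$ cells, $0\le k\le d-1$. If $\mathcal L(A)$ is a normal tessellation, its dual $\mathcal L^*(A)$ is the collection of simplices $\mathrm{conv}(v_1,\dots,v_{d+1})$ over distinct $(v_1,h_1),\dots,(v_{d+1},h_{d+1})\in A$ with $\bigcap_{i=1}^{d+1}C((v_i,h_i),A)\ne\varnothing$. The skeleton is $\mathrm{skel}(X)=\bigcup_{c\in X}\mathrm{bd}\,c$. $\mathcal L(\eta_\beta)$ (the $\beta$-Voronoi tessellation) is almost surely a normal random tessellation; $\mathcal L^*(\eta_\beta)$ is the $\beta$-Delaunay tessellation. A point process in $\mathbb R^d$ (such as $\eta^{\gamma_d}$) is viewed as a point process in $\mathbb R^d\times\mathbb R$ by identifying $v$ with $(v,0)$; thus $\mathcal L(\eta^{\gamma_d})$ and $\mathcal L^*(\eta^{\gamma_d})$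 are the Poisson-Voronoi and Poisson-Delaunay tessellations. Weak convergence of random closed sets is weak convergence of their distributions on the space of closed subsets of $\mathbb R^d$ with the Fell topology. Equivalently, with $T_Z(C)=\mathbb P(Z\cap C\neq\varnothing)$, $T_{Z_n}(C)\to T_Z(C)$ for all compact $C$ with $T_Z(\mathrm{int}\,C)=T_Z(C)$. *)

theory Defs
  imports "HOL-Probability.Probability"
begin

definition pow :: "'a::euclidean_space \<Rightarrow> 'a \<times> real \<Rightarrow> real" where
  "pow w p = (norm (w - fst p))\<^sup>2 + snd p"

definition laguerre_cell :: "'a::euclidean_space \<times> real \<Rightarrow> ('a \<times> real) set \<Rightarrow> 'a set" where
  "laguerre_cell p A = {w. \<forall>q\<in>A. pow w p \<le> pow w q}"

definition laguerre_diagram :: "('a::euclidean_space \<times> real) set \<Rightarrow> 'a set set" where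
  "laguerre_diagram A = {laguerre_cell p A | p. p \<in> A \<and> interior (laguerre_cell p A) \<noteq> {}}"

text \<open>The dual is a total function of \<open>A\<close> here. It is meaningful as a simplicial
  tessellation when \<open>laguerre_diagram A\<close> is a normal tessellation, which holds almost
  surely for the Poisson point processes below.\<close>

definition laguerre_dual :: "('a::euclidean_space \<times> real) set \<Rightarrow> 'a set set" where
  "laguerre_dual A =
     {convex hull (fst ` S) | S. S \<subseteq> A \<and> finite S \<and> card S = DIM('a) + 1 \<and>
                                 (\<Inter>p\<in>S. laguerre_cell p A) \<noteq> {}}"

definition skel :: "'a::euclidean_space set set \<Rightarrow> 'a set" where
  "skel X = (\<Union>c\<in>X. frontier c)"

text \<open>A simple point process is a random locally finite set \<open>\<eta>\<close>; all intensity
  measures considered have no atoms, so the Poisson processes are almost surely simple.\<close>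

definition num_points :: "('w \<Rightarrow> 'a set) \<Rightarrow> 'a set \<Rightarrow> 'w \<Rightarrow> ennreal" where
  "num_points \<eta> B \<omega> = emeasure (count_space UNIV) (\<eta> \<omega> \<inter> B)"

definition point_process :: "'w measure \<Rightarrow> ('w \<Rightarrow> 'a::euclidean_space set) \<Rightarrow> bool" where
  "point_process M \<eta> \<longleftrightarrow> prob_space M \<and>
     (\<forall>\<omega>\<in>space M. \<forall>K. compact K \<longrightarrow> finite (\<eta> \<omega> \<inter> K)) \<and>
     (\<forall>B\<in>sets borel. num_points \<eta> B \<in> borel_measurable M)"

definition poisson_process ::
    "'w measure \<Rightarrow> 'a::euclidean_space measure \<Rightarrow> ('w \<Rightarrow> 'a set) \<Rightarrow> bool" where
  "poisson_process M \<Lambda> \<eta> \<longleftrightarrow> point_process M \<eta> \<and>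
     (\<forall>B\<in>sets borel. emeasure \<Lambda> B < \<infinity> \<longrightarrow>
        (\<forall>k::nat. measure M {\<omega> \<in> space M. num_points \<eta> B \<omega> = of_nat k}
                   = exp (- measure \<Lambda> B) * measure \<Lambda> B ^ k / fact k)) \<and>
     (\<forall>B\<in>sets borel. emeasure \<Lambda> B = \<infinity> \<longrightarrow> (AE \<omega> in M. num_points \<eta> B \<omega> = \<infinity>)) \<and>
     (\<forall>(B :: nat \<Rightarrow> 'a set) n. (\<forall>i<n. B i \<in> sets borel) \<and> disjoint_family_on B {..<n} \<longrightarrow>
        prob_space.indep_vars M (\<lambda>_. borel) (\<lambda>i. num_points \<eta> (B i)) {..<n})"

definition beta_const :: "nat \<Rightarrow> real \<Rightarrow> real" where
  "beta_const d \<beta> = Gamma (real d / 2 + \<beta> + 2) / (pi powr (real d / 2 + 1) * Gamma (\<beta> + 1))"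

text \<open>The measure lives on all of \<open>\<real>\<^sup>d \<times> \<real>\<close>, but gives no mass to \<open>h < 0\<close>: a Poisson
  process with this intensity almost surely has all its points in \<open>\<real>\<^sup>d \<times> [0,\<infinity>)\<close>.\<close>

definition beta_intensity :: "real \<Rightarrow> ((real ^ 'n) \<times> real) measure" where
  "beta_intensity \<beta> = density lborel
     (\<lambda>(v, h). ennreal (indicator {0..} h * (beta_const CARD('n) \<beta> * h powr \<beta>)))"

definition gamma_const :: "nat \<Rightarrow> real" where
  "gamma_const d = pi powr (- (real d / 2) - 1) * Gamma (real d / 2 + 1)"

definition embed0 :: "'a set \<Rightarrow> ('a \<times> real) set" where
  "embed0 A = (\<lambda>v. (v, 0)) ` A"

definition fell_topology :: "'a::euclidean_space set topology" where
  "fell_topology = topology_generated_by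
     ({{F. closed F \<and> F \<inter> K = {}} | K. compact K} \<union>
      {{F. closed F \<and> F \<inter> G \<noteq> {}} | G. open G})"

lemma topspace_fell_topology: "topspace fell_topology = {F. closed F}"
proof (rule subset_antisym)
  show "topspace fell_topology \<subseteq> {F :: 'a set. closed F}"
    unfolding fell_topology_def topology_generated_by_topspace by (rule Union_least) auto
  have "{F :: 'a set. closed F} \<in> {{F. closed F \<and> F \<inter> K = {}} | K. compact K}"
    by (rule CollectI, rule exI[of _ "{}"]) simp
  then show "{F :: 'a set. closed F} \<subseteq> topspace fell_topology"
    unfolding fell_topology_def topology_generated_by_topspace by (intro Union_upper UnI1)
qed

definition fell_borel :: "'a::euclidean_space set measure" where
  "fell_borel = sigma {F. closed F} {U. openin fell_topology U}"

text \<open>Skeletons are closed sets only almost surely, and an exceptional null event need not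
  contain only measurable subsets. Random closed sets are therefore maps that are almost
  surely closed-valued and, after replacing non-closed values by the empty set, measurable
  with respect to the completed probability measure; the law does not depend on the
  replacement value.\<close>

definition closed_version :: "('w \<Rightarrow> 'a::euclidean_space set) \<Rightarrow> 'w \<Rightarrow> 'a set" where
  "closed_version Z \<omega> = (if closed (Z \<omega>) then Z \<omega> else {})"

definition random_closed_set :: "'w measure \<Rightarrow> ('w \<Rightarrow> 'a::euclidean_space set) \<Rightarrow> bool" where
  "random_closed_set M Z \<longleftrightarrow> prob_space M \<and> (AE \<omega> in M. closed (Z \<omega>)) \<and>
     closed_version Z \<in> measurable (completion M) fell_borel"

definition closed_set_law ::
    "'w measure \<Rightarrow> ('w \<Rightarrow> 'a::euclidean_space set) \<Rightarrow> 'a set measure" where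
  "closed_set_law M Z = distr (completion M) fell_borel (closed_version Z)"

text \<open>Weak convergence along a filter \<open>F\<close> of Borel probability measures on a topological space.\<close>

definition weak_convergence ::
    "'b topology \<Rightarrow> ('i \<Rightarrow> 'b measure) \<Rightarrow> 'b measure \<Rightarrow> 'i filter \<Rightarrow> bool" where
  "weak_convergence T \<mu> \<nu> F \<longleftrightarrow>
     (\<forall>f :: 'b \<Rightarrow> real. continuous_map T euclideanreal f \<and> bounded (f ` topspace T) \<longrightarrow>
        ((\<lambda>i. \<integral>x. f x \<partial>\<mu> i) \<longlongrightarrow> (\<integral>x. f x \<partial>\<nu>)) F)"

definition random_closed_sets_converge_weakly ::
    "('i \<Rightarrow> 'w measure) \<Rightarrow> ('i \<Rightarrow> 'w \<Rightarrow> 'a::euclidean_space set) \<Rightarrow>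
     'u measure \<Rightarrow> ('u \<Rightarrow> 'a set) \<Rightarrow> 'i filter \<Rightarrow> bool" where
  "random_closed_sets_converge_weakly M Z N Y F \<longleftrightarrow>
     weak_convergence fell_topology (\<lambda>i. closed_set_law (M i) (Z i)) (closed_set_law N Y) F"

end

theory Submission
  imports Defs
begin

text \<open>
  All processes are put on the probability space of the process with \<open>\<beta> = 0\<close>: the height
  transformation \<open>h \<mapsto> (a\<^sub>0 h / a\<^sub>\<beta>) powr (1 / (\<beta> + 1))\<close>, where \<open>a\<^sub>\<beta> = c\<^sub>\<beta> / (\<beta> + 1)\<close>, turns it into a process with
  intensity parameter \<open>\<beta>\<close>, and since \<open>a\<^sub>\<beta> \<rightarrow> \<gamma>\<^sub>d\<close> the heights below \<open>\<gamma>\<^sub>d / a\<^sub>0\<close> tend to \<open>0\<close> and the others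
  to infinity as \<open>\<beta> \<rightarrow> -1\<close>. The points that stay form a homogeneous Poisson process of intensity \<open>\<gamma>\<^sub>d\<close>.
  Laws are compared through void probabilities only, which determine them on the \<open>\<sigma>\<close>-algebra
  generated by the void events; the hitting events of both skeletons belong to it.

  It remains to prove almost sure convergence of the coupled skeletons in the Fell topology, and
  then to apply dominated convergence. The Voronoi skeleton consists of the points with at least two
  power minimizers, the Delaunay skeleton of the facets spanned by \<open>d + 1\<close> common minimizers. A limit of
  tuples of distinct minimizers is a tuple of distinct minimizers, so no new points appear in the
  limit. A ball missed by a Voronoi skeleton lies in a single cell, and this passes to the limit; a
  Delaunay simplex of the limit survives small height changes because, almost surely, at most
  \<open>d + 2\<close> points \<open>v\<close> always have affinely independent lifts \<open>(v, |v|\<^sup>2)\<close>. Closedness of the Delaunay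
  skeleton uses that the points hit every far orthant, which bounds the centers of the simplices
  that meet a compact set.
\<close>

section \<open>Laguerre cells and the Voronoi skeleton\<close>

text \<open>The hypotheses give a separate probability space for each \<open>\<beta>\<close> and no
  joint law, so almost sure convergence has no meaning before a coupling exists; the conclusion
  depends on laws only, which allows the replacement. The height transformation is the quantile map
  between height measures: heights up to \<open>x\<close> have mass
  \<open>a_\<beta> x^(\<beta>+1)\<close> per unit of base volume. Its exponent
  \<open>1/(\<beta>+1)\<close> blows up, so a height goes to \<open>0\<close> or to infinity
  according to whether \<open>a_0 h\<close> is below or above \<open>\<gamma>_d\<close>. Base points
  never move. A convergent sequence of points therefore ends on one vertical line, and two points of
  one line cannot tie; this is what keeps the vertices of a limit simplex apart. The two halves of
  Fell convergence differ in nature. Missing a compact set is a matter of compactness. Hitting an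
  open set needs stability: a tie of exactly \<open>d + 1\<close> affinely independent points can be
  restored by moving the centre, whereas a tie of \<open>d + 2\<close> points can be broken by
  arbitrarily small changes of height.\<close>

definition admissible :: "('a::euclidean_space \<times> real) set \<Rightarrow> bool" where
  "admissible A \<longleftrightarrow> (\<forall>K. compact K \<longrightarrow> finite (A \<inter> K)) \<and> (\<forall>p\<in>A. 0 \<le> snd p)"

definition minimizers :: "'a::euclidean_space \<Rightarrow> ('a \<times> real) set \<Rightarrow> ('a \<times> real) set" where
  "minimizers w A = {p \<in> A. w \<in> laguerre_cell p A}"

lemma mem_minimizers: "p \<in> minimizers w A \<longleftrightarrow> p \<in> A \<and> (\<forall>q\<in>A. pow w p \<le> pow w q)"
  by (auto simp: minimizers_def laguerre_cell_def)

lemma minimizers_subset: "minimizers w A \<subseteq> A"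
  by (auto simp: minimizers_def)

lemma pow_minimizers_eq: "p \<in> minimizers w A \<Longrightarrow> q \<in> minimizers w A \<Longrightarrow> pow w p = pow w q"
  by (meson mem_minimizers order_antisym)

lemma tendsto_pow [tendsto_intros]:
  assumes "(f \<longlongrightarrow> w) F" "(g \<longlongrightarrow> p) F"
  shows "((\<lambda>x. pow (f x) (g x)) \<longlongrightarrow> pow w p) F"
  unfolding pow_def by (intro tendsto_intros assms)

lemma continuous_on_pow [continuous_intros]:
  assumes "continuous_on S f" "continuous_on S g"
  shows "continuous_on S (\<lambda>x. pow (f x) (g x))"
  unfolding pow_def by (intro continuous_intros assms)

text \<open>The square of \<open>norm w\<close> cancels, so comparing two powers is an affine
  condition on \<open>w\<close> and bisectors are hyperplanes.\<close>

lemma pow_diff_affine: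
  "pow w p - pow w q = (norm (fst p))\<^sup>2 - (norm (fst q))\<^sup>2 + snd p - snd q - 2 * (w \<bullet> (fst p - fst q))"
  by (simp add: pow_def power2_norm_eq_inner inner_diff inner_commute algebra_simps)

lemma closed_laguerre_cell: "closed (laguerre_cell p A)"
proof -
  have "laguerre_cell p A = (\<Inter>q\<in>A. {w. pow w p \<le> pow w q})"
    by (auto simp: laguerre_cell_def)
  also have "closed \<dots>"
    by (intro closed_INT ballI closed_Collect_le continuous_intros)
  finally show ?thesis .
qed

lemma norm_le_if_square_le:
  fixes x r :: real
  assumes "x\<^sup>2 \<le> r" shows "x \<le> \<bar>r\<bar> + 1"
proof (cases "x \<le> 1")
  case False
  then have "x \<le> x\<^sup>2" by (simp add: power2_eq_square)
  then show ?thesis using assms by linarith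
qed auto

text \<open>Nonnegative heights turn a power bound into bounds on base point and height. The radius
  \<open>R + |r| + 1\<close> stands in for \<open>R + sqrt r\<close> and is valid for
  \<open>r\<close> of any sign.\<close>

lemma pow_le_imp_mem:
  assumes "pow w p \<le> r" "w \<in> cball c R" "0 \<le> snd p"
  shows "p \<in> cball c (R + \<bar>r\<bar> + 1) \<times> {0..\<bar>r\<bar>}"
proof -
  have "(norm (w - fst p))\<^sup>2 \<le> r" and 2: "snd p \<le> r"
    using assms zero_le_power2[of "norm (w - fst p)"] unfolding pow_def by linarith+
  then have "norm (w - fst p) \<le> \<bar>r\<bar> + 1" by (intro norm_le_if_square_le)
  then have "dist c (fst p) \<le> R + \<bar>r\<bar> + 1"
    using assms(2) dist_triangle[of c "fst p" w] by (simp add: dist_norm)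
  then show ?thesis using assms 2 by (cases p) auto
qed

lemma admissible_finite_low:
  assumes "admissible A"
  shows "finite {p \<in> A. \<exists>w\<in>cball c R. pow w p \<le> r}"
proof (rule finite_subset)
  show "{p \<in> A. \<exists>w\<in>cball c R. pow w p \<le> r} \<subseteq> A \<inter> cball c (R + \<bar>r\<bar> + 1) \<times> {0..\<bar>r\<bar>}"
    using pow_le_imp_mem assms unfolding admissible_def by blast
  show "finite (A \<inter> cball c (R + \<bar>r\<bar> + 1) \<times> {0..\<bar>r\<bar>})"
    using assms compact_Times[OF compact_cball compact_Icc] unfolding admissible_def by blast
qed

lemma minimizers_nonempty:
  assumes "admissible A" "A \<noteq> {}"
  shows "minimizers w A \<noteq> {}"
proof -
  obtain q where q: "q \<in> A" using assms by auto
  let ?S = "{p \<in> A. pow w p \<le> pow w q}"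
  have fin: "finite ?S"
    using admissible_finite_low[OF assms(1), of w 0 "pow w q"] by simp
  have "q \<in> ?S" using q by simp
  define p where "p = arg_min_on (pow w) ?S"
  have p: "p \<in> ?S" "\<And>p'. p' \<in> ?S \<Longrightarrow> pow w p \<le> pow w p'"
    unfolding p_def using arg_min_if_finite(1)[OF fin, of "pow w"] arg_min_least[OF fin, of _ "pow w"] \<open>q \<in> ?S\<close>
    by blast+
  then have "p \<in> minimizers w A"
    unfolding mem_minimizers by (smt (verit) mem_Collect_eq)
  then show ?thesis by auto
qed

lemma finite_minimizers:
  assumes "admissible A"
  shows "finite (minimizers w A)"
proof (cases "minimizers w A = {}")
  case False
  then obtain q where "q \<in> minimizers w A" by auto
  then have "minimizers w A \<subseteq> {p \<in> A. \<exists>w'\<in>cball w 0. pow w' p \<le> pow w q}"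
    by (auto simp: mem_minimizers)
  then show ?thesis using admissible_finite_low[OF assms, of w 0 "pow w q"] by (rule finite_subset)
qed auto

text \<open>Upper semicontinuity: near \<open>w\<close> only finitely many points can compete, and
  each of them that is not minimal at \<open>w\<close> loses strictly there, hence also in a
  neighbourhood.\<close>

lemma minimizers_nearby:
  assumes "admissible A"
  obtains e where "e > 0" "\<And>w'. w' \<in> ball w e \<Longrightarrow> minimizers w' A \<subseteq> minimizers w A"
proof (cases "A = {}")
  case True
  then show ?thesis using that[of 1] by (auto simp: minimizers_def)
next
  case False
  then obtain m where m: "m \<in> minimizers w A" using minimizers_nonempty[OF assms] by blast
  \<comment> \<open>By the triangle inequality \<open>r\<close> bounds the power of \<open>m\<close>
    on the whole unit ball around \<open>w\<close>, so every minimizer at a point of that ball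
    belongs to the finite set \<open>S\<close>.\<close>
  define r where "r = (1 + norm (w - fst m))\<^sup>2 + snd m"
  define S where "S = {p\<in>A. \<exists>w'\<in>cball w 1. pow w' p \<le> r}"
  have "finite S" unfolding S_def by (rule admissible_finite_low[OF assms])
  moreover have "\<forall>\<^sub>F w' in nhds w. pow w' m < pow w' p" if "p \<in> S - minimizers w A" for p
  proof -
    have "pow w m < pow w p"
      using that m unfolding S_def by (smt (verit) DiffD1 DiffD2 mem_Collect_eq mem_minimizers)
    moreover have "((\<lambda>w'. pow w' p - pow w' m) \<longlongrightarrow> pow w p - pow w m) (nhds w)"
      by (intro tendsto_intros filterlim_ident)
    ultimately have "\<forall>\<^sub>F w' in nhds w. 0 < pow w' p - pow w' m"
      by (intro order_tendstoD(1)) auto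
    then show ?thesis by simp
  qed
  ultimately have "\<forall>\<^sub>F w' in nhds w. \<forall>p\<in>S - minimizers w A. pow w' m < pow w' p"
    by (intro eventually_ball_finite) auto
  then obtain d where d: "d > 0" "\<And>w' p. dist w' w < d \<Longrightarrow> p \<in> S - minimizers w A \<Longrightarrow> pow w' m < pow w' p"
    unfolding eventually_nhds_metric by blast
  show ?thesis
  proof (rule that[of "min d 1"])
    fix w' assume w': "w' \<in> ball w (min d 1)"
    show "minimizers w' A \<subseteq> minimizers w A"
    proof
      fix p assume p: "p \<in> minimizers w' A"
      have "norm (w' - fst m) \<le> 1 + norm (w - fst m)"
        using w' norm_triangle_ineq[of "w' - w" "w - fst m"] by (simp add: dist_norm norm_minus_commute)
      then have "pow w' m \<le> r" unfolding r_def pow_def by (simp add: power_mono)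
      moreover have le: "pow w' p \<le> pow w' m" using p m by (auto simp: mem_minimizers)
      moreover have "w' \<in> cball w 1" using w' by auto
      ultimately have "p \<in> S" using p unfolding S_def mem_minimizers by (blast intro: order_trans)
      then show "p \<in> minimizers w A"
        using d(2)[of w' p] w' le by (auto simp: dist_commute)
    qed
  qed (use d in auto)
qed

text \<open>Over a common base point powers differ by the heights, so two such points never
  tie.\<close>

lemma minimizers_fst_neq:
  assumes "p \<in> minimizers w A" "q \<in> minimizers w A" "p \<noteq> q"
  shows "fst p \<noteq> fst q"
proof
  assume "fst p = fst q"
  with pow_minimizers_eq[OF assms(1,2)] assms(3) show False
    by (auto simp: pow_def prod_eq_iff)
qed

text \<open>If \<open>q\<close> tied with \<open>p\<close> at \<open>w\<close>, a small step in the
  direction \<open>fst q - fst p\<close> would make \<open>q\<close> strictly better, by affinity of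
  the power difference, and so leave the cell of \<open>p\<close>.\<close>

lemma interior_cell_unique_minimizer:
  assumes "w \<in> interior (laguerre_cell p A)" "p \<in> A" "q \<in> minimizers w A"
  shows "q = p"
proof (rule ccontr)
  assume "q \<noteq> p"
  have wp: "w \<in> laguerre_cell p A" using assms(1) interior_subset by blast
  then have p: "p \<in> minimizers w A" using assms by (auto simp: minimizers_def)
  let ?u = "fst q - fst p"
  have u: "?u \<noteq> 0" using minimizers_fst_neq[OF assms(3) p \<open>q \<noteq> p\<close>] by simp
  obtain e where e: "e > 0" "ball w e \<subseteq> laguerre_cell p A"
    using assms(1) mem_interior by blast
  define t where "t = e / (2 * norm ?u)"
  have t: "t > 0" using e u by (simp add: t_def)
  have "w + t *\<^sub>R ?u \<in> ball w e" using u e by (simp add: dist_norm t_def)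
  then have "pow (w + t *\<^sub>R ?u) p \<le> pow (w + t *\<^sub>R ?u) q"
    using e assms(3) by (auto simp: laguerre_cell_def mem_minimizers)
  moreover have "pow w p = pow w q" by (rule pow_minimizers_eq[OF p assms(3)])
  ultimately have "(t *\<^sub>R ?u) \<bullet> ?u \<le> 0"
    using pow_diff_affine[of "w + t *\<^sub>R ?u" q p] pow_diff_affine[of w q p]
    by (simp add: inner_add_left)
  then show False using t u by (simp add: mult_le_0_iff) (metis inner_gt_zero_iff not_le right_minus_eq)
qed

definition voronoi_skel :: "('a::euclidean_space \<times> real) set \<Rightarrow> 'a set" where
  "voronoi_skel A = {w. \<exists>p\<in>minimizers w A. \<exists>q\<in>minimizers w A. p \<noteq> q}"

lemma unique_minimizer_interior:
  assumes "admissible A" "minimizers w A = {p}"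
  shows "w \<in> interior (laguerre_cell p A)"
proof -
  have "A \<noteq> {}" using assms(2) by (auto simp: minimizers_def)
  obtain e where e: "e > 0" "\<And>w'. w' \<in> ball w e \<Longrightarrow> minimizers w' A \<subseteq> minimizers w A"
    using minimizers_nearby[OF assms(1)] by metis
  have "ball w e \<subseteq> laguerre_cell p A"
  proof
    fix w' assume "w' \<in> ball w e"
    with e minimizers_nonempty[OF assms(1) \<open>A \<noteq> {}\<close>, of w'] assms(2) have "p \<in> minimizers w' A"
      by (metis subset_singletonD singletonI)
    then show "w' \<in> laguerre_cell p A" by (simp add: minimizers_def)
  qed
  then show ?thesis using e(1) by (auto simp: mem_interior)
qed

lemma closed_finite_Union_empty_interior:
  assumes "finite F" "\<And>S. S \<in> F \<Longrightarrow> closed S \<and> interior S = {}"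
  shows "interior (\<Union>F) = {}"
  using assms
proof (induction F)
  case (insert S F)
  then show ?case
    using interior_closed_Un_empty_interior[of S "\<Union>F"] by auto
qed auto

text \<open>Only cells with interior enter \<open>skel\<close>, so a tie must be located on the
  frontier of such a cell. Near a tie point \<open>w\<close> the finitely many cells of the
  minimizers at \<open>w\<close> cover a ball, hence one of them has interior; \<open>w\<close> is
  not in that interior because interior points have a single minimizer.\<close>

lemma skel_laguerre_diagram:
  assumes "admissible A"
  shows "skel (laguerre_diagram A) = voronoi_skel A"
proof (intro set_eqI iffI)
  fix w assume "w \<in> skel (laguerre_diagram A)"
  then obtain p where p: "p \<in> A" "w \<in> frontier (laguerre_cell p A)"
    by (auto simp: skel_def laguerre_diagram_def)
  then have w: "w \<in> laguerre_cell p A" "w \<notin> interior (laguerre_cell p A)"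
    using closed_laguerre_cell[of p A] by (auto simp: frontier_def)
  then have "p \<in> minimizers w A" using p by (simp add: minimizers_def)
  moreover have "minimizers w A \<noteq> {p}" using unique_minimizer_interior[OF assms] w by blast
  ultimately show "w \<in> voronoi_skel A" by (auto simp: voronoi_skel_def)
next
  fix w assume "w \<in> voronoi_skel A"
  then obtain p q where pq: "p \<in> minimizers w A" "q \<in> minimizers w A" "p \<noteq> q"
    by (auto simp: voronoi_skel_def)
  then have "A \<noteq> {}" by (auto simp: minimizers_def)
  obtain e where e: "e > 0" "\<And>w'. w' \<in> ball w e \<Longrightarrow> minimizers w' A \<subseteq> minimizers w A"
    using minimizers_nearby[OF assms] by metis
  let ?F = "(\<lambda>p. laguerre_cell p A) ` minimizers w A"
  have "ball w e \<subseteq> \<Union>?F"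
  proof
    fix w' assume "w' \<in> ball w e"
    with e minimizers_nonempty[OF assms \<open>A \<noteq> {}\<close>, of w'] obtain r
      where "r \<in> minimizers w' A" "r \<in> minimizers w A" by blast
    then show "w' \<in> \<Union>?F" unfolding minimizers_def by blast
  qed
  then have "interior (\<Union>?F) \<noteq> {}" using e(1) mem_interior by blast
  then obtain r where r: "r \<in> minimizers w A" "interior (laguerre_cell r A) \<noteq> {}"
    using closed_finite_Union_empty_interior[of ?F] finite_minimizers[OF assms] closed_laguerre_cell
    by blast
  have "r \<in> A" "w \<in> laguerre_cell r A" using r by (auto simp: minimizers_def)
  moreover have "w \<notin> interior (laguerre_cell r A)"
    using interior_cell_unique_minimizer[of w r A] pq \<open>r \<in> A\<close> by metis
  ultimately have "w \<in> frontier (laguerre_cell r A)"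
    using closed_laguerre_cell[of r A] by (simp add: frontier_def)
  then show "w \<in> skel (laguerre_diagram A)"
    using r \<open>r \<in> A\<close> unfolding skel_def laguerre_diagram_def by blast
qed

text \<open>Without ties on \<open>G\<close>, membership in the cell of \<open>p\<close> is
  relatively open as well as relatively closed in \<open>G\<close>, so connectedness
  decides.\<close>

lemma connected_disjoint_voronoi_skel:
  assumes "admissible A" "A \<noteq> {}" "connected G" "G \<noteq> {}" "voronoi_skel A \<inter> G = {}"
  obtains p where "p \<in> A" "G \<subseteq> laguerre_cell p A"
proof -
  obtain x where x: "x \<in> G" using assms by auto
  obtain p where p: "p \<in> minimizers x A" using minimizers_nonempty[OF assms(1,2)] by blast
  have unique: "w \<in> interior (laguerre_cell p A)" if "w \<in> G" "w \<in> laguerre_cell p A" for w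
  proof -
    have "p \<in> minimizers w A" using that p by (auto simp: minimizers_def)
    moreover have "w \<notin> voronoi_skel A" using assms(5) that by auto
    ultimately have "minimizers w A = {p}" by (auto simp: voronoi_skel_def)
    then show ?thesis by (rule unique_minimizer_interior[OF assms(1)])
  qed
  have "openin (top_of_set G) (G \<inter> laguerre_cell p A)"
  proof -
    have "G \<inter> laguerre_cell p A = G \<inter> interior (laguerre_cell p A)"
      using unique interior_subset by blast
    then show ?thesis by (metis open_interior openin_open_Int)
  qed
  moreover have "closedin (top_of_set G) (G \<inter> laguerre_cell p A)"
    by (simp add: closed_laguerre_cell closedin_closed_Int)
  moreover have "x \<in> G \<inter> laguerre_cell p A" using x p by (auto simp: minimizers_def)
  ultimately have "G \<inter> laguerre_cell p A = G"
    using assms(3) connected_clopen by (metis empty_iff)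
  then show ?thesis using that[of p] p by (auto simp: minimizers_def)
qed

lemma frontier_convex_hull_facets:
  fixes U :: "'a::euclidean_space set"
  assumes "finite U" "card U = DIM('a) + 1"
  shows "frontier (convex hull U) = (\<Union>v\<in>U. convex hull (U - {v}))"
proof (cases "affine_dependent U")
  case False
  then have "aff_dim U = DIM('a)" using assms aff_dim_affine_independent[OF False] by simp
  then have "affine hull U = UNIV" by (simp add: affine_hull_UNIV)
  then have "frontier (convex hull U) = rel_frontier (convex hull U)"
    by (simp add: affine_hull_convex_hull rel_frontier_frontier)
  also have "\<dots> = (\<Union>v\<in>U. convex hull (U - {v}))"
    unfolding rel_frontier_convex_hull_cases[OF False] by auto
  finally show ?thesis .
next
  case True
  have "aff_dim U < DIM('a)"
  proof (rule ccontr)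
    assume "\<not> aff_dim U < DIM('a)"
    then have "aff_dim U = int (card U) - 1" using aff_dim_le_DIM[of U] assms by simp
    with True assms show False using affine_independent_iff_card by blast
  qed
  then have "interior (convex hull U) = {}" using aff_dim_nonempty_interior[of "convex hull U"]
    by (auto simp: aff_dim_convex_hull)
  then have "frontier (convex hull U) = convex hull U"
    using assms by (simp add: frontier_def finite_imp_compact_convex_hull compact_imp_closed)
  also have "\<dots> = (\<Union>v\<in>U. convex hull (U - {v}))"
  proof (intro equalityI subsetI)
    fix x assume "x \<in> convex hull U"
    then obtain S where S: "finite S" "S \<subseteq> U" "card S \<le> aff_dim U + 1" "x \<in> convex hull S"
      unfolding caratheodory_aff_dim[of U] by auto
    then have "card S < card U" using \<open>aff_dim U < DIM('a)\<close> assms by linarith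
    then obtain v where "v \<in> U" "v \<notin> S" using S by (metis less_irrefl subsetI subset_antisym)
    then have "convex hull S \<subseteq> convex hull (U - {v})" using S by (intro hull_mono) auto
    then show "x \<in> (\<Union>v\<in>U. convex hull (U - {v}))" using S \<open>v \<in> U\<close> by auto
  next
    fix x assume "x \<in> (\<Union>v\<in>U. convex hull (U - {v}))"
    then show "x \<in> convex hull U" using hull_mono[of _ U convex] by blast
  qed
  finally show ?thesis .
qed

section \<open>Convergence of configurations\<close>

lemma finite_common_subseq:
  fixes x :: "nat \<Rightarrow> 'i \<Rightarrow> 'a::heine_borel"
  assumes "finite I" "\<And>i. i \<in> I \<Longrightarrow> bounded (range (\<lambda>n. x n i))"
  obtains l r where "strict_mono (r :: nat \<Rightarrow> nat)" "\<And>i. i \<in> I \<Longrightarrow> (\<lambda>n. x (r n) i) \<longlonglongrightarrow> l i"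
proof -
  have "\<exists>l r. strict_mono (r :: nat \<Rightarrow> nat) \<and> (\<forall>i\<in>I. (\<lambda>n. x (r n) i) \<longlonglongrightarrow> l i)"
    using assms
  proof (induction I)
    case empty
    then show ?case by (intro exI[of _ undefined] exI[of _ id]) (simp add: strict_mono_id)
  next
    case (insert i F)
    then obtain l r where lr: "strict_mono (r :: nat \<Rightarrow> nat)" "\<forall>j\<in>F. (\<lambda>n. x (r n) j) \<longlonglongrightarrow> l j" by auto
    have "bounded (range (\<lambda>n. x (r n) i))"
      by (rule bounded_subset[OF insert.prems]) auto
    then obtain r' y where r': "strict_mono (r' :: nat \<Rightarrow> nat)" "((\<lambda>n. x (r n) i) \<circ> r') \<longlonglongrightarrow> y"
      using bounded_imp_convergent_subsequence by blast
    show ?case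
    proof (intro exI conjI ballI)
      show "strict_mono (r \<circ> r')" using lr r' by (simp add: strict_mono_o)
      fix j assume "j \<in> insert i F"
      show "(\<lambda>n. x ((r \<circ> r') n) j) \<longlonglongrightarrow> (l(i := y)) j"
      proof (cases "j = i")
        case True
        then show ?thesis using r' by (simp add: o_def)
      next
        case False
        then have "j \<in> F" using \<open>j \<in> insert i F\<close> by auto
        then have "((\<lambda>n. x (r n) j) \<circ> r') \<longlonglongrightarrow> l j" using lr r' LIMSEQ_subseq_LIMSEQ by blast
        then show ?thesis using False by (simp add: o_def)
      qed
    qed
  qed
  then show thesis using that by blast
qed

lemma not_eventually_subseq:
  assumes "\<not> (\<forall>\<^sub>F n in sequentially. P n)"
  obtains r :: "nat \<Rightarrow> nat" where "strict_mono r" "\<And>n. \<not> P (r n)"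
proof -
  have inf: "infinite {n. \<not> P n}"
    using assms unfolding eventually_sequentially infinite_nat_iff_unbounded_le by auto
  show thesis
    by (rule that[of "enumerate {n. \<not> P n}"])
       (use enumerate_in_set[OF inf] strict_mono_enumerate[OF inf] in auto)
qed

text \<open>Set convergence in the sense of Painleve and Kuratowski, sharpened by the rigidity of
  base points: approximants lie exactly above the base point of their limit, and convergent
  sequences eventually do. The quantification over subsequences \<open>r\<close> makes the notion
  usable in proofs by contradiction, where only infinitely many indices are available.\<close>

definition config_conv :: "(nat \<Rightarrow> ('a::euclidean_space \<times> real) set) \<Rightarrow> ('a \<times> real) set \<Rightarrow> bool" where
  "config_conv As A \<longleftrightarrow> (\<forall>n. admissible (As n)) \<and> admissible A \<and> A \<noteq> {} \<and>
     (\<forall>q\<in>A. \<exists>qs. (\<forall>n. qs n \<in> As n \<and> fst (qs n) = fst q) \<and> qs \<longlonglongrightarrow> q) \<and>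
     (\<forall>r p l. strict_mono r \<longrightarrow> (\<forall>n. p n \<in> As (r n)) \<longrightarrow> p \<longlonglongrightarrow> l \<longrightarrow>
        l \<in> A \<and> (\<forall>\<^sub>F n in sequentially. fst (p n) = fst l))"

lemma config_conv_approx:
  assumes "config_conv As A" "q \<in> A"
  obtains qs where "\<And>n. qs n \<in> As n" "\<And>n. fst (qs n) = fst q" "qs \<longlonglongrightarrow> q"
  using assms unfolding config_conv_def by metis

lemma config_conv_limit:
  assumes "config_conv As A" "strict_mono r" "\<And>n. p n \<in> As (r n)" "p \<longlonglongrightarrow> l"
  shows "l \<in> A" "\<forall>\<^sub>F n in sequentially. fst (p n) = fst l"
  using assms unfolding config_conv_def by blast+

lemma config_conv_subseq:
  assumes "config_conv As A" "strict_mono s"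
  shows "config_conv (As \<circ> s) A"
  unfolding config_conv_def
proof (intro conjI allI ballI impI)
  fix q assume "q \<in> A"
  then obtain qs where qs: "\<And>n. qs n \<in> As n" "\<And>n. fst (qs n) = fst q" "qs \<longlonglongrightarrow> q"
    using config_conv_approx[OF assms(1)] by metis
  then show "\<exists>qs. (\<forall>n. qs n \<in> (As \<circ> s) n \<and> fst (qs n) = fst q) \<and> qs \<longlonglongrightarrow> q"
    using LIMSEQ_subseq_LIMSEQ[OF qs(3) assms(2)] by (intro exI[of _ "qs \<circ> s"]) auto
next
  fix r p l assume r: "strict_mono r" "\<forall>n. p n \<in> (As \<circ> s) (r n)" "p \<longlonglongrightarrow> l"
  have "strict_mono (s \<circ> r)" using r assms by (simp add: strict_mono_o)
  then show "l \<in> A" "\<forall>\<^sub>F n in sequentially. fst (p n) = fst l"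
    using config_conv_limit[OF assms(1), of "s \<circ> r" p l] r by auto
qed (use assms in \<open>auto simp: config_conv_def\<close>)

lemma admissible_closed:
  assumes "admissible A" shows "closed A"
proof -
  have "l \<in> A" if f: "\<forall>n. f n \<in> A" "f \<longlonglongrightarrow> l" for f l
  proof -
    have "finite (A \<inter> cball l 1)" using assms by (simp add: admissible_def)
    then have "closed (A \<inter> cball l 1)" by (rule finite_imp_closed)
    moreover have "\<forall>\<^sub>F n in sequentially. f n \<in> A \<inter> cball l 1"
      using tendstoD[OF f(2), of 1] f(1) by (auto elim!: eventually_mono simp: dist_commute)
    ultimately have "l \<in> A \<inter> cball l 1" by (rule Lim_in_closed_set[OF _ _ trivial_limit_sequentially f(2)])
    then show ?thesis by auto
  qed
  then show ?thesis unfolding closed_sequential_limits by blast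
qed

lemma finite_set_limit_eventually_eq:
  fixes f :: "nat \<Rightarrow> 'a::t1_space"
  assumes "finite S" "\<forall>\<^sub>F n in sequentially. f n \<in> S" "f \<longlonglongrightarrow> l"
  shows "\<forall>\<^sub>F n in sequentially. f n = l"
proof -
  have "open (- (S - {l}))" using assms(1) by (intro open_Compl finite_imp_closed) auto
  then have "\<forall>\<^sub>F n in sequentially. f n \<in> - (S - {l})" using assms(3) by (auto dest: topological_tendstoD)
  then show ?thesis using assms(2) by eventually_elim auto
qed

text \<open>Allows closedness of a single skeleton to be treated by the same limit argument as
  convergence of skeletons.\<close>

lemma config_conv_const:
  assumes "admissible A" "A \<noteq> {}"
  shows "config_conv (\<lambda>_. A) A"
  unfolding config_conv_def
proof (intro conjI allI ballI impI)
  fix q assume "q \<in> A"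
  then show "\<exists>qs. (\<forall>n. qs n \<in> A \<and> fst (qs n) = fst q) \<and> qs \<longlonglongrightarrow> q"
    by (intro exI[of _ "\<lambda>_. q"]) auto
next
  fix r :: "nat \<Rightarrow> nat" and p l assume p: "\<forall>n. p n \<in> A" "p \<longlonglongrightarrow> l"
  then show "l \<in> A" using admissible_closed[OF assms(1)] closed_sequentially by blast
  have "\<forall>\<^sub>F n in sequentially. p n \<in> cball l 1"
    using tendstoD[OF p(2), of 1] by (auto elim!: eventually_mono simp: dist_commute)
  then have "\<forall>\<^sub>F n in sequentially. p n \<in> A \<inter> cball l 1" using p by auto
  moreover have "finite (A \<inter> cball l 1)" using assms by (auto simp: admissible_def)
  ultimately have "\<forall>\<^sub>F n in sequentially. p n = l" using finite_set_limit_eventually_eq p(2) by blast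
  then show "\<forall>\<^sub>F n in sequentially. fst (p n) = fst l" by eventually_elim auto
qed (use assms in auto)

section \<open>Compactness of common minimizers\<close>

lemma pow_le_norms:
  assumes "norm w \<le> R" "norm q \<le> B"
  shows "pow w q \<le> (R + B)\<^sup>2 + B"
proof -
  have "norm (fst q) \<le> B" using assms norm_fst_le[of "fst q" "snd q"] by simp
  then have "norm (w - fst q) \<le> R + B" using assms norm_triangle_ineq4[of w "fst q"] by linarith
  moreover have "snd q \<le> B" using assms norm_snd_le[of "snd q" "fst q"] by simp
  ultimately show ?thesis unfolding pow_def by (simp add: add_mono power_mono)
qed

text \<open>Bounded centres give bounded minimizers, so a subsequence of all the points converges;
  minimality survives because every competitor in \<open>A\<close> is a limit of competitors in the
  \<open>As n\<close>.\<close>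

lemma minimizers_limit:
  assumes conv: "config_conv As A"
    and p: "\<And>n i. i < (m::nat) \<Longrightarrow> p n i \<in> minimizers (w n) (As n)"
    and inj: "\<And>n. inj_on (p n) {..<m}" and bnd: "bounded (range w)"
  shows "\<exists>s l w0. strict_mono (s :: nat \<Rightarrow> nat) \<and> (\<lambda>n. w (s n)) \<longlonglongrightarrow> w0 \<and> inj_on l {..<m} \<and>
    (\<forall>i<m. (\<lambda>n. p (s n) i) \<longlonglongrightarrow> l i \<and> l i \<in> minimizers w0 A \<and>
      (\<forall>\<^sub>F n in sequentially. fst (p (s n) i) = fst (l i)))"
proof -
  obtain q where "q \<in> A" using conv by (auto simp: config_conv_def)
  then obtain qs where qs: "\<And>n. qs n \<in> As n" "qs \<longlonglongrightarrow> q" using config_conv_approx[OF conv] by metis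
  obtain R where R: "\<And>n. norm (w n) \<le> R" using bnd by (auto simp: bounded_iff)
  obtain B where B: "\<And>n. norm (qs n) \<le> B"
    using convergent_imp_bounded[OF qs(2)] by (auto simp: bounded_iff)
  \<comment> \<open>The approximants \<open>qs n\<close> of one fixed point of \<open>A\<close> are
    competitors in every configuration, so their powers bound the minimal powers uniformly in
    \<open>n\<close>.\<close>
  define c where "c = (R + B)\<^sup>2 + B"
  have "p n i \<in> cball 0 (R + \<bar>c\<bar> + 1) \<times> {0..\<bar>c\<bar>}" if "i < m" for n i
  proof (rule pow_le_imp_mem)
    have "pow (w n) (p n i) \<le> pow (w n) (qs n)" using p[OF that] qs(1) by (auto simp: mem_minimizers)
    also have "\<dots> \<le> c" unfolding c_def by (rule pow_le_norms[OF R B])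
    finally show "pow (w n) (p n i) \<le> c" .
    have "p n i \<in> As n" using p[OF that] minimizers_subset by blast
    then show "0 \<le> snd (p n i)" using conv by (simp add: config_conv_def admissible_def)
  qed (use R in auto)
  moreover have "bounded (cball (0::'a) (R + \<bar>c\<bar> + 1) \<times> {0..\<bar>c\<bar>})"
    by (intro bounded_Times bounded_cball bounded_closed_interval)
  ultimately have pb: "bounded (range (\<lambda>n. p n i))" if "i < m" for i
    using that by (metis (no_types, lifting) bounded_subset image_subsetI)
  obtain r w0 where r: "strict_mono (r :: nat \<Rightarrow> nat)" "(w \<circ> r) \<longlonglongrightarrow> w0"
    using bounded_imp_convergent_subsequence[OF bnd] by blast
  have "bounded (range (\<lambda>n. p (r n) i))" if "i \<in> {..<m}" for i
    using that by (intro bounded_subset[OF pb[of i]]) auto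
  then obtain l r' where r': "strict_mono (r' :: nat \<Rightarrow> nat)" "\<And>i. i \<in> {..<m} \<Longrightarrow> (\<lambda>n. p (r (r' n)) i) \<longlonglongrightarrow> l i"
    using finite_common_subseq[of "{..<m}" "\<lambda>n. p (r n)"] by (metis finite_lessThan)
  define s where "s = r \<circ> r'"
  have s: "strict_mono s" using r r' by (simp add: s_def strict_mono_o)
  have ws: "(\<lambda>n. w (s n)) \<longlonglongrightarrow> w0"
    using LIMSEQ_subseq_LIMSEQ[OF r(2) r'(1)] by (simp add: s_def o_def)
  have ps: "(\<lambda>n. p (s n) i) \<longlonglongrightarrow> l i" if "i < m" for i using r'(2)[of i] that by (simp add: s_def)
  have pin: "p (s n) i \<in> As (s n)" if "i < m" for i n using p[OF that] minimizers_subset by blast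
  have lA: "l i \<in> A" and ev: "\<forall>\<^sub>F n in sequentially. fst (p (s n) i) = fst (l i)" if "i < m" for i
    using config_conv_limit[OF conv s, of "\<lambda>n. p (s n) i"] pin ps that by auto
  have lm: "l i \<in> minimizers w0 A" if "i < m" for i
    unfolding mem_minimizers
  proof (intro conjI ballI)
    fix q assume "q \<in> A"
    then obtain qs where qs: "\<And>n. qs n \<in> As n" "qs \<longlonglongrightarrow> q" using config_conv_approx[OF conv] by metis
    show "pow w0 (l i) \<le> pow w0 q"
    proof (rule LIMSEQ_le)
      show "(\<lambda>n. pow (w (s n)) (p (s n) i)) \<longlonglongrightarrow> pow w0 (l i)" by (intro tendsto_intros ws ps that)
      show "(\<lambda>n. pow (w (s n)) (qs (s n))) \<longlonglongrightarrow> pow w0 q"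
        using LIMSEQ_subseq_LIMSEQ[OF qs(2) s] by (intro tendsto_intros ws) (simp add: o_def)
      show "\<exists>N. \<forall>n\<ge>N. pow (w (s n)) (p (s n) i) \<le> pow (w (s n)) (qs (s n))"
        using p[OF that] qs(1) by (auto simp: mem_minimizers)
    qed
  qed (rule lA[OF that])
  \<comment> \<open>Equal limits would force equal base points far out in the sequence, and distinct
    points that tie cannot share a base point.\<close>
  have "inj_on l {..<m}"
  proof (rule inj_onI, simp)
    fix i j assume ij: "i < m" "j < m" "l i = l j"
    have "\<forall>\<^sub>F n in sequentially. fst (p (s n) i) = fst (p (s n) j)"
      using ev[OF ij(1)] ev[OF ij(2)] by eventually_elim (use ij in auto)
    then obtain n where "fst (p (s n) i) = fst (p (s n) j)"
      using eventually_happens' trivial_limit_sequentially by blast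
    then have "p (s n) i = p (s n) j" using minimizers_fst_neq[OF p[OF ij(1)] p[OF ij(2)]] by blast
    then show "i = j" using inj[of "s n"] ij by (auto simp: inj_on_def)
  qed
  then show ?thesis using s ws ps lm ev by blast
qed

text \<open>The common form of both hitting events: pairs of tied points describe the Voronoi
  skeleton, tuples of \<open>DIM('a) + 1\<close> tied points the Delaunay skeleton, and
  \<open>C\<close> says where the compact set is hit. Semicontinuity and measurability are thus
  proved once for both.\<close>

definition cluster :: "nat \<Rightarrow> ((nat \<Rightarrow> 'a::euclidean_space \<times> real) \<Rightarrow> 'a \<Rightarrow> bool) \<Rightarrow> ('a \<times> real) set \<Rightarrow> bool" where
  "cluster m C A \<longleftrightarrow> (\<exists>p w. (\<forall>i<m. p i \<in> minimizers w A) \<and> inj_on p {..<m} \<and> C p w)"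

definition closed_cond :: "nat \<Rightarrow> ((nat \<Rightarrow> 'a::euclidean_space \<times> real) \<Rightarrow> 'a \<Rightarrow> bool) \<Rightarrow> bool" where
  "closed_cond m C \<longleftrightarrow> (\<forall>ps ws p w. (\<forall>i<m. (\<lambda>n::nat. ps n i) \<longlonglongrightarrow> p i) \<longrightarrow> ws \<longlonglongrightarrow> w \<longrightarrow>
     (\<forall>n. C (ps n) (ws n)) \<longrightarrow> C p w)"

text \<open>Clusters along a subsequence would have bounded centres by \<open>bnd\<close>, hence
  converge to tied distinct points of \<open>A\<close>; closedness of \<open>C\<close> makes the
  limit a cluster again.\<close>

lemma cluster_eventually_not:
  assumes conv: "config_conv As A" and C: "closed_cond m C"
    and bnd: "\<And>n p w. (\<And>i. i < m \<Longrightarrow> p i \<in> minimizers w (As n)) \<Longrightarrow> C p w \<Longrightarrow> norm w \<le> M"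
    and no: "\<not> cluster m C A"
  shows "\<forall>\<^sub>F n in sequentially. \<not> cluster m C (As n)"
proof (rule ccontr)
  assume "\<not> ?thesis"
  then obtain r :: "nat \<Rightarrow> nat" where r: "strict_mono r" "\<And>n. cluster m C (As (r n))"
    using not_eventually_subseq[of "\<lambda>n. \<not> cluster m C (As n)"] by metis
  then obtain p w where pw: "\<And>n i. i < m \<Longrightarrow> p n i \<in> minimizers (w n) (As (r n))"
      "\<And>n. inj_on (p n) {..<m}" "\<And>n. C (p n) (w n)"
    unfolding cluster_def by metis
  have "norm (w n) \<le> M" for n using bnd pw by metis
  then have "bounded (range w)" by (auto simp: bounded_iff intro!: exI[of _ M])
  moreover have "config_conv (As \<circ> r) A" using conv r by (simp add: config_conv_subseq)
  ultimately obtain s l w0 where s: "strict_mono (s :: nat \<Rightarrow> nat)" "(\<lambda>n. w (s n)) \<longlonglongrightarrow> w0"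
    "\<forall>i<m. (\<lambda>n. p (s n) i) \<longlonglongrightarrow> l i \<and> l i \<in> minimizers w0 A \<and>
      (\<forall>\<^sub>F n in sequentially. fst (p (s n) i) = fst (l i))" "inj_on l {..<m}"
    using minimizers_limit[of "As \<circ> r" A m p w] pw(1,2) unfolding o_def by blast
  have "C l w0"
    using C[unfolded closed_cond_def, rule_format, of "\<lambda>n. p (s n)" l "\<lambda>n. w (s n)" w0] s pw(3)
    by blast
  then have "cluster m C A" using s unfolding cluster_def by blast
  with no show False by simp
qed

section \<open>Semicontinuity of the Voronoi skeleton\<close>

lemma voronoi_skel_hits_iff:
  "voronoi_skel A \<inter> K \<noteq> {} \<longleftrightarrow> cluster 2 (\<lambda>p w. w \<in> K) A"
proof
  assume "voronoi_skel A \<inter> K \<noteq> {}"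
  then obtain w p q where w: "w \<in> K" "p \<in> minimizers w A" "q \<in> minimizers w A" "p \<noteq> q"
    unfolding voronoi_skel_def by blast
  then show "cluster 2 (\<lambda>p w. w \<in> K) A" unfolding cluster_def
    by (intro exI[of _ "\<lambda>i. if i = 0 then p else q"] exI[of _ w]) (auto simp: inj_on_def less_2_cases_iff)
next
  assume "cluster 2 (\<lambda>p w. w \<in> K) A"
  then obtain p w where p: "\<forall>i<2. p i \<in> minimizers w A" "inj_on p {..<2::nat}" "w \<in> K"
    unfolding cluster_def by blast
  then have "p 0 \<noteq> p 1" unfolding inj_on_def by (metis lessThan_iff one_less_numeral_iff pos2 semiring_norm(76) zero_neq_one)
  moreover have "p 0 \<in> minimizers w A" "p 1 \<in> minimizers w A" using p by auto
  ultimately show "voronoi_skel A \<inter> K \<noteq> {}" using p(3) unfolding voronoi_skel_def by blast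
qed

lemma closed_cond_voronoi: "closed K \<Longrightarrow> closed_cond m (\<lambda>p w. w \<in> K)"
  unfolding closed_cond_def using closed_sequentially by blast

lemma voronoi_skel_eventually_misses:
  assumes "config_conv As A" "compact K" "voronoi_skel A \<inter> K = {}"
  shows "\<forall>\<^sub>F n in sequentially. voronoi_skel (As n) \<inter> K = {}"
proof -
  obtain M where "\<And>w. w \<in> K \<Longrightarrow> norm w \<le> M"
    using compact_imp_bounded[OF assms(2)] by (auto simp: bounded_iff)
  then have "\<forall>\<^sub>F n in sequentially. \<not> cluster 2 (\<lambda>p w. w \<in> K) (As n)"
    using assms(3) closed_cond_voronoi[OF compact_imp_closed[OF assms(2)]] voronoi_skel_hits_iff[of A K]
    by (intro cluster_eventually_not[OF assms(1), of 2 _ M]) blast+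
  then show ?thesis
    by (rule eventually_mono) (use voronoi_skel_hits_iff[of _ K] in blast)
qed

lemma closed_voronoi_skel:
  assumes "admissible A"
  shows "closed (voronoi_skel A)"
proof -
  have "open (- voronoi_skel A)"
    unfolding open_contains_ball
  proof
    fix w assume w: "w \<in> - voronoi_skel A"
    obtain e where "e > 0" and "\<And>w'. w' \<in> ball w e \<Longrightarrow> minimizers w' A \<subseteq> minimizers w A"
      using minimizers_nearby[OF assms] by metis
    moreover from this have "ball w e \<subseteq> - voronoi_skel A"
      using w unfolding voronoi_skel_def subset_iff Compl_iff mem_Collect_eq by metis
    ultimately show "\<exists>e>0. ball w e \<subseteq> - voronoi_skel A" by blast
  qed
  then show ?thesis by (simp add: closed_def)
qed

lemma voronoi_skel_eventually_hits:
  assumes conv: "config_conv As A" and "open G" "voronoi_skel A \<inter> G \<noteq> {}"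
  shows "\<forall>\<^sub>F n in sequentially. voronoi_skel (As n) \<inter> G \<noteq> {}"
proof (rule ccontr)
  assume "\<not> ?thesis"
  then obtain r :: "nat \<Rightarrow> nat" where r: "strict_mono r" "\<And>n. voronoi_skel (As (r n)) \<inter> G = {}"
    using not_eventually_subseq[of "\<lambda>n. voronoi_skel (As n) \<inter> G \<noteq> {}"] by metis
  obtain w p q where w: "w \<in> G" "p \<in> minimizers w A" "q \<in> minimizers w A" "p \<noteq> q"
    using assms(3) unfolding voronoi_skel_def by blast
  obtain e where e: "e > 0" "ball w e \<subseteq> G" using assms(2) w(1) openE by blast
  have conv': "config_conv (As \<circ> r) A" using conv r by (simp add: config_conv_subseq)
  obtain qs where qs: "\<And>n. qs n \<in> As n" using config_conv_approx[OF conv] w(2) minimizers_subset by (metis subsetD)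
  have "\<exists>a. a \<in> As (r n) \<and> ball w e \<subseteq> laguerre_cell a (As (r n))" for n
  proof -
    have "admissible (As (r n))" using conv by (auto simp: config_conv_def)
    moreover have "As (r n) \<noteq> {}" using qs by blast
    ultimately show ?thesis
      using connected_disjoint_voronoi_skel[of "As (r n)" "ball w e"] r(2)[of n] e
      by (metis (no_types, lifting) ball_eq_empty connected_ball inf.absorb_iff2 inf_assoc inf_bot_left inf_commute not_le)
  qed
  then obtain a where a: "\<And>n. a n \<in> As (r n)" "\<And>n. ball w e \<subseteq> laguerre_cell (a n) (As (r n))" by metis
  have mn: "a n \<in> minimizers w (As (r n))" for n using a(1)[of n] a(2)[of n] e(1) by (auto simp: minimizers_def)
  have aw: "pow w' (a n) \<le> pow w' b" if "w' \<in> ball w e" "b \<in> As (r n)" for w' b n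
    using a(2)[of n] that by (auto simp: laguerre_cell_def)
  \<comment> \<open>Each owner \<open>a n\<close> of the ball is a minimizer at its centre
    \<open>w\<close>, so the compactness lemma with a single index makes the owners converge along a
    subsequence.\<close>
  obtain s l w0 where s: "strict_mono (s :: nat \<Rightarrow> nat)" "(\<lambda>n. w) \<longlonglongrightarrow> w0"
    "(\<lambda>n. a (s n)) \<longlonglongrightarrow> l (0::nat)" "l 0 \<in> minimizers w0 A"
    using minimizers_limit[OF conv', of "1::nat" "\<lambda>n i. a n" "\<lambda>_. w"] mn by (auto simp: inj_on_def)
  define b where "b = l 0"
  have b: "(\<lambda>n. a (s n)) \<longlonglongrightarrow> b" "b \<in> A" using s minimizers_subset[of w0 A] unfolding b_def by auto
  have "ball w e \<subseteq> laguerre_cell b A"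
  proof
    fix w' assume w': "w' \<in> ball w e"
    have "pow w' b \<le> pow w' c" if "c \<in> A" for c
    proof -
      obtain cs where cs: "\<And>n. cs n \<in> As n" "cs \<longlonglongrightarrow> c" using config_conv_approx[OF conv \<open>c \<in> A\<close>] by metis
      have rs: "strict_mono (r \<circ> s)" using r s by (simp add: strict_mono_o)
      show ?thesis
      proof (rule LIMSEQ_le)
        show "(\<lambda>n. pow w' (a (s n))) \<longlonglongrightarrow> pow w' b" by (intro tendsto_intros b)
        show "(\<lambda>n. pow w' (cs (r (s n)))) \<longlonglongrightarrow> pow w' c"
          using LIMSEQ_subseq_LIMSEQ[OF cs(2) rs] by (intro tendsto_intros) (simp add: o_def)
        show "\<exists>N. \<forall>n\<ge>N. pow w' (a (s n)) \<le> pow w' (cs (r (s n)))" using aw[OF w'] cs(1) by blast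
      qed
    qed
    then show "w' \<in> laguerre_cell b A" by (simp add: laguerre_cell_def)
  qed
  then have "w \<in> interior (laguerre_cell b A)" using e(1) by (auto simp: mem_interior)
  then show False using interior_cell_unique_minimizer[of w b A] b(2) w by metis
qed

section \<open>The Delaunay skeleton\<close>

text \<open>The vanishing product says that some barycentric coordinate is zero, in a form that is stable
  under limits. Degenerate simplices are included: by Caratheodory they are covered by their facets.\<close>

definition on_facet :: "'a::euclidean_space \<Rightarrow> (nat \<Rightarrow> 'a \<times> real) \<Rightarrow> bool" where
  "on_facet x p \<longleftrightarrow> (\<exists>c. (\<forall>i\<le>DIM('a). 0 \<le> c i) \<and> (\<Prod>i\<le>DIM('a). c i) = 0 \<and>
     (\<Sum>i\<le>DIM('a). c i) = 1 \<and> (\<Sum>i\<le>DIM('a). c i *\<^sub>R fst (p i)) = x)"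

text \<open>Barycentric coordinates stay in the unit interval, so they converge along a subsequence,
  and all conditions on them are closed.\<close>

lemma on_facet_limit:
  fixes x :: "'a::euclidean_space"
  assumes "xs \<longlonglongrightarrow> x" "\<And>i. i \<le> DIM('a) \<Longrightarrow> (\<lambda>n. ps n i) \<longlonglongrightarrow> p i" "\<And>n. on_facet (xs n) (ps n)"
  shows "on_facet x p"
proof -
  obtain c where c: "\<And>n i. i \<le> DIM('a) \<Longrightarrow> 0 \<le> c n i" "\<And>n. (\<Prod>i\<le>DIM('a). c n i) = 0"
    "\<And>n. (\<Sum>i\<le>DIM('a). c n i) = 1" "\<And>n. (\<Sum>i\<le>DIM('a). c n i *\<^sub>R fst (ps n i)) = xs n"
    using assms(3) unfolding on_facet_def by metis
  have "c n i \<le> 1" if "i \<le> DIM('a)" for n i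
    using member_le_sum[of i "{..DIM('a)}" "c n"] c(1,3) that by auto
  then have "bounded (range (\<lambda>n. c n i))" if "i \<in> {..DIM('a)}" for i
    using that c(1) by (auto simp: bounded_iff intro!: exI[of _ 1])
  then obtain d r where r: "strict_mono (r :: nat \<Rightarrow> nat)" "\<And>i. i \<in> {..DIM('a)} \<Longrightarrow> (\<lambda>n. c (r n) i) \<longlonglongrightarrow> d i"
    using finite_common_subseq[of "{..DIM('a)}" c] by (metis finite_atMost)
  have d: "(\<lambda>n. c (r n) i) \<longlonglongrightarrow> d i" if "i \<le> DIM('a)" for i using r(2) that by simp
  have ps: "(\<lambda>n. ps (r n) i) \<longlonglongrightarrow> p i" if "i \<le> DIM('a)" for i
    using LIMSEQ_subseq_LIMSEQ[OF assms(2)[OF that] r(1)] by (simp add: o_def)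
  have xs: "(\<lambda>n. xs (r n)) \<longlonglongrightarrow> x" using LIMSEQ_subseq_LIMSEQ[OF assms(1) r(1)] by (simp add: o_def)
  show ?thesis unfolding on_facet_def
  proof (intro exI[of _ d] conjI allI impI)
    show "0 \<le> d i" if "i \<le> DIM('a)" for i
      by (rule LIMSEQ_le_const[OF d[OF that]]) (use c(1)[OF that] in auto)
    have "(\<lambda>n. \<Prod>i\<le>DIM('a). c (r n) i) \<longlonglongrightarrow> (\<Prod>i\<le>DIM('a). d i)" by (intro tendsto_prod d) simp
    then show "(\<Prod>i\<le>DIM('a). d i) = 0" using c(2) by (simp add: LIMSEQ_const_iff)
    have "(\<lambda>n. \<Sum>i\<le>DIM('a). c (r n) i) \<longlonglongrightarrow> (\<Sum>i\<le>DIM('a). d i)" by (intro tendsto_sum d) simp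
    then show "(\<Sum>i\<le>DIM('a). d i) = 1" using c(3) by (simp add: LIMSEQ_const_iff)
    have "(\<lambda>n. \<Sum>i\<le>DIM('a). c (r n) i *\<^sub>R fst (ps (r n) i)) \<longlonglongrightarrow> (\<Sum>i\<le>DIM('a). d i *\<^sub>R fst (p i))"
      by (intro tendsto_sum tendsto_scaleR tendsto_fst d ps) simp_all
    then have "(xs \<circ> r) \<longlonglongrightarrow> (\<Sum>i\<le>DIM('a). d i *\<^sub>R fst (p i))" using c(4) by (simp add: o_def)
    then show "(\<Sum>i\<le>DIM('a). d i *\<^sub>R fst (p i)) = x" using xs LIMSEQ_unique by (auto simp: o_def)
  qed
qed

text \<open>Injectivity of the base points identifies indices with vertices; with a repeated vertex
  a vanishing coefficient would not remove it from the hull.\<close>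

lemma on_facet_iff:
  fixes x :: "'a::euclidean_space"
  assumes inj: "inj_on (\<lambda>i. fst (p i)) {..DIM('a)}"
  shows "on_facet x p \<longleftrightarrow> x \<in> frontier (convex hull ((\<lambda>i. fst (p i)) ` {..DIM('a)}))"
proof -
  let ?v = "\<lambda>i. fst (p i)" and ?U = "(\<lambda>i. fst (p i)) ` {..DIM('a)}"
  have card: "card ?U = DIM('a) + 1" using card_image[OF inj] by simp
  show ?thesis
  proof
    assume "on_facet x p"
    then obtain c j where c: "\<And>i. i \<le> DIM('a) \<Longrightarrow> 0 \<le> c i" "(\<Sum>i\<le>DIM('a). c i) = 1"
      "(\<Sum>i\<le>DIM('a). c i *\<^sub>R ?v i) = x" and j: "j \<le> DIM('a)" "c j = 0"
      unfolding on_facet_def by auto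
    have "(\<Sum>i\<in>{..DIM('a)} - {j}. c i *\<^sub>R ?v i) \<in> convex hull (?U - {?v j})"
    proof (rule convex_sum)
      show "(\<Sum>i\<in>{..DIM('a)} - {j}. c i) = 1" using c(2) j by (subst sum_diff1) auto
      show "?v i \<in> convex hull (?U - {?v j})" if "i \<in> {..DIM('a)} - {j}" for i
        using inj that j by (intro hull_inc) (auto simp: inj_on_def)
    qed (use c in auto)
    moreover have "(\<Sum>i\<in>{..DIM('a)} - {j}. c i *\<^sub>R ?v i) = x"
      using c(3) j by (subst sum_diff1) auto
    ultimately show "x \<in> frontier (convex hull ?U)"
      using j frontier_convex_hull_facets[OF _ card] by auto
  next
    assume "x \<in> frontier (convex hull ?U)"
    then obtain j where j: "j \<le> DIM('a)" "x \<in> convex hull (?U - {?v j})"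
      using frontier_convex_hull_facets[OF _ card] by auto
    then obtain a where a: "\<forall>y\<in>?U - {?v j}. 0 \<le> a y" "sum a (?U - {?v j}) = 1"
      "(\<Sum>y\<in>?U - {?v j}. a y *\<^sub>R y) = x"
      by (auto simp: convex_hull_finite)
    let ?J = "{..DIM('a)} - {j}"
    have U: "?U - {?v j} = ?v ` ?J" using inj j by (auto simp: inj_on_def)
    have inj': "inj_on ?v ?J" using inj by (rule inj_on_subset) auto
    define c where "c i = (if i = j then 0 else a (?v i))" for i
    have "(\<Sum>i\<le>DIM('a). c i) = (\<Sum>i\<in>?J. c i)" using j by (subst sum_diff1) (auto simp: c_def)
    also have "\<dots> = (\<Sum>i\<in>?J. a (?v i))" by (intro sum.cong) (auto simp: c_def)
    also have "\<dots> = 1" using a(2) unfolding U sum.reindex[OF inj'] by simp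
    finally have 1: "(\<Sum>i\<le>DIM('a). c i) = 1" .
    have "(\<Sum>i\<le>DIM('a). c i *\<^sub>R ?v i) = (\<Sum>i\<in>?J. c i *\<^sub>R ?v i)" using j by (subst sum_diff1) (auto simp: c_def)
    also have "\<dots> = (\<Sum>i\<in>?J. a (?v i) *\<^sub>R ?v i)" by (intro sum.cong) (auto simp: c_def)
    also have "\<dots> = x" using a(3) unfolding U sum.reindex[OF inj'] by simp
    finally have 2: "(\<Sum>i\<le>DIM('a). c i *\<^sub>R ?v i) = x" .
    have "0 \<le> c i" if "i \<le> DIM('a)" for i
      using a(1) that inj j by (auto simp: c_def inj_on_def)
    moreover have "(\<Prod>i\<le>DIM('a). c i) = 0" using j by (auto simp: c_def)
    ultimately show "on_facet x p" unfolding on_facet_def using 1 2 by blast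
  qed
qed

text \<open>Tied distinct points have distinct base points, so the index form and the set form of a
  dual simplex have the same number of vertices and \<open>on_facet_iff\<close> applies in both
  directions.\<close>

lemma delaunay_skel_hits_iff:
  fixes A :: "('a::euclidean_space \<times> real) set"
  shows "skel (laguerre_dual A) \<inter> K \<noteq> {} \<longleftrightarrow> cluster (DIM('a) + 1) (\<lambda>p w. \<exists>x\<in>K. on_facet x p) A"
proof
  assume "skel (laguerre_dual A) \<inter> K \<noteq> {}"
  then obtain x S where S: "x \<in> K" "S \<subseteq> A" "finite S" "card S = DIM('a) + 1"
    "(\<Inter>p\<in>S. laguerre_cell p A) \<noteq> {}" "x \<in> frontier (convex hull (fst ` S))"
    unfolding skel_def laguerre_dual_def by blast
  then obtain w where w: "\<And>p. p \<in> S \<Longrightarrow> p \<in> minimizers w A" by (auto simp: minimizers_def)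
  obtain p where p: "bij_betw p {..DIM('a)} S"
    using S(3,4) by (metis Suc_eq_plus1 atLeast0LessThan ex_bij_betw_nat_finite lessThan_Suc_atMost)
  then have pS: "p ` {..DIM('a)} = S" and pinj: "inj_on p {..DIM('a)}" by (auto simp: bij_betw_def)
  have "inj_on fst S" using minimizers_fst_neq w by (metis inj_onI)
  then have "inj_on (\<lambda>i. fst (p i)) {..DIM('a)}"
    using comp_inj_on[OF pinj, of fst] pS by (simp add: o_def)
  then have "on_facet x p" using on_facet_iff[of p x] S(6) pS by (simp add: image_image[symmetric, of fst p])
  then show "cluster (DIM('a) + 1) (\<lambda>p w. \<exists>x\<in>K. on_facet x p) A"
    unfolding cluster_def
    using S(1) w[OF subsetD[OF equalityD1[OF pS]]] pinj
    by (intro exI[of _ p] exI[of _ w] conjI bexI[of _ x]) (auto simp: lessThan_Suc_atMost less_Suc_eq_le)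
next
  assume "cluster (DIM('a) + 1) (\<lambda>p w. \<exists>x\<in>K. on_facet x p) A"
  then obtain p w x where p: "\<And>i. i \<le> DIM('a) \<Longrightarrow> p i \<in> minimizers w A" "inj_on p {..DIM('a)}"
    "x \<in> K" "on_facet x p"
    unfolding cluster_def by (auto simp: lessThan_Suc_atMost less_Suc_eq_le)
  let ?S = "p ` {..DIM('a)}"
  have "inj_on (\<lambda>i. fst (p i)) {..DIM('a)}"
    using p(1,2) minimizers_fst_neq unfolding inj_on_def by (metis atMost_iff)
  then have "x \<in> frontier (convex hull (fst ` ?S))" using on_facet_iff[of p x] p(4) by (simp add: image_image)
  moreover have "?S \<subseteq> A" "finite ?S" "card ?S = DIM('a) + 1" "w \<in> (\<Inter>p\<in>?S. laguerre_cell p A)"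
    using p card_image[OF p(2)] by (auto simp: minimizers_def)
  ultimately have "x \<in> skel (laguerre_dual A)" unfolding skel_def laguerre_dual_def by blast
  then show "skel (laguerre_dual A) \<inter> K \<noteq> {}" using p(3) by auto
qed

lemma closed_cond_delaunay:
  fixes K :: "'a::euclidean_space set"
  assumes "compact K"
  shows "closed_cond (DIM('a) + 1) (\<lambda>p w. \<exists>x\<in>K. on_facet x p)"
  unfolding closed_cond_def
proof (intro allI impI)
  fix ps :: "nat \<Rightarrow> nat \<Rightarrow> 'a \<times> real" and ws :: "nat \<Rightarrow> 'a" and p w
  assume ps: "\<forall>i<DIM('a) + 1. (\<lambda>n. ps n i) \<longlonglongrightarrow> p i" and "\<forall>n. \<exists>x\<in>K. on_facet x (ps n)"
  then obtain x where x: "\<And>n. x n \<in> K" "\<And>n. on_facet (x n) (ps n)" by metis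
  then obtain y r where r: "y \<in> K" "strict_mono (r :: nat \<Rightarrow> nat)" "(x \<circ> r) \<longlonglongrightarrow> y"
    using assms unfolding compact_def by metis
  have "on_facet y p"
  proof (rule on_facet_limit[OF r(3)])
    show "(\<lambda>n. (ps \<circ> r) n i) \<longlonglongrightarrow> p i" if "i \<le> DIM('a)" for i
      using LIMSEQ_subseq_LIMSEQ[OF ps[rule_format, of i] r(2)] that by (simp add: o_def)
  qed (use x in auto)
  then show "\<exists>x\<in>K. on_facet x p" using r by auto
qed

section \<open>Bounded centres of Delaunay simplices\<close>

definition spread :: "('a::euclidean_space \<times> real) set \<Rightarrow> bool" where
  "spread A \<longleftrightarrow> (\<forall>N::nat. \<forall>\<sigma>\<subseteq>Basis. \<exists>p\<in>A. \<forall>b\<in>Basis.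
     if b \<in> \<sigma> then real N \<le> fst p \<bullet> b else fst p \<bullet> b \<le> - real N)"

text \<open>The point \<open>q\<close> lies far out in the orthant into which \<open>w - x\<close>
  points. If \<open>w\<close> were far from \<open>x\<close>, moving the centre from
  \<open>x\<close> towards \<open>w\<close> would bring it so much closer to \<open>q\<close> that
  \<open>q\<close> would beat \<open>p\<close>. Expanding the square around \<open>x\<close> makes
  this quantitative: the inner product of \<open>w - x\<close> and \<open>fst q - x\<close> is at
  least \<open>norm (w - x)\<close>.\<close>

lemma center_bounded:
  fixes w x :: "'a::euclidean_space"
  assumes "pow w p \<le> pow w q" "(norm (w - x))\<^sup>2 \<le> pow w p" "norm x \<le> R" "norm q \<le> T"
    "R + 1 \<le> N" "\<And>b. b \<in> Basis \<Longrightarrow> if 0 \<le> (w - x) \<bullet> b then N \<le> fst q \<bullet> b else fst q \<bullet> b \<le> - N"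
  shows "norm w \<le> R + ((T + R)\<^sup>2 + T) / 2"
proof -
  have T: "norm (fst q) \<le> T" "snd q \<le> T"
    using assms(4) norm_fst_le[of "fst q" "snd q"] norm_snd_le[of "snd q" "fst q"] by auto
  \<comment> \<open>Since \<open>N\<close> exceeds the coordinates of \<open>x\<close> by at least
    1, each coordinate of \<open>fst q - x\<close> has absolute value at least 1 and a sign that
    matches \<open>w - x\<close>.\<close>
  have *: "\<bar>(w - x) \<bullet> b\<bar> \<le> ((w - x) \<bullet> b) * ((fst q - x) \<bullet> b)" if b: "b \<in> Basis" for b
  proof -
    have xb: "\<bar>x \<bullet> b\<bar> \<le> R" using Basis_le_norm[OF b, of x] assms(3) by linarith
    show ?thesis
    proof (cases "0 \<le> (w - x) \<bullet> b")
      case True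
      then have "1 \<le> (fst q - x) \<bullet> b" using assms(6)[OF b] assms(5) xb by (simp add: inner_diff_left)
      then show ?thesis using True mult_left_mono[of 1 "(fst q - x) \<bullet> b" "(w - x) \<bullet> b"] by simp
    next
      case False
      then have "(fst q - x) \<bullet> b \<le> -1" using assms(6)[OF b] assms(5) xb by (simp add: inner_diff_left)
      then show ?thesis using False mult_left_mono_neg[of "(fst q - x) \<bullet> b" "-1" "(w - x) \<bullet> b"] by simp
    qed
  qed
  have "norm (w - x) \<le> (\<Sum>b\<in>Basis. \<bar>(w - x) \<bullet> b\<bar>)" by (rule norm_le_l1)
  also have "\<dots> \<le> (\<Sum>b\<in>Basis. ((w - x) \<bullet> b) * ((fst q - x) \<bullet> b))" by (intro sum_mono *)
  also have "\<dots> = (w - x) \<bullet> (fst q - x)" by (rule euclidean_inner[symmetric])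
  finally have 1: "norm (w - x) \<le> (w - x) \<bullet> (fst q - x)" .
  have "(norm (w - x))\<^sup>2 \<le> pow w q" using assms(1,2) by simp
  also have "\<dots> = (norm (w - x))\<^sup>2 - 2 * ((w - x) \<bullet> (fst q - x)) + (norm (fst q - x))\<^sup>2 + snd q"
    unfolding pow_def power2_norm_eq_inner by (simp add: inner_diff inner_commute algebra_simps)
  finally have "2 * norm (w - x) \<le> (norm (fst q - x))\<^sup>2 + snd q" using 1 by linarith
  also have "\<dots> \<le> (T + R)\<^sup>2 + T"
  proof -
    have "norm (fst q - x) \<le> T + R" using norm_triangle_ineq4[of "fst q" x] T assms(3) by linarith
    then show ?thesis using T by (intro add_mono power_mono) auto
  qed
  finally have "norm (w - x) \<le> ((T + R)\<^sup>2 + T) / 2" by simp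
  moreover have "norm w \<le> norm (w - x) + norm x" using norm_triangle_ineq[of "w - x" x] by simp
  ultimately show ?thesis using assms(3) by linarith
qed

text \<open>Nonnegative heights put all vertices into the ball around \<open>w\<close> whose squared
  radius is the common power; by convexity the ball contains the facet.\<close>

lemma on_facet_in_cball:
  fixes x :: "'a::euclidean_space"
  assumes "on_facet x p" "\<And>i. i \<le> DIM('a) \<Longrightarrow> p i \<in> minimizers w A" "\<And>q. q \<in> A \<Longrightarrow> 0 \<le> snd q"
  shows "(norm (w - x))\<^sup>2 \<le> pow w (p 0)"
proof -
  let ?F = "pow w (p 0)"
  have F: "pow w (p i) = ?F" if "i \<le> DIM('a)" for i
    using pow_minimizers_eq[of "p i" w A "p 0"] assms(2) that by blast
  have "0 \<le> snd (p i)" if "i \<le> DIM('a)" for i using assms(2)[OF that] assms(3) minimizers_subset by blast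
  then have "(norm (w - fst (p i)))\<^sup>2 \<le> ?F" if "i \<le> DIM('a)" for i
    using F[OF that] that unfolding pow_def by (smt (verit, best))
  then have v: "fst (p i) \<in> cball w (sqrt ?F)" if "i \<le> DIM('a)" for i
    using that by (simp add: dist_norm real_le_rsqrt)
  obtain c where c: "\<forall>i\<le>DIM('a). 0 \<le> c i" "(\<Sum>i\<le>DIM('a). c i) = 1" "(\<Sum>i\<le>DIM('a). c i *\<^sub>R fst (p i)) = x"
    using assms(1) unfolding on_facet_def by blast
  have "(\<Sum>i\<le>DIM('a). c i *\<^sub>R fst (p i)) \<in> cball w (sqrt ?F)"
    by (rule convex_sum) (use c v in auto)
  then have "norm (w - x) \<le> sqrt ?F" using c by (simp add: dist_norm)
  then have "(norm (w - x))\<^sup>2 \<le> (sqrt ?F)\<^sup>2" by (rule power_mono) simp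
  moreover have "0 \<le> ?F" using v[of 0] by (metis cball_eq_empty le0 linorder_not_less empty_iff real_sqrt_ge_0_iff)
  ultimately show ?thesis by simp
qed

text \<open>The bound is uniform in \<open>n\<close> because there are only finitely many sign
  patterns: one far point of \<open>A\<close> is chosen for each, and its approximants keep the base
  point, hence the orthant, and are bounded.\<close>

lemma delaunay_centers_bounded:
  fixes A :: "('a::euclidean_space \<times> real) set"
  assumes conv: "config_conv As A" and "spread A" and "bounded K"
  shows "\<exists>M. \<forall>n p w. (\<forall>i\<le>DIM('a). p i \<in> minimizers w (As n)) \<longrightarrow> (\<exists>x\<in>K. on_facet x p) \<longrightarrow> norm w \<le> M"
proof -
  obtain R where R: "\<And>x. x \<in> K \<Longrightarrow> norm x \<le> R" using assms(3) by (auto simp: bounded_iff)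
  obtain N :: nat where N: "R + 1 \<le> real N" using real_arch_simple by blast
  have "\<exists>qs. (\<forall>n. qs n \<in> As n \<and> (\<forall>b\<in>Basis. if b \<in> \<sigma> then real N \<le> fst (qs n) \<bullet> b else fst (qs n) \<bullet> b \<le> - real N)) \<and>
      bounded (range qs)" if \<sigma>: "\<sigma> \<subseteq> Basis" for \<sigma> :: "'a set"
  proof -
    obtain q where q: "q \<in> A" "\<forall>b\<in>Basis. if b \<in> \<sigma> then real N \<le> fst q \<bullet> b else fst q \<bullet> b \<le> - real N"
      using assms(2) \<sigma> unfolding spread_def by blast
    obtain qs where "\<And>n. qs n \<in> As n" "\<And>n. fst (qs n) = fst q" "qs \<longlonglongrightarrow> q"
      using config_conv_approx[OF conv q(1)] by metis
    then show ?thesis using q convergent_imp_bounded by (intro exI[of _ qs]) auto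
  qed
  then obtain qs where qs: "\<And>\<sigma> n. \<sigma> \<subseteq> Basis \<Longrightarrow> qs \<sigma> n \<in> As n"
    "\<And>\<sigma> n b. \<sigma> \<subseteq> Basis \<Longrightarrow> b \<in> Basis \<Longrightarrow>
       if b \<in> \<sigma> then real N \<le> fst (qs \<sigma> n) \<bullet> b else fst (qs \<sigma> n) \<bullet> b \<le> - real N"
    "\<And>\<sigma> :: 'a set. \<sigma> \<subseteq> Basis \<Longrightarrow> bounded (range (qs \<sigma>))" by metis
  have "bounded (\<Union>\<sigma>\<in>Pow Basis. range (qs \<sigma>))" using qs(3) by (intro bounded_UN) auto
  then obtain T where T: "\<And>\<sigma> n. \<sigma> \<subseteq> Basis \<Longrightarrow> norm (qs \<sigma> n) \<le> T" unfolding bounded_iff by auto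
  show ?thesis
  proof (intro exI allI impI)
    fix n p w assume p: "\<forall>i\<le>DIM('a). p i \<in> minimizers w (As n)" and "\<exists>x\<in>K. on_facet x p"
    then obtain x where x: "x \<in> K" "on_facet x p" by blast
    \<comment> \<open>The sign pattern of \<open>w - x\<close>, so that the chosen far point lies in
      the direction of the centre.\<close>
    let ?\<sigma> = "{b \<in> Basis. 0 \<le> (w - x) \<bullet> b}"
    have \<sigma>: "?\<sigma> \<subseteq> Basis" by auto
    show "norm w \<le> R + ((T + R)\<^sup>2 + T) / 2"
    proof (rule center_bounded)
      show "pow w (p 0) \<le> pow w (qs ?\<sigma> n)" using p qs(1)[OF \<sigma>] by (auto simp: mem_minimizers)
      have "\<And>q. q \<in> As n \<Longrightarrow> 0 \<le> snd q" using conv by (simp add: config_conv_def admissible_def)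
      then show "(norm (w - x))\<^sup>2 \<le> pow w (p 0)" using on_facet_in_cball[OF x(2)] p by blast
      show "norm x \<le> R" "norm (qs ?\<sigma> n) \<le> T" "R + 1 \<le> real N" using R x T \<sigma> N by auto
      show "if 0 \<le> (w - x) \<bullet> b then real N \<le> fst (qs ?\<sigma> n) \<bullet> b else fst (qs ?\<sigma> n) \<bullet> b \<le> - real N"
        if "b \<in> Basis" for b
        using qs(2)[OF \<sigma> that, of n] that by auto
    qed
  qed
qed

lemma delaunay_skel_eventually_misses:
  fixes A :: "('a::euclidean_space \<times> real) set"
  assumes "config_conv As A" "spread A" "compact K" "skel (laguerre_dual A) \<inter> K = {}"
  shows "\<forall>\<^sub>F n in sequentially. skel (laguerre_dual (As n)) \<inter> K = {}"
proof -
  obtain M where M: "\<And>n p w. (\<And>i. i \<le> DIM('a) \<Longrightarrow> p i \<in> minimizers w (As n)) \<Longrightarrow> \<exists>x\<in>K. on_facet x p \<Longrightarrow> norm w \<le> M"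
    using delaunay_centers_bounded[OF assms(1,2) compact_imp_bounded[OF assms(3)]] by blast
  have "\<forall>\<^sub>F n in sequentially. \<not> cluster (DIM('a) + 1) (\<lambda>p w. \<exists>x\<in>K. on_facet x p) (As n)"
  proof (rule cluster_eventually_not[OF assms(1) closed_cond_delaunay[OF assms(3)]])
    show "norm w \<le> M" if "\<And>i. i < DIM('a) + 1 \<Longrightarrow> p i \<in> minimizers w (As n)" "\<exists>x\<in>K. on_facet x p" for n p w
      by (rule M[of p w n]) (use that in auto)
    show "\<not> cluster (DIM('a) + 1) (\<lambda>p w. \<exists>x\<in>K. on_facet x p) A"
      using delaunay_skel_hits_iff[of A K] assms(4) by blast
  qed
  then show ?thesis by (rule eventually_mono) (use delaunay_skel_hits_iff[of _ K] in blast)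
qed

text \<open>For points of the skeleton that converge to \<open>x\<close>, the centres of their
  simplices are bounded by \<open>spread\<close>; a limit of the simplices in the constant
  configuration has \<open>x\<close> on a facet.\<close>

lemma closed_delaunay_skel:
  fixes A :: "('a::euclidean_space \<times> real) set"
  assumes "admissible A" "spread A"
  shows "closed (skel (laguerre_dual A))"
proof -
  have "A \<noteq> {}" using assms(2) by (auto simp: spread_def)
  have conv: "config_conv (\<lambda>_. A) A" by (rule config_conv_const[OF assms(1) \<open>A \<noteq> {}\<close>])
  have "\<exists>e>0. ball x e \<subseteq> - skel (laguerre_dual A)" if x: "x \<notin> skel (laguerre_dual A)" for x
  proof (rule ccontr)
    assume no: "\<not> ?thesis"
    have "\<exists>y. y \<in> skel (laguerre_dual A) \<and> dist x y < inverse (real (Suc n))" for n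
    proof -
      have "\<not> ball x (inverse (real (Suc n))) \<subseteq> - skel (laguerre_dual A)"
        using no by (metis inverse_positive_iff_positive of_nat_0_less_iff zero_less_Suc)
      then show ?thesis by auto
    qed
    then obtain y where y: "\<And>n. y n \<in> skel (laguerre_dual A)" "\<And>n. dist x (y n) < inverse (real (Suc n))" by metis
    have ylim: "y \<longlonglongrightarrow> x"
      unfolding tendsto_dist_iff[of y]
    proof (rule tendsto_sandwich[OF _ _ tendsto_const LIMSEQ_inverse_real_of_nat])
      show "\<forall>\<^sub>F n in sequentially. dist (y n) x \<le> inverse (real (Suc n))"
        using y(2) by (intro always_eventually allI) (metis dist_commute less_imp_le)
    qed simp
    let ?K = "range y"
    have "bounded ?K" by (rule convergent_imp_bounded[OF ylim])
    obtain M where M: "\<And>p w. (\<And>i. i \<le> DIM('a) \<Longrightarrow> p i \<in> minimizers w A) \<Longrightarrow> \<exists>x\<in>?K. on_facet x p \<Longrightarrow> norm w \<le> M"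
      using delaunay_centers_bounded[OF conv assms(2) \<open>bounded ?K\<close>] by blast
    have "cluster (DIM('a) + 1) (\<lambda>p w. \<exists>x\<in>{y n}. on_facet x p) A" for n
      using delaunay_skel_hits_iff[of A "{y n}"] y(1)[of n] by blast
    then have "\<forall>n. \<exists>p w. (\<forall>i<DIM('a) + 1. p i \<in> minimizers w A) \<and> inj_on p {..<DIM('a) + 1} \<and> on_facet (y n) p"
      unfolding cluster_def by blast
    then obtain p w where pw: "\<And>n i. i < DIM('a) + 1 \<Longrightarrow> p n i \<in> minimizers (w n) A"
      "\<And>n. inj_on (p n) {..<DIM('a) + 1}" "\<And>n. on_facet (y n) (p n)"
      by metis
    have "norm (w n) \<le> M" for n
    proof (rule M)
      show "\<exists>x\<in>?K. on_facet x (p n)" using pw(3) by blast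
    qed (use pw(1) in auto)
    then have "bounded (range w)" by (auto simp: bounded_iff)
    then obtain s l w0 where s: "strict_mono (s :: nat \<Rightarrow> nat)" "inj_on l {..<DIM('a) + 1}"
      "\<forall>i<DIM('a) + 1. (\<lambda>n. p (s n) i) \<longlonglongrightarrow> l i \<and> l i \<in> minimizers w0 A \<and>
        (\<forall>\<^sub>F n in sequentially. fst (p (s n) i) = fst (l i))"
      using minimizers_limit[OF conv, of "DIM('a) + 1" p w] pw(1,2) by blast
    have "on_facet x l"
      by (rule on_facet_limit[of "y \<circ> s" x "p \<circ> s"])
         (use s pw LIMSEQ_subseq_LIMSEQ[OF ylim s(1)] in auto)
    then have "cluster (DIM('a) + 1) (\<lambda>p w. \<exists>x\<in>{x}. on_facet x p) A"
      unfolding cluster_def using s by blast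
    then show False using delaunay_skel_hits_iff[of A "{x}"] x by blast
  qed
  then have "open (- skel (laguerre_dual A))" unfolding open_contains_ball by blast
  then show ?thesis by (simp add: closed_def)
qed

section \<open>Generic limits at height zero\<close>

definition lift :: "'a::euclidean_space \<Rightarrow> 'a \<times> real" where
  "lift v = (v, (norm v)\<^sup>2)"

lemma inj_lift: "inj_on lift T"
  by (auto simp: inj_on_def lift_def)

text \<open>One condition on the paraboloid lift, whose hyperplane sections project to spheres and
  hyperplanes, serves two purposes: it excludes a further point on the sphere of a simplex and it
  excludes degenerate simplices.\<close>

definition lift_generic :: "'a::euclidean_space set \<Rightarrow> bool" where
  "lift_generic Z \<longleftrightarrow> (\<forall>T\<subseteq>Z. finite T \<longrightarrow> card T \<le> DIM('a) + 2 \<longrightarrow> \<not> affine_dependent (lift ` T))"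

text \<open>On a sphere the squared norm is an affine function of \<open>v\<close>, so an affine
  dependence of the base points annihilates the last coordinate of the lifts too.\<close>

lemma cospherical_affine_dependent_lift:
  assumes "finite U" "\<And>v. v \<in> U \<Longrightarrow> (norm (w - v))\<^sup>2 = \<rho>" "affine_dependent U"
  shows "affine_dependent (lift ` U)"
proof -
  obtain c where c: "sum c U = 0" "\<exists>v\<in>U. c v \<noteq> 0" "(\<Sum>v\<in>U. c v *\<^sub>R v) = 0"
    using assms(1,3) affine_dependent_explicit_finite by blast
  have "(norm v)\<^sup>2 = \<rho> - (norm w)\<^sup>2 + 2 * (w \<bullet> v)" if "v \<in> U" for v
    using assms(2)[OF that] by (simp add: power2_norm_eq_inner inner_diff inner_commute algebra_simps)
  then have "(\<Sum>v\<in>U. c v * (norm v)\<^sup>2) = (\<Sum>v\<in>U. c v * (\<rho> - (norm w)\<^sup>2) + 2 * (w \<bullet> (c v *\<^sub>R v)))"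
    by (intro sum.cong refl) (simp add: algebra_simps flip: distrib_left)
  also have "\<dots> = sum c U * (\<rho> - (norm w)\<^sup>2) + 2 * (w \<bullet> (\<Sum>v\<in>U. c v *\<^sub>R v))"
    by (simp only: sum.distrib sum_distrib_right sum_distrib_left inner_sum_right)
  also have "\<dots> = 0" using c by simp
  finally have sq: "(\<Sum>v\<in>U. c v * (norm v)\<^sup>2) = 0" .
  have "(\<Sum>v\<in>U. c v *\<^sub>R lift v) = ((\<Sum>v\<in>U. c v *\<^sub>R v), (\<Sum>v\<in>U. c v * (norm v)\<^sup>2))"
    unfolding lift_def by (simp add: prod_eq_iff fst_sum snd_sum)
  then have "(\<Sum>v\<in>U. c v *\<^sub>R lift v) = 0" using c sq by (simp add: zero_prod_def)
  then have "sum (c \<circ> fst) (lift ` U) = 0" "(\<exists>v\<in>lift ` U. (c \<circ> fst) v \<noteq> 0)"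
    "(\<Sum>v\<in>lift ` U. (c \<circ> fst) v *\<^sub>R v) = 0"
    using c by (simp_all add: sum.reindex[OF inj_lift] o_def) (simp_all add: lift_def)
  then show ?thesis using assms(1) by (subst affine_dependent_explicit_finite) blast+
qed

lemma flat_minimizers_independent:
  fixes A :: "('a::euclidean_space \<times> real) set"
  assumes "\<And>p. p \<in> A \<Longrightarrow> snd p = 0" "lift_generic (fst ` A)"
    and "T \<subseteq> minimizers w A" "finite T" "card T \<le> DIM('a) + 2"
  shows "\<not> affine_dependent (fst ` T)"
proof (cases "T = {}")
  case False
  then obtain p where p: "p \<in> T" by blast
  have "(norm (w - v))\<^sup>2 = pow w p" if v: "v \<in> fst ` T" for v
  proof -
    obtain q where q: "q \<in> T" "v = fst q" using v by blast
    then have "pow w q = pow w p" using pow_minimizers_eq assms(3) p by blast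
    moreover have "snd q = 0" using assms(1,3) q minimizers_subset by blast
    ultimately show ?thesis using q by (simp add: pow_def)
  qed
  moreover have "\<not> affine_dependent (lift ` fst ` T)"
  proof -
    have "fst ` T \<subseteq> fst ` A" using assms(3) minimizers_subset by blast
    moreover have "card (fst ` T) \<le> DIM('a) + 2" using card_image_le[OF assms(4), of fst] assms(5) by simp
    ultimately show ?thesis using assms(2,4) unfolding lift_generic_def by blast
  qed
  ultimately show ?thesis using cospherical_affine_dependent_lift[of "fst ` T" w "pow w p"] assms(4) by blast
qed (simp add: affine_independent_0)

text \<open>A dual basis to the edges at \<open>v0\<close>, obtained by representing linear
  functionals through their adjoints. It solves explicitly the linear system for a displaced
  centre.\<close>

lemma affine_independent_dual_vectors:
  fixes U :: "'a::euclidean_space set"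
  assumes "\<not> affine_dependent U" "v0 \<in> U"
  obtains D where "\<And>u v. u \<in> U - {v0} \<Longrightarrow> v \<in> U \<Longrightarrow> (v - v0) \<bullet> D u = (if v = u then 1 else 0)"
proof -
  let ?B = "(\<lambda>v. v - v0) ` (U - {v0})"
  have ind: "independent ?B"
    using affine_dependent_iff_dependent2[OF assms(2)] assms(1) by simp
  have "\<exists>d. \<forall>v\<in>U. (v - v0) \<bullet> d = (if v = u then 1 else 0)" if u: "u \<in> U - {v0}" for u
  proof -
    obtain f where f: "linear f" "\<forall>x\<in>?B. f x = (if x = u - v0 then 1 else (0::real))"
      using linear_independent_extend[OF ind, of "\<lambda>x. if x = u - v0 then 1 else 0"] by blast
    have "(v - v0) \<bullet> adjoint f 1 = (if v = u then 1 else 0)" if "v \<in> U" for v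
    proof (cases "v = v0")
      case True
      then show ?thesis using u by auto
    next
      case False
      then have "f (v - v0) = (if v = u then 1 else 0)" using f(2) that by auto
      then show ?thesis using adjoint_works[OF f(1), of "v - v0" 1] by simp
    qed
    then show ?thesis by blast
  qed
  then show thesis using that by metis
qed

text \<open>Of several points on one vertical line only the lowest can be minimal; local finiteness
  makes it exist.\<close>

lemma lowest_point_over:
  fixes A :: "('a::euclidean_space \<times> real) set"
  assumes "admissible A" "q \<in> A"
  obtains h where "(fst q, h) \<in> A" "0 \<le> h" "h \<le> snd q" "\<And>h'. (fst q, h') \<in> A \<Longrightarrow> h \<le> h'"
proof -
  let ?H = "snd ` (A \<inter> {fst q} \<times> {0..snd q})"
  have "compact ({fst q} \<times> {0..snd q})" by (intro compact_Times) auto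
  then have fin: "finite ?H" using assms(1) unfolding admissible_def by blast
  have q: "snd q \<in> ?H" using assms by (intro image_eqI[of _ _ q]) (auto simp: admissible_def mem_Times_iff)
  have "Min ?H \<in> ?H" using fin q by (intro Min_in) auto
  moreover have "Min ?H \<le> h'" if "(fst q, h') \<in> A" for h'
  proof (cases "h' \<le> snd q")
    case True
    moreover have "0 \<le> h'" using that assms(1) by (fastforce simp: admissible_def)
    ultimately have "h' \<in> ?H" using that by (intro image_eqI[of _ _ "(fst q, h')"]) auto
    then show ?thesis using fin by simp
  next
    case False
    then show ?thesis using Min_le[OF fin q] by simp
  qed
  ultimately show thesis using that[of "Min ?H"] by auto
qed

text \<open>Genericity makes the minimizers at \<open>w\<close> exactly the \<open>d + 1\<close>
  vertices of the simplex, and makes these affinely independent. The first fact bars newcomers after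
  a perturbation, the second allows the tie to be restored at a nearby centre.\<close>

lemma delaunay_skel_eventually_hits:
  fixes A :: "('a::euclidean_space \<times> real) set"
  assumes conv: "config_conv As A" and flat: "\<And>p. p \<in> A \<Longrightarrow> snd p = 0"
    and gen: "lift_generic (fst ` A)" and hit: "skel (laguerre_dual A) \<inter> G \<noteq> {}"
  shows "\<forall>\<^sub>F n in sequentially. skel (laguerre_dual (As n)) \<inter> G \<noteq> {}"
proof -
  have admA: "admissible (As n)" for n using conv by (simp add: config_conv_def)
  obtain x S where S: "x \<in> G" "S \<subseteq> A" "finite S" "card S = DIM('a) + 1"
    "(\<Inter>p\<in>S. laguerre_cell p A) \<noteq> {}" "x \<in> frontier (convex hull (fst ` S))"
    using hit unfolding skel_def laguerre_dual_def by blast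
  then obtain w where "\<And>p. p \<in> S \<Longrightarrow> w \<in> laguerre_cell p A" by auto
  then have Sw: "S \<subseteq> minimizers w A" using S(2) by (auto simp: minimizers_def)
  have injM: "inj_on fst (minimizers w A)" using minimizers_fst_neq by (metis inj_onI)
  \<comment> \<open>One further minimizer would produce \<open>d + 2\<close> affinely independent
    points in dimension \<open>d\<close>.\<close>
  have S_eq: "minimizers w A = S"
  proof (rule ccontr)
    assume "minimizers w A \<noteq> S"
    then obtain q where q: "q \<in> minimizers w A" "q \<notin> S" using Sw by blast
    let ?T = "insert q S"
    have T: "?T \<subseteq> minimizers w A" "finite ?T" "card ?T = DIM('a) + 2" using q S Sw by auto
    have "\<not> affine_dependent (fst ` ?T)"
      by (rule flat_minimizers_independent[OF flat gen T(1,2)]) (use T in auto)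
    note ad = aff_dim_affine_independent[OF this]
    have "card (fst ` ?T) = DIM('a) + 2"
      using card_image[OF inj_on_subset[OF injM T(1)]] T(3) by simp
    then show False using aff_dim_le_DIM[of "fst ` ?T"] ad by linarith
  qed
  define U where "U = fst ` S"
  have finU: "finite U" using S by (simp add: U_def)
  have cardU: "card U = DIM('a) + 1" using card_image[OF inj_on_subset[OF injM Sw]] S(4) by (simp add: U_def)
  have indU: "\<not> affine_dependent U"
    unfolding U_def by (rule flat_minimizers_independent[OF flat gen Sw S(3)]) (use S in auto)
  \<comment> \<open>The approximant over \<open>v\<close> need not be the lowest point of
    \<open>As n\<close> there; the lowest one is squeezed between \<open>0\<close> and the
    approximant, so its height also tends to \<open>0\<close>.\<close>
  have "\<exists>h. \<forall>n. (v, h n) \<in> As n \<and> (\<forall>h'. (v, h') \<in> As n \<longrightarrow> h n \<le> h') \<and> 0 \<le> h n \<and> h \<longlonglongrightarrow> 0" if "v \<in> U" for v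
  proof -
    have v0: "(v, 0) \<in> A" using that S(2) flat unfolding U_def by force
    obtain qs where qs: "\<And>n. qs n \<in> As n" "\<And>n. fst (qs n) = v" "qs \<longlonglongrightarrow> (v, 0)"
      using config_conv_approx[OF conv v0] by (metis fst_conv)
    have "\<exists>h. (v, h) \<in> As n \<and> 0 \<le> h \<and> h \<le> snd (qs n) \<and> (\<forall>h'. (v, h') \<in> As n \<longrightarrow> h \<le> h')" for n
      using lowest_point_over[OF admA qs(1)] qs(2) by metis
    then obtain h where h: "\<And>n. (v, h n) \<in> As n" "\<And>n. 0 \<le> h n" "\<And>n. h n \<le> snd (qs n)"
      "\<And>n h'. (v, h') \<in> As n \<Longrightarrow> h n \<le> h'" by metis
    have "(\<lambda>n. snd (qs n)) \<longlonglongrightarrow> 0" using tendsto_snd[OF qs(3)] by simp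
    then have "h \<longlonglongrightarrow> 0" by (rule tendsto_sandwich[rotated 2, OF tendsto_const]) (use h in auto)
    then show ?thesis using h by blast
  qed
  then obtain h where h: "\<And>v n. v \<in> U \<Longrightarrow> (v, h v n) \<in> As n"
    "\<And>v n h'. v \<in> U \<Longrightarrow> (v, h') \<in> As n \<Longrightarrow> h v n \<le> h'" "\<And>v. v \<in> U \<Longrightarrow> h v \<longlonglongrightarrow> 0" by metis
  obtain v0 where v0: "v0 \<in> U" using cardU by fastforce
  obtain D where D: "\<And>u v. u \<in> U - {v0} \<Longrightarrow> v \<in> U \<Longrightarrow> (v - v0) \<bullet> D u = (if v = u then 1 else 0)"
    using affine_independent_dual_vectors[OF indU v0] by blast
  \<comment> \<open>The lowest points over \<open>U\<close> tie at \<open>w + z\<close> exactly when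
    twice the inner product of \<open>z\<close> and \<open>v - v0\<close> equals
    \<open>h v n - h v0 n\<close> for every \<open>v\<close> in \<open>U\<close>. The dual vectors
    give such a \<open>z\<close>, and it tends to \<open>0\<close> with the heights.\<close>
  define wn where "wn n = w + (\<Sum>u\<in>U - {v0}. ((h u n - h v0 n) / 2) *\<^sub>R D u)" for n
  have "wn \<longlonglongrightarrow> w + (\<Sum>u\<in>U - {v0}. ((0 - 0) / 2) *\<^sub>R D u)"
    unfolding wn_def by (intro tendsto_intros h(3) v0) auto
  then have wlim: "wn \<longlonglongrightarrow> w" by simp
  have min0: "(v, 0) \<in> minimizers w A" if "v \<in> U" for v
    using that Sw flat minimizers_subset unfolding U_def by force
  have equal: "pow (wn n) (v, h v n) = pow (wn n) (v0, h v0 n)" if v: "v \<in> U" for v n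
  proof -
    have "(v - v0) \<bullet> (\<Sum>u\<in>U - {v0}. ((h u n - h v0 n) / 2) *\<^sub>R D u) =
        (\<Sum>u\<in>U - {v0}. if v = u then (h u n - h v0 n) / 2 else 0)"
      unfolding inner_sum_right by (intro sum.cong) (use D v in auto)
    also have "\<dots> = (h v n - h v0 n) / 2" using v finU by (simp add: sum.delta)
    finally have "2 * (wn n \<bullet> (v - v0)) = 2 * (w \<bullet> (v - v0)) + (h v n - h v0 n)"
      unfolding wn_def by (simp add: inner_add_right inner_commute[of _ "v - v0"])
    moreover have "pow w (v, 0) = pow w (v0, 0)" by (rule pow_minimizers_eq[OF min0[OF v] min0[OF v0]])
    ultimately show ?thesis
      using pow_diff_affine[of "wn n" "(v, h v n)" "(v0, h v0 n)"] pow_diff_affine[of w "(v, 0)" "(v0, 0)"] by simp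
  qed
  \<comment> \<open>Minimizers at \<open>wn n\<close> converge, along subsequences, to minimizers at
    \<open>w\<close>, so they eventually stand over \<open>U\<close>. The lowest point over the same
    vertex is at least as good, and it ties with the others by construction, so all of them are
    minimal.\<close>
  have "\<forall>\<^sub>F n in sequentially. \<forall>v\<in>U. (v, h v n) \<in> minimizers (wn n) (As n)"
  proof (rule ccontr)
    assume "\<not> ?thesis"
    then obtain r :: "nat \<Rightarrow> nat" where r: "strict_mono r"
      "\<And>n. \<not> (\<forall>v\<in>U. (v, h v (r n)) \<in> minimizers (wn (r n)) (As (r n)))"
      using not_eventually_subseq[of "\<lambda>n. \<forall>v\<in>U. (v, h v n) \<in> minimizers (wn n) (As n)"] by metis
    have "As (r n) \<noteq> {}" for n using h(1)[OF v0] by blast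
    then have "\<exists>a. a \<in> minimizers (wn (r n)) (As (r n))" for n using minimizers_nonempty[OF admA] by blast
    then obtain a where a: "\<And>n. a n \<in> minimizers (wn (r n)) (As (r n))" by metis
    have conv': "config_conv (As \<circ> r) A" by (rule config_conv_subseq[OF conv r(1)])
    have wr: "(\<lambda>n. wn (r n)) \<longlonglongrightarrow> w" using LIMSEQ_subseq_LIMSEQ[OF wlim r(1)] by (simp add: o_def)
    have "bounded (range (\<lambda>n. wn (r n)))" by (rule convergent_imp_bounded[OF wr])
    then obtain s l w0 where s: "strict_mono (s :: nat \<Rightarrow> nat)" "(\<lambda>n. wn (r (s n))) \<longlonglongrightarrow> w0"
      "l (0::nat) \<in> minimizers w0 A" "\<forall>\<^sub>F n in sequentially. fst (a (s n)) = fst (l 0)"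
      using minimizers_limit[OF conv', of "1::nat" "\<lambda>n i. a n" "\<lambda>n. wn (r n)"] a by (auto simp: inj_on_def)
    have "w0 = w"
      using LIMSEQ_unique[OF s(2)] LIMSEQ_subseq_LIMSEQ[OF wr s(1)] by (simp add: o_def)
    then have lU: "fst (l 0) \<in> U" using s(3) S_eq by (simp add: U_def)
    obtain n where "fst (a (s n)) = fst (l 0)"
      using eventually_happens'[OF trivial_limit_sequentially s(4)] by blast
    then obtain v where v: "v \<in> U" "fst (a (s n)) = v" using lU by auto
    define k where "k = r (s n)"
    have ak: "a (s n) \<in> minimizers (wn k) (As k)" using a by (simp add: k_def)
    have "(v, snd (a (s n))) \<in> As k" using ak v minimizers_subset by (metis prod.collapse subsetD)
    then have "h v k \<le> snd (a (s n))" by (rule h(2)[OF v(1)])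
    then have "pow (wn k) (v, h v k) \<le> pow (wn k) (a (s n))" using v by (simp add: pow_def)
    then have "(u, h u k) \<in> minimizers (wn k) (As k)" if "u \<in> U" for u
      using equal[OF that, of k] equal[OF v(1), of k] ak h(1)[OF that, of k]
      unfolding mem_minimizers by fastforce
    then show False using r(2)[of "s n"] by (simp add: k_def)
  qed
  then show ?thesis
  proof eventually_elim
    case (elim n)
    let ?S = "(\<lambda>v. (v, h v n)) ` U"
    have "inj_on (\<lambda>v. (v, h v n)) U" by (auto simp: inj_on_def)
    then have "card ?S = DIM('a) + 1" using cardU card_image by fastforce
    moreover have "?S \<subseteq> As n" "finite ?S" "wn n \<in> (\<Inter>p\<in>?S. laguerre_cell p (As n))"
      using elim finU by (auto simp: minimizers_def)
    \<comment> \<open>Only heights have changed: the simplex, and with it the point \<open>x\<close>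
      on its frontier, is literally the same for every such \<open>n\<close>.\<close>
    moreover have "fst ` ?S = U" by (simp add: image_image)
    ultimately have "convex hull U \<in> laguerre_dual (As n)"
      unfolding laguerre_dual_def by (intro CollectI exI[of _ ?S]) auto
    then show ?case using S(1,6) unfolding skel_def U_def by blast
  qed
qed

text \<open>The maps \<open>g n\<close> converge only pointwise in the height. Local finiteness
  supplies uniformity: over a bounded base region the points below \<open>hs\<close> are finitely
  many, and those above stay away from \<open>hs\<close>, so monotonicity drives them off together.
  Nothing is known about the limit at \<open>hs\<close> itself, hence its exclusion.\<close>

lemma flat_config_conv:
  fixes P :: "('a::euclidean_space \<times> real) set" and g :: "nat \<Rightarrow> real \<Rightarrow> real"
  assumes P: "admissible P" "\<And>p. p \<in> P \<Longrightarrow> snd p \<noteq> hs" "p0 \<in> P" "snd p0 < hs"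
    and g0: "\<And>h. 0 \<le> h \<Longrightarrow> h < hs \<Longrightarrow> (\<lambda>n. g n h) \<longlonglongrightarrow> 0"
    and ginf: "\<And>h. hs < h \<Longrightarrow> filterlim (\<lambda>n. g n h) at_top sequentially"
    and mono: "\<And>n h h'. 0 \<le> h \<Longrightarrow> h \<le> h' \<Longrightarrow> g n h \<le> g n h'"
    and adm: "\<And>n. admissible ((\<lambda>(v, h). (v, g n h)) ` P)"
  shows "config_conv (\<lambda>n. (\<lambda>(v, h). (v, g n h)) ` P) ((\<lambda>(v, h). (v, 0)) ` {p \<in> P. snd p < hs})"
    (is "config_conv ?As ?A")
proof -
  have nonneg: "0 \<le> snd p" if "p \<in> P" for p using P(1) that by (simp add: admissible_def)
  have fin: "finite (P \<inter> cball 0 R \<times> {0..H})" for R H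
    using P(1) compact_Times[OF compact_cball compact_Icc] unfolding admissible_def by blast
  have "finite (?A \<inter> K)" if K: "compact K" for K
  proof -
    obtain R where R: "\<And>x. x \<in> K \<Longrightarrow> norm x \<le> R" using compact_imp_bounded[OF K] unfolding bounded_iff by blast
    have "?A \<inter> K \<subseteq> (\<lambda>(v, h). (v, 0)) ` (P \<inter> cball 0 R \<times> {0..hs})"
      using R nonneg by (fastforce simp: norm_Pair)
    then show ?thesis by (rule finite_subset) (intro finite_imageI fin)
  qed
  then have "admissible ?A" by (auto simp: admissible_def)
  moreover have "?A \<noteq> {}" using P(3,4) by (cases p0) auto
  moreover have "\<exists>qs. (\<forall>n. qs n \<in> ?As n \<and> fst (qs n) = fst q) \<and> qs \<longlonglongrightarrow> q" if q: "q \<in> ?A" for q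
  proof -
    obtain v h where vh: "q = (v, 0)" "(v, h) \<in> P" "h < hs" using q by auto
    have "(\<lambda>n. (v, g n h)) \<longlonglongrightarrow> (v, 0)"
      using nonneg[OF vh(2)] vh by (intro tendsto_Pair tendsto_const g0) auto
    then show ?thesis using vh by (intro exI[of _ "\<lambda>n. (v, g n h)"]) force
  qed
  moreover have "l \<in> ?A \<and> (\<forall>\<^sub>F n in sequentially. fst (p n) = fst l)"
    if r: "strict_mono r" and p: "\<forall>n. p n \<in> ?As (r n)" and lim: "p \<longlonglongrightarrow> l" for r p l
  proof -
    have "\<forall>n. \<exists>a. a \<in> P \<and> p n = (fst a, g (r n) (snd a))" using p by fastforce
    then obtain a where a: "\<And>n. a n \<in> P" "\<And>n. p n = (fst (a n), g (r n) (snd (a n)))" by metis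
    obtain R where R: "\<And>n. norm (p n) \<le> R" using convergent_imp_bounded[OF lim] by (auto simp: bounded_iff)
    have fa: "norm (fst (a n)) \<le> R" and ga: "g (r n) (snd (a n)) \<le> R" for n
      using R[of n] a(2)[of n] norm_fst_le[of "fst (p n)" "snd (p n)"] norm_snd_le[of "snd (p n)" "fst (p n)"] by auto
    \<comment> \<open>The entry \<open>hs + 1\<close> keeps \<open>F\<close> non-empty and
      represents all greater heights, so the minimum of \<open>F\<close> is strictly above
      \<open>hs\<close> and at or below every height beyond \<open>hs\<close> that occurs over the
      ball of radius \<open>R\<close>.\<close>
    define F where "F = insert (hs + 1) (snd ` (P \<inter> cball 0 R \<times> {0..hs + 1} \<inter> {q. hs < snd q}))"
    have "finite F" unfolding F_def using finite_subset[OF Int_lower1 fin[of R "hs + 1"]] by (intro finite.insertI finite_imageI)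
    define h' where "h' = Min F"
    have "hs < h'" unfolding h'_def using \<open>finite F\<close> by (subst Min_gr_iff) (auto simp: F_def)
    have h'_le: "h' \<le> snd (a n)" if "hs < snd (a n)" for n
    proof (cases "snd (a n) \<le> hs + 1")
      case True
      then have "a n \<in> P \<inter> cball 0 R \<times> {0..hs + 1}" using a(1)[of n] nonneg fa[of n] by (simp add: mem_Times_iff)
      then have "snd (a n) \<in> F" using that by (auto simp: F_def)
      then show ?thesis unfolding h'_def using \<open>finite F\<close> by simp
    next
      case False
      have "h' \<le> hs + 1" unfolding h'_def using \<open>finite F\<close> by (simp add: F_def)
      then show ?thesis using False by simp
    qed
    have rlim: "filterlim r at_top sequentially" by (rule filterlim_subseq[OF r])
    have "\<forall>\<^sub>F n in sequentially. R < g n h'"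
      using ginf[OF \<open>hs < h'\<close>] by (simp add: filterlim_at_top_dense)
    then have "\<forall>\<^sub>F n in sequentially. R < g (r n) h'" using rlim by (auto simp: filterlim_iff)
    then have low: "\<forall>\<^sub>F n in sequentially. snd (a n) < hs"
    proof eventually_elim
      case (elim n)
      show ?case
      proof (rule ccontr)
        assume "\<not> snd (a n) < hs"
        then have "hs < snd (a n)" using P(2)[OF a(1)[of n]] by simp
        then have "h' \<le> snd (a n)" by (rule h'_le)
        have "0 \<le> hs" using P(3,4) nonneg[of p0] by simp
        then have "g (r n) h' \<le> g (r n) (snd (a n))" using \<open>hs < h'\<close> \<open>h' \<le> snd (a n)\<close> by (intro mono) auto
        then show False using elim ga[of n] by simp
      qed
    qed
    define \<Phi> where "\<Phi> = P \<inter> cball 0 R \<times> {0..hs} \<inter> {q. snd q < hs}"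
    have fin\<Phi>: "finite \<Phi>" unfolding \<Phi>_def by (rule finite_subset[OF Int_lower1 fin])
    have a\<Phi>: "\<forall>\<^sub>F n in sequentially. a n \<in> \<Phi>" using low
    proof eventually_elim
      case (elim n)
      then show ?case using a(1)[of n] fa[of n] nonneg by (simp add: \<Phi>_def mem_Times_iff)
    qed
    then have ev: "\<forall>\<^sub>F n in sequentially. fst (p n) \<in> fst ` \<Phi>" by eventually_elim (use a(2) in auto)
    have fst_eq: "\<forall>\<^sub>F n in sequentially. fst (p n) = fst l"
      by (rule finite_set_limit_eventually_eq[OF _ ev tendsto_fst[OF lim]]) (use fin\<Phi> in simp)
    obtain n where "fst (p n) \<in> fst ` \<Phi>" "fst (p n) = fst l"
      using eventually_happens'[OF trivial_limit_sequentially eventually_conj[OF ev fst_eq]] by blast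
    then have l\<Phi>: "fst l \<in> fst ` \<Phi>" by simp
    have "(\<lambda>n. snd (p n)) \<longlonglongrightarrow> 0"
    proof (rule tendstoI)
      fix e :: real assume e: "e > 0"
      have "\<forall>\<^sub>F n in sequentially. dist (g n (snd q)) 0 < e" if "q \<in> \<Phi>" for q
        using g0[of "snd q"] that e tendstoD unfolding \<Phi>_def by fastforce
      then have "\<forall>\<^sub>F n in sequentially. \<forall>q\<in>\<Phi>. dist (g n (snd q)) 0 < e"
        by (intro eventually_ball_finite fin\<Phi>) auto
      then have "\<forall>\<^sub>F n in sequentially. \<forall>q\<in>\<Phi>. dist (g (r n) (snd q)) 0 < e" using rlim by (auto simp: filterlim_iff)
      then show "\<forall>\<^sub>F n in sequentially. dist (snd (p n)) 0 < e"
        using a\<Phi> by eventually_elim (use a(2) in auto)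
    qed
    then have "snd l = 0" using tendsto_snd[OF lim] LIMSEQ_unique by blast
    then have "l = (fst l, 0)" by (simp add: prod_eq_iff)
    moreover have "(fst l, 0) \<in> ?A" using l\<Phi> unfolding \<Phi>_def by force
    ultimately show ?thesis using fst_eq by metis
  qed
  ultimately show ?thesis using adm unfolding config_conv_def by blast
qed

section \<open>The Fell topology\<close>

lemma countable_compact_neighbourhoods:
  obtains B :: "'a::euclidean_space set set" where "countable B" "\<And>b. b \<in> B \<Longrightarrow> compact b"
    "\<And>G x. open G \<Longrightarrow> x \<in> G \<Longrightarrow> \<exists>b\<in>B. x \<in> interior b \<and> b \<subseteq> G"
proof -
  obtain D :: "'a set" where D: "countable D" "\<And>X. open X \<Longrightarrow> X \<noteq> {} \<Longrightarrow> \<exists>d\<in>D. d \<in> X"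
    using countable_dense_exists by blast
  let ?B = "(\<lambda>(d, n). cball d (inverse (real (Suc n)))) ` (D \<times> UNIV)"
  have "\<exists>b\<in>?B. x \<in> interior b \<and> b \<subseteq> G" if G: "open G" "x \<in> G" for G x
  proof -
    obtain e where e: "e > 0" "ball x e \<subseteq> G" using G openE by blast
    obtain n where n: "inverse (real (Suc n)) < e / 2" using reals_Archimedean[of "e / 2"] e by auto
    obtain d where d: "d \<in> D" "d \<in> ball x (inverse (real (Suc n)))"
      using D(2)[of "ball x (inverse (real (Suc n)))"] by auto
    have "x \<in> interior (cball d (inverse (real (Suc n))))" using d by (simp add: dist_commute)
    moreover have "cball d (inverse (real (Suc n))) \<subseteq> ball x e"
    proof
      fix y assume "y \<in> cball d (inverse (real (Suc n)))"
      then show "y \<in> ball x e" using d(2) n dist_triangle[of x y d] by simp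
    qed
    ultimately show ?thesis using d(1) e(2) by (intro bexI[of _ "cball d (inverse (real (Suc n)))"]) auto
  qed
  moreover have "countable ?B" by (intro countable_image countable_SIGMA D(1) countableI_type)
  moreover have "compact b" if "b \<in> ?B" for b using that by auto
  ultimately show thesis by (intro that[of ?B])
qed

text \<open>The hit sets \<open>b\<close> will be compact, not open, so a cell need not be
  Fell-open. In exchange it is described by hitting events of compact sets alone, which is what
  measurability asks for.\<close>

definition fell_cell :: "'a::euclidean_space set set \<Rightarrow> 'a set set \<Rightarrow> 'a set set" where
  "fell_cell S T = {F. closed F \<and> F \<inter> \<Union>S = {} \<and> (\<forall>b\<in>T. F \<inter> b \<noteq> {})}"

text \<open>A compact set missed by \<open>F\<close> is covered by finitely many members of
  \<open>B\<close> that \<open>F\<close> misses as well, and a hit of an open set is witnessed by a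
  hit of a member of \<open>B\<close> inside it.\<close>

lemma fell_open_local_base:
  fixes B :: "'a::euclidean_space set set"
  assumes B: "\<And>b. b \<in> B \<Longrightarrow> compact b"
    "\<And>G x. open G \<Longrightarrow> x \<in> G \<Longrightarrow> \<exists>b\<in>B. x \<in> interior b \<and> b \<subseteq> G"
    and "openin fell_topology U" "F \<in> U"
  shows "\<exists>S T. finite S \<and> S \<subseteq> B \<and> finite T \<and> T \<subseteq> B \<and> F \<in> fell_cell S T \<and> fell_cell S T \<subseteq> U"
proof -
  have "generate_topology_on ({{F. closed F \<and> F \<inter> K = {}} | K. compact K} \<union>
      {{F. closed F \<and> F \<inter> G \<noteq> {}} | G. open G}) U"
    using assms(3) unfolding fell_topology_def by (simp add: openin_topology_generated_by_iff)
  then show ?thesis using assms(4)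
  proof (induction arbitrary: F rule: generate_topology_on.induct)
    case Empty
    then show ?case by simp
  next
    case (Int U V)
    have FU: "F \<in> U" and FV: "F \<in> V" using Int.prems by auto
    obtain S T where 1: "finite S" "S \<subseteq> B" "finite T" "T \<subseteq> B" "F \<in> fell_cell S T" "fell_cell S T \<subseteq> U"
      using Int.IH(1)[OF FU] by blast
    obtain S' T' where 2: "finite S'" "S' \<subseteq> B" "finite T'" "T' \<subseteq> B" "F \<in> fell_cell S' T'" "fell_cell S' T' \<subseteq> V"
      using Int.IH(2)[OF FV] by blast
    have "fell_cell (S \<union> S') (T \<union> T') = fell_cell S T \<inter> fell_cell S' T'" by (auto simp: fell_cell_def)
    then show ?case
      using 1 2 by (intro exI[of _ "S \<union> S'"] exI[of _ "T \<union> T'"]) auto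
  next
    case (UN \<U>)
    then obtain V where V: "V \<in> \<U>" "F \<in> V" by blast
    show ?case using UN.IH[OF V] V(1) by (meson Union_upper order_trans)
  next
    case (Basis U)
    then consider K where "compact K" "U = {F. closed F \<and> F \<inter> K = {}}"
      | G where "open G" "U = {F. closed F \<and> F \<inter> G \<noteq> {}}" by blast
    then show ?case
    proof cases
      case 1
      then have F: "closed F" "F \<inter> K = {}" using Basis.prems by auto
      have "\<forall>x\<in>K. \<exists>b\<in>B. x \<in> interior b \<and> b \<subseteq> - F" using B(2)[of "- F"] F by (auto simp: open_Compl)
      then obtain b where b: "\<And>x. x \<in> K \<Longrightarrow> b x \<in> B" "\<And>x. x \<in> K \<Longrightarrow> x \<in> interior (b x)"
        "\<And>x. x \<in> K \<Longrightarrow> b x \<subseteq> - F" by metis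
      obtain K0 where K0: "finite K0" "K0 \<subseteq> K" "K \<subseteq> (\<Union>x\<in>K0. interior (b x))"
        using compactE_image[OF 1(1), of K "\<lambda>x. interior (b x)"] b(2) by (metis UN_I open_interior subsetI)
      have "K \<subseteq> \<Union>(b ` K0)" using K0(3) interior_subset by blast
      then have "fell_cell (b ` K0) {} \<subseteq> U" using 1 by (auto simp: fell_cell_def)
      moreover have "F \<in> fell_cell (b ` K0) {}" using F b(3) K0(2) by (fastforce simp: fell_cell_def)
      moreover have "b ` K0 \<subseteq> B" "finite (b ` K0)" using b(1) K0 by auto
      ultimately show ?thesis by blast
    next
      case 2
      then obtain x where x: "x \<in> F" "x \<in> G" using Basis.prems by auto
      then obtain c where c: "c \<in> B" "x \<in> interior c" "c \<subseteq> G" using B(2)[OF 2(1)] by blast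
      then have "x \<in> c" using interior_subset by blast
      then have "F \<in> fell_cell {} {c}" "fell_cell {} {c} \<subseteq> U"
        using 2 x c Basis.prems by (auto simp: fell_cell_def)
      then show ?thesis using c(1) by (intro exI[of _ "{}"] exI[of _ "{c}"]) auto
    qed
  qed
qed

text \<open>A countable family \<open>B\<close> has only countably many cells, so each Fell-open set
  is a countable union of cells; hence hitting events of compact sets suffice.\<close>

lemma measurable_fell_borel:
  fixes Z :: "'w \<Rightarrow> 'a::euclidean_space set"
  assumes closed: "\<And>x. x \<in> space M \<Longrightarrow> closed (Z x)"
    and hits: "\<And>K. compact K \<Longrightarrow> {x \<in> space M. Z x \<inter> K \<noteq> {}} \<in> sets M"
  shows "Z \<in> measurable M fell_borel"
  unfolding fell_borel_def
proof (rule measurable_measure_of)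
  show "{U. openin fell_topology U} \<subseteq> Pow {F :: 'a set. closed F}"
    using openin_subset topspace_fell_topology by blast
  show "Z \<in> space M \<rightarrow> {F. closed F}" using closed by auto
  fix U :: "'a set set" assume "U \<in> {U. openin fell_topology U}"
  then have U: "openin fell_topology U" by simp
  obtain B :: "'a set set" where B: "countable B" "\<And>b. b \<in> B \<Longrightarrow> compact b"
    "\<And>G x. open G \<Longrightarrow> x \<in> G \<Longrightarrow> \<exists>b\<in>B. x \<in> interior b \<and> b \<subseteq> G"
    using countable_compact_neighbourhoods by blast
  let ?P = "{S. finite S \<and> S \<subseteq> B}"
  let ?c = "\<lambda>S T. {x \<in> space M. Z x \<in> fell_cell S T}"
  define I where "I = {(S, T). S \<in> ?P \<and> T \<in> ?P \<and> fell_cell S T \<subseteq> U}"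
  have "Z -` U \<inter> space M = (\<Union>(S, T)\<in>I. ?c S T)"
  proof (intro equalityI subsetI)
    fix x assume x: "x \<in> Z -` U \<inter> space M"
    show "x \<in> (\<Union>(S, T)\<in>I. ?c S T)"
      using fell_open_local_base[OF B(2,3) U, of "Z x"] x unfolding I_def by blast
  next
    fix x assume "x \<in> (\<Union>(S, T)\<in>I. ?c S T)"
    then show "x \<in> Z -` U \<inter> space M" unfolding I_def by blast
  qed
  moreover have "(\<Union>(S, T)\<in>I. ?c S T) \<in> sets M"
  proof (rule sets.countable_UN')
    have "countable ?P" by (rule countable_Collect_finite_subset[OF B(1)])
    then have "countable (?P \<times> ?P)" by (intro countable_SIGMA)
    then show "countable I" by (rule countable_subset[rotated]) (auto simp: I_def)
    show "(\<lambda>(S, T). ?c S T) ` I \<subseteq> sets M"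
    proof clarify
      fix S T assume "(S, T) \<in> I"
      then have ST: "finite S" "S \<subseteq> B" "finite T" "T \<subseteq> B" by (auto simp: I_def)
      have "compact (\<Union>S)" using ST B(2) by (intro compact_Union) auto
      then have "{x \<in> space M. Z x \<inter> \<Union>S \<noteq> {}} \<in> sets M" by (rule hits)
      then have 1: "{x \<in> space M. \<not> Z x \<inter> \<Union>S \<noteq> {}} \<in> sets M" by (rule sets.sets_Collect_neg)
      have "{x \<in> space M. \<forall>b\<in>T. Z x \<inter> b \<noteq> {}} \<in> sets M"
        using ST B(2) hits by (intro sets.sets_Collect_finite_All) auto
      from sets.sets_Collect_conj[OF 1 this] have "{x \<in> space M. Z x \<inter> \<Union>S = {} \<and> (\<forall>b\<in>T. Z x \<inter> b \<noteq> {})} \<in> sets M"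
        by (simp add: conj_commute)
      also have "{x \<in> space M. Z x \<inter> \<Union>S = {} \<and> (\<forall>b\<in>T. Z x \<inter> b \<noteq> {})} = ?c S T"
        using closed by (auto simp: fell_cell_def)
      finally show "?c S T \<in> sets M" .
    qed
  qed
  ultimately show "Z -` U \<inter> space M \<in> sets M" by simp
qed

text \<open>\<open>miss\<close> and \<open>hit\<close> express convergence tested on the subbase;
  finite intersections and unions preserve it.\<close>

lemma fell_continuous_tendsto:
  fixes Z :: "nat \<Rightarrow> 'a::euclidean_space set" and f :: "'a set \<Rightarrow> real"
  assumes cont: "continuous_map fell_topology euclideanreal f"
    and "closed Y" "\<And>n. closed (Z n)"
    and miss: "\<And>K. compact K \<Longrightarrow> Y \<inter> K = {} \<Longrightarrow> \<forall>\<^sub>F n in sequentially. Z n \<inter> K = {}"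
    and hit: "\<And>G. open G \<Longrightarrow> Y \<inter> G \<noteq> {} \<Longrightarrow> \<forall>\<^sub>F n in sequentially. Z n \<inter> G \<noteq> {}"
  shows "(\<lambda>n. f (Z n)) \<longlonglongrightarrow> f Y"
proof -
  have "\<forall>\<^sub>F n in sequentially. Z n \<in> U" if "openin fell_topology U" "Y \<in> U" for U
  proof -
    have "generate_topology_on ({{F. closed F \<and> F \<inter> K = {}} | K. compact K} \<union>
      {{F. closed F \<and> F \<inter> G \<noteq> {}} | G. open G}) U"
      using that(1) unfolding fell_topology_def by (simp add: openin_topology_generated_by_iff)
    then show ?thesis using that(2)
    proof (induction rule: generate_topology_on.induct)
      case (Int U V)
      then show ?case by (simp add: eventually_conj)
    next
      case (UN \<U>)
      then obtain V where "V \<in> \<U>" "\<forall>\<^sub>F n in sequentially. Z n \<in> V" by blast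
      then show ?case by (elim eventually_mono) blast
    next
      case (Basis U)
      then consider K where "compact K" "U = {F. closed F \<and> F \<inter> K = {}}"
        | G where "open G" "U = {F. closed F \<and> F \<inter> G \<noteq> {}}" by blast
      then show ?case
      proof cases
        case 1
        then show ?thesis using miss[of K] Basis.prems assms(3) by simp
      next
        case 2
        then show ?thesis using hit[of G] Basis.prems assms(3) by simp
      qed
    qed simp
  qed
  then have "limitin fell_topology Z Y sequentially"
    using assms(2) by (simp add: limitin_def topspace_fell_topology)
  then have "limitin euclideanreal (f \<circ> Z) (f Y) sequentially" by (rule continuous_map_limit[OF cont])
  then show ?thesis by (simp add: o_def)
qed

lemma space_fell_borel: "space fell_borel = {F. closed F}"
  by (simp add: fell_borel_def space_measure_of_conv)

lemma fell_continuous_measurable: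
  fixes f :: "'a::euclidean_space set \<Rightarrow> real"
  assumes "continuous_map fell_topology euclideanreal f"
  shows "f \<in> borel_measurable fell_borel"
proof (rule borel_measurableI)
  fix S :: "real set" assume "open S"
  then have "openin fell_topology {x \<in> topspace fell_topology. f x \<in> S}"
    using assms by (intro openin_continuous_map_preimage) auto
  moreover have "{U. openin fell_topology U} \<subseteq> Pow {F :: 'a set. closed F}"
    using openin_subset topspace_fell_topology by blast
  ultimately have "{x \<in> topspace fell_topology. f x \<in> S} \<in> sets fell_borel"
    unfolding fell_borel_def by (simp add: sets_measure_of sigma_sets.Basic)
  moreover have "f -` S \<inter> space fell_borel = {x \<in> topspace fell_topology. f x \<in> S}"
    by (auto simp: space_fell_borel topspace_fell_topology)
  ultimately show "f -` S \<inter> space fell_borel \<in> sets fell_borel" by simp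
qed

section \<open>Measurability with respect to void events\<close>

definition void_algebra :: "'b::topological_space set measure" where
  "void_algebra = sigma UNIV {{A. A \<inter> B = {}} | B. B \<in> sets borel}"

lemma space_void_algebra [simp]: "space void_algebra = UNIV"
  by (simp add: void_algebra_def space_measure_of_conv)

lemma sets_void_algebra: "sets void_algebra = sigma_sets UNIV {{A. A \<inter> B = {}} | B. B \<in> sets borel}"
  by (simp add: void_algebra_def sets_measure_of)

lemma void_event: "B \<in> sets borel \<Longrightarrow> {A. A \<inter> B = {}} \<in> sets void_algebra"
  unfolding sets_void_algebra by (rule sigma_sets.Basic) blast

lemma hit_event: "B \<in> sets borel \<Longrightarrow> {A. A \<inter> B \<noteq> {}} \<in> sets void_algebra"
  using sets.sets_Collect_neg[of void_algebra "\<lambda>A. A \<inter> B = {}"] void_event[of B] by simp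

lemma eventually_less_real: "\<forall>\<^sub>F N in sequentially. x < real N"
  using filterlim_real_sequentially by (simp add: filterlim_at_top_dense)

lemma eventually_inverse_Suc_less: "0 < d \<Longrightarrow> \<forall>\<^sub>F N in sequentially. inverse (real (Suc N)) < d"
  using order_tendstoD(2)[OF LIMSEQ_inverse_real_of_nat] .

text \<open>\<open>k\<close> is both the precision and the radius up to which competing points are inspected, so that
  only countably many void events are needed; \<open>N\<close> bounds the witnesses and keeps them apart.\<close>

definition separated_near ::
    "nat \<Rightarrow> ((nat \<Rightarrow> 'a::euclidean_space \<times> real) \<Rightarrow> 'a \<Rightarrow> bool) \<Rightarrow> nat \<Rightarrow> nat \<Rightarrow> (nat \<Rightarrow> 'a \<times> real) \<Rightarrow> 'a \<Rightarrow> bool" where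
  "separated_near m C N k q w \<longleftrightarrow> (\<forall>i<m. norm (q i) \<le> N) \<and> norm w \<le> N \<and>
     (\<forall>i<m. \<forall>j<m. i \<noteq> j \<longrightarrow> inverse (real (Suc N)) \<le> dist (q i) (q j)) \<and>
     (\<exists>p' w'. C p' w' \<and> (\<forall>i<m. dist (p' i) (q i) < inverse (real (Suc k))) \<and> dist w' w < inverse (real (Suc k)))"

definition approx_minimizers :: "nat \<Rightarrow> nat \<Rightarrow> (nat \<Rightarrow> 'a::euclidean_space \<times> real) \<Rightarrow> 'a \<Rightarrow> ('a \<times> real) set set" where
  "approx_minimizers m k q w = {A. \<forall>i<m. A \<inter> ball (q i) (inverse (real (Suc k))) \<noteq> {} \<and>
     A \<inter> {a. norm a \<le> k \<and> pow w a < pow w (q i) - inverse (real (Suc k))} = {}}"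

lemma approx_minimizers_measurable: "approx_minimizers m k q w \<in> sets void_algebra"
proof -
  have *: "{a. norm a \<le> k \<and> pow w a < pow w (q i) - inverse (real (Suc k))} \<in> sets borel" for i
  proof -
    have "{a. norm a \<le> k \<and> pow w a < pow w (q i) - inverse (real (Suc k))} =
      cball 0 k \<inter> {a. pow w a < pow w (q i) - inverse (real (Suc k))}" by auto
    moreover have "open {a. pow w a < pow w (q i) - inverse (real (Suc k))}"
      by (intro open_Collect_less continuous_intros)
    ultimately show ?thesis by auto
  qed
  have "{A \<in> space void_algebra. A \<inter> ball (q i) (inverse (real (Suc k))) \<noteq> {} \<and>
     A \<inter> {a. norm a \<le> k \<and> pow w a < pow w (q i) - inverse (real (Suc k))} = {}} \<in> sets void_algebra" for i
  proof (rule sets.sets_Collect_conj)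
    show "{A \<in> space void_algebra. A \<inter> ball (q i) (inverse (real (Suc k))) \<noteq> {}} \<in> sets void_algebra"
      using hit_event[OF borel_open[OF open_ball]] by simp
    show "{A \<in> space void_algebra. A \<inter> {a. norm a \<le> k \<and> pow w a < pow w (q i) - inverse (real (Suc k))} = {}}
      \<in> sets void_algebra"
      using void_event[OF *] by simp
  qed
  then have "{A \<in> space void_algebra. \<forall>i\<in>{..<m}. A \<inter> ball (q i) (inverse (real (Suc k))) \<noteq> {} \<and>
     A \<inter> {a. norm a \<le> k \<and> pow w a < pow w (q i) - inverse (real (Suc k))} = {}} \<in> sets void_algebra"
    by (intro sets.sets_Collect_finite_All) simp_all
  then show ?thesis unfolding approx_minimizers_def by (simp add: Ball_def)
qed

text \<open>Points and centre are approximated from the dense sets. The bounds fixed through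
  \<open>N\<close> are strict and survive this, and for given \<open>k\<close> only finitely many
  competitors have to be controlled.\<close>

lemma cluster_imp_approx:
  fixes A :: "('a::euclidean_space \<times> real) set"
  assumes A: "admissible A" and "cluster m C A"
    and D1: "\<And>X :: ('a \<times> real) set. open X \<Longrightarrow> X \<noteq> {} \<Longrightarrow> \<exists>d\<in>D1. d \<in> X"
    and D2: "\<And>X :: 'a set. open X \<Longrightarrow> X \<noteq> {} \<Longrightarrow> \<exists>d\<in>D2. d \<in> X"
  shows "\<exists>N. \<forall>k. \<exists>q\<in>{..<m} \<rightarrow>\<^sub>E D1. \<exists>w\<in>D2. separated_near m C N k q w \<and> A \<in> approx_minimizers m k q w"
proof -
  obtain p w where p: "\<And>i. i < m \<Longrightarrow> p i \<in> minimizers w A" "inj_on p {..<m}" "C p w"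
    using assms(2) unfolding cluster_def by blast
  have "\<forall>\<^sub>F N in sequentially. (\<forall>i\<in>{..<m}. norm (p i) < real N) \<and> norm w < real N \<and>
     (\<forall>i\<in>{..<m}. \<forall>j\<in>{..<m}. i \<noteq> j \<longrightarrow> inverse (real (Suc N)) < dist (p i) (p j))"
    using p(2)
    by (intro eventually_conj eventually_ball_finite ballI eventually_less_real finite_lessThan)
       (auto simp: inj_on_def simp del: of_nat_Suc intro!: eventually_inverse_Suc_less)
  then obtain N where N: "\<forall>i<m. norm (p i) < real N" "norm w < real N"
    "\<forall>i<m. \<forall>j<m. i \<noteq> j \<longrightarrow> inverse (real (Suc N)) < dist (p i) (p j)"
    unfolding eventually_sequentially by (metis (no_types, lifting) lessThan_iff order_refl)
  have "\<exists>d. (\<forall>n. d n \<in> D1) \<and> d \<longlonglongrightarrow> x" for x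
  proof -
    have "x \<in> closure D1" unfolding closure_iff_nhds_not_empty using D1 by blast
    then show ?thesis unfolding closure_sequential .
  qed
  then have "\<forall>i. \<exists>d. (\<forall>n. d n \<in> D1) \<and> d \<longlonglongrightarrow> p i" by blast
  then obtain qs where qs: "\<And>i n. qs i n \<in> D1" "\<And>i. qs i \<longlonglongrightarrow> p i" by metis
  have "w \<in> closure D2" unfolding closure_iff_nhds_not_empty using D2 by blast
  then obtain ws where ws: "\<And>n. ws n \<in> D2" "ws \<longlonglongrightarrow> w" unfolding closure_sequential by blast
  show ?thesis
  proof (intro exI allI)
    fix k
    let ?\<epsilon> = "inverse (real (Suc k))"
    have \<epsilon>: "0 < ?\<epsilon>" by simp
    have finA: "finite (A \<inter> cball 0 (real k))" using A by (simp add: admissible_def)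
    have "\<forall>\<^sub>F n in sequentially. (\<forall>i\<in>{..<m}. norm (qs i n) < real N) \<and> norm (ws n) < real N \<and>
      (\<forall>i\<in>{..<m}. \<forall>j\<in>{..<m}. i \<noteq> j \<longrightarrow> inverse (real (Suc N)) < dist (qs i n) (qs j n)) \<and>
      (\<forall>i\<in>{..<m}. dist (p i) (qs i n) < ?\<epsilon>) \<and> dist w (ws n) < ?\<epsilon> \<and>
      (\<forall>i\<in>{..<m}. \<forall>a\<in>A \<inter> cball 0 (real k). 0 < pow (ws n) a - pow (ws n) (qs i n) + ?\<epsilon>)"
    proof (intro eventually_conj eventually_ball_finite ballI finite_lessThan finA)
      fix i assume i: "i \<in> {..<m}"
      show "\<forall>\<^sub>F n in sequentially. norm (qs i n) < real N"
        using order_tendstoD(2)[OF tendsto_norm[OF qs(2)]] N(1) i by auto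
      show "\<forall>\<^sub>F n in sequentially. dist (p i) (qs i n) < ?\<epsilon>"
        using tendstoD[OF qs(2) \<epsilon>] by (simp add: dist_commute)
      show "\<forall>\<^sub>F n in sequentially. i \<noteq> j \<longrightarrow> inverse (real (Suc N)) < dist (qs i n) (qs j n)" if j: "j \<in> {..<m}" for j
      proof (cases "i = j")
        case False
        then have "inverse (real (Suc N)) < dist (p i) (p j)" using N(3) i j by blast
        from order_tendstoD(1)[OF tendsto_dist[OF qs(2) qs(2)] this] show ?thesis
          by (rule eventually_mono) simp
      qed simp
      show "\<forall>\<^sub>F n in sequentially. 0 < pow (ws n) a - pow (ws n) (qs i n) + ?\<epsilon>" if a: "a \<in> A \<inter> cball 0 (real k)" for a
      proof (rule order_tendstoD(1))
        show "(\<lambda>n. pow (ws n) a - pow (ws n) (qs i n) + ?\<epsilon>) \<longlonglongrightarrow> pow w a - pow w (p i) + ?\<epsilon>"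
          by (intro tendsto_intros ws qs)
        have "pow w (p i) \<le> pow w a" using p(1) i a by (auto simp: mem_minimizers)
        then show "0 < pow w a - pow w (p i) + ?\<epsilon>" using \<epsilon> by linarith
      qed
    next
      show "\<forall>\<^sub>F n in sequentially. norm (ws n) < real N"
        using order_tendstoD(2)[OF tendsto_norm[OF ws(2)] N(2)] .
      show "\<forall>\<^sub>F n in sequentially. dist w (ws n) < ?\<epsilon>"
        using tendstoD[OF ws(2) \<epsilon>] by (simp add: dist_commute)
    qed
    from eventually_happens'[OF trivial_limit_sequentially this]
    obtain n where n: "\<forall>i<m. norm (qs i n) < real N" "norm (ws n) < real N"
      "\<forall>i<m. \<forall>j<m. i \<noteq> j \<longrightarrow> inverse (real (Suc N)) < dist (qs i n) (qs j n)"
      "\<forall>i<m. dist (p i) (qs i n) < ?\<epsilon>" "dist w (ws n) < ?\<epsilon>"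
      "\<forall>i<m. \<forall>a\<in>A \<inter> cball 0 (real k). 0 < pow (ws n) a - pow (ws n) (qs i n) + ?\<epsilon>"
      unfolding Ball_def lessThan_iff by (elim exE conjE) (rule that; blast)
    \<comment> \<open>Restriction puts the tuple into the countable function space over which the
      event is a union.\<close>
    define q where "q = restrict (\<lambda>i. qs i n) {..<m}"
    have qi: "q i = qs i n" if "i < m" for i using that by (simp add: q_def)
    have "q \<in> {..<m} \<rightarrow>\<^sub>E D1" using qs(1) by (auto simp: q_def)
    moreover have "separated_near m C N k q (ws n)"
      unfolding separated_near_def
    proof (intro conjI exI[of _ p] exI[of _ w] allI impI)
      show "norm (q i) \<le> real N" if "i < m" for i using n(1) that by (simp add: qi less_imp_le)
      show "inverse (real (Suc N)) \<le> dist (q i) (q j)" if "i < m" "j < m" "i \<noteq> j" for i j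
        using n(3) that by (simp add: qi less_imp_le del: of_nat_Suc)
      show "dist (p i) (q i) < inverse (real (Suc k))" if "i < m" for i
        using n(4) that by (simp add: qi del: of_nat_Suc)
    qed (use n p in auto)
    moreover have "A \<in> approx_minimizers m k q (ws n)"
    proof -
      have "p i \<in> A \<inter> ball (q i) ?\<epsilon>" if "i < m" for i
        using p(1)[OF that] n(4) that minimizers_subset by (auto simp: qi dist_commute simp del: of_nat_Suc)
      moreover have "A \<inter> {a. norm a \<le> real k \<and> pow (ws n) a < pow (ws n) (q i) - ?\<epsilon>} = {}" if "i < m" for i
      proof -
        have "pow (ws n) (q i) - ?\<epsilon> < pow (ws n) a" if "a \<in> A" "norm a \<le> real k" for a
          using n(6)[rule_format, of i a] that \<open>i < m\<close> by (simp add: qi del: of_nat_Suc)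
        then show ?thesis by fastforce
      qed
      ultimately show ?thesis unfolding approx_minimizers_def by blast
    qed
    ultimately show "\<exists>q\<in>{..<m} \<rightarrow>\<^sub>E D1. \<exists>w\<in>D2. separated_near m C N k q w \<and> A \<in> approx_minimizers m k q w"
      using ws(1) by blast
  qed
qed

text \<open>As \<open>k\<close> grows, the bound \<open>N\<close> gives convergent subsequences, and
  the separation \<open>1 / (N + 1)\<close>, which does not depend on \<open>k\<close>, prevents
  points from merging in the limit. The errors of size \<open>1 / (k + 1)\<close> disappear.\<close>

lemma approx_imp_cluster:
  fixes A :: "('a::euclidean_space \<times> real) set"
  assumes A: "admissible A" and C: "closed_cond m C"
    and ex: "\<And>k. \<exists>q w. separated_near m C N k q w \<and> A \<in> approx_minimizers m k q w"
  shows "cluster m C A"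
proof -
  obtain q w where qw: "\<And>k. separated_near m C N k (q k) (w k)" "\<And>k. A \<in> approx_minimizers m k (q k) (w k)"
    using ex by metis
  have "\<forall>k. \<exists>p' w'. C p' w' \<and> (\<forall>i<m. dist (p' i) (q k i) < inverse (real (Suc k))) \<and> dist w' (w k) < inverse (real (Suc k))"
    using qw(1) unfolding separated_near_def by blast
  then obtain p' w' where p': "\<And>k. C (p' k) (w' k)" "\<And>k i. i < m \<Longrightarrow> dist (p' k i) (q k i) < inverse (real (Suc k))"
    "\<And>k. dist (w' k) (w k) < inverse (real (Suc k))" by metis
  have "\<forall>k i. \<exists>a. i < m \<longrightarrow> a \<in> A \<and> dist a (q k i) < inverse (real (Suc k))"
    using qw(2) unfolding approx_minimizers_def by (fastforce simp: dist_commute simp del: of_nat_Suc)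
  then obtain a where a: "\<And>k i. i < m \<Longrightarrow> a k i \<in> A" "\<And>k i. i < m \<Longrightarrow> dist (a k i) (q k i) < inverse (real (Suc k))"
    by metis
  have "norm (w k) \<le> real N" for k using qw(1) unfolding separated_near_def by blast
  then have "bounded (range w)" by (auto simp: bounded_iff)
  then obtain r w0 where r: "strict_mono (r :: nat \<Rightarrow> nat)" "(w \<circ> r) \<longlonglongrightarrow> w0"
    using bounded_imp_convergent_subsequence by blast
  have "bounded (range (\<lambda>k. q (r k) i))" if "i \<in> {..<m}" for i
  proof -
    have "norm (q k i) \<le> real N" for k using qw(1)[of k] that unfolding separated_near_def by blast
    then show ?thesis by (auto simp: bounded_iff)
  qed
  then obtain p r' where r': "strict_mono (r' :: nat \<Rightarrow> nat)" "\<And>i. i \<in> {..<m} \<Longrightarrow> (\<lambda>k. q (r (r' k)) i) \<longlonglongrightarrow> p i"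
    using finite_common_subseq[of "{..<m}" "\<lambda>k. q (r k)"] by (metis finite_lessThan)
  define s where "s = r \<circ> r'"
  have s: "strict_mono s" using r r' by (simp add: s_def strict_mono_o)
  have ws: "(\<lambda>k. w (s k)) \<longlonglongrightarrow> w0" using LIMSEQ_subseq_LIMSEQ[OF r(2) r'(1)] by (simp add: s_def o_def)
  have qs: "(\<lambda>k. q (s k) i) \<longlonglongrightarrow> p i" if "i < m" for i using r'(2)[of i] that by (simp add: s_def)
  have inv: "(\<lambda>k. inverse (real (Suc (s k)))) \<longlonglongrightarrow> 0"
    using LIMSEQ_subseq_LIMSEQ[OF LIMSEQ_inverse_real_of_nat s] by (simp add: o_def)
  have near: "(\<lambda>k. f (s k)) \<longlonglongrightarrow> l" if "\<And>k. dist (f k) (g k) < inverse (real (Suc k))" "(\<lambda>k. g (s k)) \<longlonglongrightarrow> l"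
    for f g :: "nat \<Rightarrow> 'z::metric_space" and l
  proof -
    have "(\<lambda>k. inverse (real (Suc (s k))) + dist (g (s k)) l) \<longlonglongrightarrow> 0 + dist l l"
      by (intro tendsto_intros inv that)
    then have up: "(\<lambda>k. inverse (real (Suc (s k))) + dist (g (s k)) l) \<longlonglongrightarrow> 0" by simp
    show ?thesis unfolding tendsto_dist_iff[of "\<lambda>k. f (s k)"]
    proof (rule tendsto_sandwich[OF _ _ tendsto_const up])
      show "\<forall>\<^sub>F k in sequentially. dist (f (s k)) l \<le> inverse (real (Suc (s k))) + dist (g (s k)) l"
        using that(1) dist_triangle[of "f (s _)" l "g (s _)"] by (intro always_eventually allI) (smt (verit))
    qed simp
  qed
  have as: "(\<lambda>k. a (s k) i) \<longlonglongrightarrow> p i" if "i < m" for i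
    by (rule near[of "\<lambda>k. a k i" "\<lambda>k. q k i"]) (use a that qs in auto)
  have ps: "(\<lambda>k. p' (s k) i) \<longlonglongrightarrow> p i" if "i < m" for i
    by (rule near[of "\<lambda>k. p' k i" "\<lambda>k. q k i"]) (use p' that qs in auto)
  have w's: "(\<lambda>k. w' (s k)) \<longlonglongrightarrow> w0" by (rule near[of w' w]) (use p' ws in auto)
  have "C p w0"
    by (rule C[unfolded closed_cond_def, rule_format, of "\<lambda>k. p' (s k)" p "\<lambda>k. w' (s k)" w0])
       (use ps w's p' in auto)
  moreover have "inj_on p {..<m}"
  proof (rule inj_onI, rule ccontr)
    fix i j assume ij: "i \<in> {..<m}" "j \<in> {..<m}" "p i = p j" "i \<noteq> j"
    have "inverse (real (Suc N)) \<le> dist (p i) (p j)"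
    proof (rule LIMSEQ_le_const)
      show "(\<lambda>k. dist (q (s k) i) (q (s k) j)) \<longlonglongrightarrow> dist (p i) (p j)" using ij by (intro tendsto_dist qs) auto
      show "\<exists>M. \<forall>k\<ge>M. inverse (real (Suc N)) \<le> dist (q (s k) i) (q (s k) j)"
        using qw(1) ij unfolding separated_near_def by blast
    qed
    then show False using ij by simp
  qed
  moreover have "p i \<in> minimizers w0 A" if i: "i < m" for i
    unfolding mem_minimizers
  proof (intro conjI ballI)
    show "p i \<in> A" using closed_sequentially[OF admissible_closed[OF A], of "\<lambda>k. a (s k) i"] a(1)[OF i] as[OF i] by blast
    fix b assume b: "b \<in> A"
    show "pow w0 (p i) \<le> pow w0 b"
    proof (rule LIMSEQ_le)
      have "(\<lambda>k. pow (w (s k)) (q (s k) i) - inverse (real (Suc (s k)))) \<longlonglongrightarrow> pow w0 (p i) - 0"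
        by (intro tendsto_intros ws qs i inv)
      then show "(\<lambda>k. pow (w (s k)) (q (s k) i) - inverse (real (Suc (s k)))) \<longlonglongrightarrow> pow w0 (p i)" by simp
      show "(\<lambda>k. pow (w (s k)) b) \<longlonglongrightarrow> pow w0 b" by (intro tendsto_intros ws)
      \<comment> \<open>Each fixed competitor is inspected as soon as the index reaches its
        norm.\<close>
      obtain M :: nat where M: "norm b \<le> real M" using real_arch_simple by blast
      show "\<exists>M. \<forall>k\<ge>M. pow (w (s k)) (q (s k) i) - inverse (real (Suc (s k))) \<le> pow (w (s k)) b"
      proof (intro exI[of _ M] allI impI)
        fix k assume "M \<le> k"
        then have "norm b \<le> real (s k)" using M seq_suble[OF s, of k] by linarith
        then show "pow (w (s k)) (q (s k) i) - inverse (real (Suc (s k))) \<le> pow (w (s k)) b"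
          using qw(2)[of "s k"] b i unfolding approx_minimizers_def by (force simp del: of_nat_Suc)
      qed
    qed
  qed
  ultimately show ?thesis unfolding cluster_def by blast
qed

text \<open>A cluster is approximated at every precision \<open>k\<close> with a single bound
  \<open>N\<close>, so the event is a countable combination of \<open>approx_minimizers\<close>. The
  relation \<open>separated_near\<close> does not involve \<open>A\<close>; thus \<open>C\<close>
  only restricts the index set of a countable union.\<close>

lemma cluster_measurable:
  assumes C: "closed_cond m (C :: (nat \<Rightarrow> 'a::euclidean_space \<times> real) \<Rightarrow> 'a \<Rightarrow> bool)"
  shows "\<exists>E\<in>sets void_algebra. \<forall>A. admissible A \<longrightarrow> (A \<in> E \<longleftrightarrow> cluster m C A)"
proof -
  obtain D1 :: "('a \<times> real) set" where D1: "countable D1" "\<And>X. open X \<Longrightarrow> X \<noteq> {} \<Longrightarrow> \<exists>d\<in>D1. d \<in> X"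
    using countable_dense_exists by blast
  obtain D2 :: "'a set" where D2: "countable D2" "\<And>X. open X \<Longrightarrow> X \<noteq> {} \<Longrightarrow> \<exists>d\<in>D2. d \<in> X"
    using countable_dense_exists by blast
  let ?Q = "{..<m} \<rightarrow>\<^sub>E D1"
  have Q: "countable ?Q" using D1(1) by (intro countable_PiE) auto
  define E where "E = (\<Union>N. \<Inter>k. \<Union>q\<in>?Q. \<Union>w\<in>{w \<in> D2. separated_near m C N k q w}. approx_minimizers m k q w)"
  have "countable {w \<in> D2. P w}" for P by (rule countable_subset[OF _ D2(1)]) auto
  then have "E \<in> sets void_algebra"
    unfolding E_def
    by (intro sets.countable_UN' sets.countable_INT' image_subsetI Q countableI_type approx_minimizers_measurable)
       auto
  moreover have "A \<in> E \<longleftrightarrow> cluster m C A" if A: "admissible A" for A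
  proof
    assume "A \<in> E"
    then have "\<exists>N. \<forall>k. \<exists>q w. separated_near m C N k q w \<and> A \<in> approx_minimizers m k q w"
      unfolding E_def UN_iff INT_iff by fast
    then obtain N where "\<And>k. \<exists>q w. separated_near m C N k q w \<and> A \<in> approx_minimizers m k q w"
      by (elim exE) (rule that, rule spec)
    then show "cluster m C A" by (rule approx_imp_cluster[OF A C])
  next
    assume "cluster m C A"
    from cluster_imp_approx[OF A this D1(2) D2(2)]
    show "A \<in> E" unfolding E_def UN_iff INT_iff by fast
  qed
  ultimately show ?thesis by blast
qed

section \<open>Laws determined by void probabilities\<close>

text \<open>All that is kept of a Poisson process. \<open>L\<close> is a bare set function, so
  images and restrictions of the process are handled by composing \<open>L\<close> with preimages;
  an infinite value corresponds to void probability \<open>0\<close>.\<close>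

definition void_law :: "'w measure \<Rightarrow> ('b::topological_space set \<Rightarrow> ennreal) \<Rightarrow> ('w \<Rightarrow> 'b set) \<Rightarrow> bool" where
  "void_law M L \<eta> \<longleftrightarrow> prob_space M \<and> (\<forall>B\<in>sets borel. {\<omega> \<in> space M. \<eta> \<omega> \<inter> B = {}} \<in> sets M \<and>
     measure M {\<omega> \<in> space M. \<eta> \<omega> \<inter> B = {}} = (if L B = \<infinity> then 0 else exp (- enn2real (L B))))"

lemma num_points_eq_0: "num_points \<eta> B \<omega> = 0 \<longleftrightarrow> \<eta> \<omega> \<inter> B = {}"
  by (simp add: num_points_def emeasure_count_space_eq_0)

lemma poisson_hit_measurable:
  assumes "poisson_process M \<Lambda> \<eta>" "B \<in> sets borel"
  shows "{\<omega> \<in> space M. \<eta> \<omega> \<inter> B \<noteq> {}} \<in> sets M" "{\<omega> \<in> space M. \<eta> \<omega> \<inter> B = {}} \<in> sets M"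
proof -
  have [measurable]: "num_points \<eta> B \<in> borel_measurable M"
    using assms by (auto simp: poisson_process_def point_process_def)
  have "{\<omega> \<in> space M. num_points \<eta> B \<omega> \<noteq> 0} \<in> sets M" "{\<omega> \<in> space M. num_points \<eta> B \<omega> = 0} \<in> sets M"
    by measurable
  then show "{\<omega> \<in> space M. \<eta> \<omega> \<inter> B \<noteq> {}} \<in> sets M" "{\<omega> \<in> space M. \<eta> \<omega> \<inter> B = {}} \<in> sets M"
    by (simp_all add: num_points_eq_0)
qed

lemma poisson_void_law:
  assumes "poisson_process M \<Lambda> \<eta>"
  shows "void_law M (emeasure \<Lambda>) \<eta>"
  unfolding void_law_def
proof (intro conjI ballI)
  show "prob_space M" using assms by (simp add: poisson_process_def point_process_def)
  then interpret prob_space M .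
  fix B :: "'b set" assume B: "B \<in> sets borel"
  show "{\<omega> \<in> space M. \<eta> \<omega> \<inter> B = {}} \<in> sets M" by (rule poisson_hit_measurable(2)[OF assms B])
  show "prob {\<omega> \<in> space M. \<eta> \<omega> \<inter> B = {}} = (if emeasure \<Lambda> B = \<infinity> then 0 else exp (- enn2real (emeasure \<Lambda> B)))"
  proof (cases "emeasure \<Lambda> B = \<infinity>")
    case True
    then have "AE \<omega> in M. num_points \<eta> B \<omega> = \<infinity>" using assms B unfolding poisson_process_def by blast
    then have "AE \<omega> in M. \<not> \<eta> \<omega> \<inter> B = {}"
      by eventually_elim (metis num_points_eq_0 ennreal_zero_neq_top infinity_ennreal_def)
    then have "prob {\<omega> \<in> space M. \<eta> \<omega> \<inter> B = {}} = 0"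
      using poisson_hit_measurable(2)[OF assms B] by (subst prob_eq_0) auto
    then show ?thesis using True by simp
  next
    case False
    then have "emeasure \<Lambda> B < \<infinity>" by (simp add: less_top)
    then have "prob {\<omega> \<in> space M. num_points \<eta> B \<omega> = of_nat 0} = exp (- measure \<Lambda> B) * measure \<Lambda> B ^ 0 / fact 0"
      using assms B unfolding poisson_process_def by blast
    then show ?thesis using False by (simp add: num_points_eq_0 measure_def)
  qed
qed

lemma void_law_measurable:
  fixes \<eta> :: "'w \<Rightarrow> 'b::topological_space set"
  assumes "void_law M L \<eta>"
  shows "\<eta> \<in> measurable M void_algebra"
  unfolding void_algebra_def
proof (rule measurable_measure_of)
  fix Y :: "'b set set" assume "Y \<in> {{A. A \<inter> B = {}} | B. B \<in> sets borel}"
  then obtain B where B: "B \<in> sets borel" "Y = {A. A \<inter> B = {}}" by blast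
  have "\<eta> -` Y \<inter> space M = {\<omega> \<in> space M. \<eta> \<omega> \<inter> B = {}}" using B by auto
  then show "\<eta> -` Y \<inter> space M \<in> sets M" using assms B by (simp add: void_law_def)
qed auto

lemma void_law_emeasure:
  assumes "void_law M L \<eta>" "B \<in> sets borel"
  shows "emeasure M {\<omega> \<in> space M. \<eta> \<omega> \<inter> B = {}} = (if L B = \<infinity> then 0 else ennreal (exp (- enn2real (L B))))"
proof -
  interpret prob_space M using assms by (simp add: void_law_def)
  show ?thesis using assms unfolding emeasure_eq_measure void_law_def by simp
qed

lemma emeasure_distr_void:
  assumes "void_law M L \<eta>" "B \<in> sets borel"
  shows "emeasure (distr M void_algebra \<eta>) {A. A \<inter> B = {}} =
    (if L B = \<infinity> then 0 else ennreal (exp (- enn2real (L B))))"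
proof -
  have "\<eta> -` {A. A \<inter> B = {}} \<inter> space M = {\<omega> \<in> space M. \<eta> \<omega> \<inter> B = {}}" by auto
  then show ?thesis
    using emeasure_distr[OF void_law_measurable[OF assms(1)] void_event[OF assms(2)]] void_law_emeasure[OF assms]
    by simp
qed

text \<open>Missing \<open>B\<close> and missing \<open>B'\<close> together means missing their
  union, so the void events form an intersection-stable generator and the uniqueness theorem for
  measures applies.\<close>

lemma void_law_distr_eq:
  fixes \<eta> :: "'w \<Rightarrow> 'b::topological_space set" and \<eta>' :: "'u \<Rightarrow> 'b set"
  assumes 1: "void_law M L \<eta>" and 2: "void_law M' L \<eta>'"
  shows "distr M void_algebra \<eta> = distr M' void_algebra \<eta>'"
proof (rule measure_eqI_generator_eq)
  let ?E = "{{A. A \<inter> B = {}} | B :: 'b set. B \<in> sets borel}"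
  show "Int_stable ?E"
  proof (rule Int_stableI, clarify)
    fix B B' :: "'b set" assume "B \<in> sets borel" "B' \<in> sets borel"
    moreover have "{A. A \<inter> B = {}} \<inter> {A. A \<inter> B' = {}} = {A. A \<inter> (B \<union> B') = {}}" by auto
    ultimately show "\<exists>C. {A. A \<inter> B = {}} \<inter> {A. A \<inter> B' = {}} = {A. A \<inter> C = {}} \<and> C \<in> sets borel" by blast
  qed
  show "?E \<subseteq> Pow UNIV" by auto
  show "sets (distr M void_algebra \<eta>) = sigma_sets UNIV ?E" "sets (distr M' void_algebra \<eta>') = sigma_sets UNIV ?E"
    by (simp_all add: sets_void_algebra)
  show "range (\<lambda>_::nat. UNIV) \<subseteq> ?E" by (auto intro!: exI[of _ "{}"])
  show "emeasure (distr M void_algebra \<eta>) X = emeasure (distr M' void_algebra \<eta>') X" if "X \<in> ?E" for X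
    using that emeasure_distr_void[OF 1] emeasure_distr_void[OF 2] by auto
  interpret D: prob_space "distr M void_algebra \<eta>"
    using 1 by (intro prob_space.prob_space_distr void_law_measurable) (auto simp: void_law_def)
  show "emeasure (distr M void_algebra \<eta>) UNIV \<noteq> \<infinity>" for i :: nat using D.emeasure_finite by simp
qed auto

text \<open>An image misses \<open>B\<close> exactly when the points in \<open>S\<close> miss the
  preimage of \<open>B\<close>. In this form a mapping theorem is immediate, even if points
  collide.\<close>

lemma void_law_image:
  assumes "void_law M L \<eta>" "f \<in> borel_measurable borel" "S \<in> sets borel"
  shows "void_law M (\<lambda>B. L (f -` B \<inter> S)) (\<lambda>\<omega>. f ` (\<eta> \<omega> \<inter> S))"
proof -
  have "f -` B \<inter> S \<in> sets borel" if "B \<in> sets borel" for B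
    using measurable_sets[OF assms(2) that] assms(3) by simp
  moreover have "f ` (A \<inter> S) \<inter> B = {} \<longleftrightarrow> A \<inter> (f -` B \<inter> S) = {}" for A B by auto
  ultimately show ?thesis using assms(1) unfolding void_law_def by simp
qed

lemma void_law_AE_hit:
  assumes "void_law M L \<eta>" "B \<in> sets borel" "L B = \<infinity>"
  shows "AE \<omega> in M. \<eta> \<omega> \<inter> B \<noteq> {}"
proof (rule AE_I)
  show "{\<omega> \<in> space M. \<not> \<eta> \<omega> \<inter> B \<noteq> {}} \<subseteq> {\<omega> \<in> space M. \<eta> \<omega> \<inter> B = {}}" by auto
  show "emeasure M {\<omega> \<in> space M. \<eta> \<omega> \<inter> B = {}} = 0" using void_law_emeasure[OF assms(1,2)] assms(3) by simp
  show "{\<omega> \<in> space M. \<eta> \<omega> \<inter> B = {}} \<in> sets M" using assms by (simp add: void_law_def)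
qed

lemma void_law_AE_miss:
  assumes "void_law M L \<eta>" "B \<in> sets borel" "L B = 0"
  shows "AE \<omega> in M. \<eta> \<omega> \<inter> B = {}"
proof -
  interpret prob_space M using assms by (simp add: void_law_def)
  have "prob {\<omega> \<in> space M. \<eta> \<omega> \<inter> B = {}} = 1" using assms by (simp add: void_law_def)
  then show ?thesis using AE_in_set_eq_1[of "{\<omega> \<in> space M. \<eta> \<omega> \<inter> B = {}}"] assms
    by (auto simp: void_law_def)
qed

text \<open>The hitting events are only required to agree with void events on \<open>\<G>\<close>,
  and \<open>\<G>\<close> itself may lie outside \<open>void_algebra\<close>; the trace of the
  algebra on \<open>\<G>\<close> carries the argument.\<close>

definition void_measurable_on :: "('b::topological_space set) set \<Rightarrow> ('b set \<Rightarrow> 'a::euclidean_space set) \<Rightarrow> bool" where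
  "void_measurable_on \<G> Z \<longleftrightarrow> (\<forall>A\<in>\<G>. closed (Z A)) \<and>
     (\<forall>K. compact K \<longrightarrow> (\<exists>E\<in>sets void_algebra. \<forall>A\<in>\<G>. A \<in> E \<longleftrightarrow> Z A \<inter> K \<noteq> {}))"

lemma void_measurable_on_event:
  fixes Z :: "'b::topological_space set \<Rightarrow> 'a::euclidean_space set"
  assumes "void_measurable_on \<G> Z" "U \<in> sets fell_borel"
  shows "\<exists>E\<in>sets void_algebra. \<forall>A\<in>\<G>. A \<in> E \<longleftrightarrow> Z A \<in> U"
proof -
  have sp: "space (restrict_space void_algebra \<G>) = \<G>" by (simp add: space_restrict_space)
  have "Z \<in> measurable (restrict_space void_algebra \<G>) fell_borel"
  proof (rule measurable_fell_borel)
    show "closed (Z A)" if "A \<in> space (restrict_space void_algebra \<G>)" for A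
      using that assms(1) sp by (simp add: void_measurable_on_def)
    fix K :: "'a set" assume "compact K"
    then obtain E where "E \<in> sets void_algebra" "\<forall>A\<in>\<G>. A \<in> E \<longleftrightarrow> Z A \<inter> K \<noteq> {}"
      using assms(1) unfolding void_measurable_on_def by blast
    then have "{A \<in> \<G>. Z A \<inter> K \<noteq> {}} = \<G> \<inter> E" "E \<in> sets void_algebra" by auto
    then show "{x \<in> space (restrict_space void_algebra \<G>). Z x \<inter> K \<noteq> {}} \<in> sets (restrict_space void_algebra \<G>)"
      unfolding sp sets_restrict_space by auto
  qed
  then have "Z -` U \<inter> \<G> \<in> sets (restrict_space void_algebra \<G>)"
    using measurable_sets[OF _ assms(2)] sp by metis
  then show ?thesis unfolding sets_restrict_space by blast
qed

text \<open>The preimage agrees with the measurable event given by \<open>E\<close> except inside a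
  null event. An arbitrary subset of a null event may be involved, which is why the completion
  appears.\<close>

lemma closed_version_vimage:
  assumes vm: "void_measurable_on \<G> Z" and law: "void_law M L \<eta>" and good: "AE \<omega> in M. \<eta> \<omega> \<in> \<G>"
    and E: "E \<in> sets void_algebra" "\<forall>A\<in>\<G>. A \<in> E \<longleftrightarrow> Z A \<in> U"
  shows "closed_version (\<lambda>\<omega>. Z (\<eta> \<omega>)) -` U \<inter> space M \<in> sets (completion M)" (is "?P \<in> _")
    and "emeasure (completion M) (closed_version (\<lambda>\<omega>. Z (\<eta> \<omega>)) -` U \<inter> space M) = emeasure (distr M void_algebra \<eta>) E"
proof -
  have E': "\<eta> -` E \<inter> space M \<in> sets M" by (rule measurable_sets[OF void_law_measurable[OF law] E(1)])
  have "AE \<omega> in M. \<omega> \<in> space M \<longrightarrow> (\<omega> \<in> \<eta> -` E \<inter> space M \<longleftrightarrow> \<omega> \<in> ?P)"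
    using good
  proof eventually_elim
    case (elim \<omega>)
    then have "closed (Z (\<eta> \<omega>))" using vm by (simp add: void_measurable_on_def)
    then show ?case using elim E(2) by (simp add: closed_version_def)
  qed
  then have "AE \<omega> in M. \<omega> \<in> \<eta> -` E \<inter> space M \<longleftrightarrow> \<omega> \<in> ?P" by (auto elim: eventually_mono)
  then have ae: "AE \<omega> in completion M. \<omega> \<in> \<eta> -` E \<inter> space M \<longleftrightarrow> \<omega> \<in> ?P" by (rule AE_completion)
  have E'': "\<eta> -` E \<inter> space M \<in> sets (completion M)" using E' by (rule sets_completionI_sets)
  show P: "?P \<in> sets (completion M)" using completion.in_sets_AE[OF ae E''] by simp
  have "emeasure (completion M) ?P = emeasure (completion M) (\<eta> -` E \<inter> space M)"
    by (rule emeasure_eq_AE) (use ae P E'' in \<open>auto elim: eventually_mono\<close>)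
  also have "\<dots> = emeasure M (\<eta> -` E \<inter> space M)" using E' by (simp add: emeasure_completion)
  also have "\<dots> = emeasure (distr M void_algebra \<eta>) E"
    by (rule emeasure_distr[symmetric, OF void_law_measurable[OF law] E(1)])
  finally show "emeasure (completion M) ?P = emeasure (distr M void_algebra \<eta>) E" .
qed

lemma random_closed_set_void:
  fixes Z :: "'b::topological_space set \<Rightarrow> 'a::euclidean_space set"
  assumes vm: "void_measurable_on \<G> Z" and law: "void_law M L \<eta>" and good: "AE \<omega> in M. \<eta> \<omega> \<in> \<G>"
  shows "random_closed_set M (\<lambda>\<omega>. Z (\<eta> \<omega>))"
  unfolding random_closed_set_def
proof (intro conjI)
  show "prob_space M" using law by (simp add: void_law_def)
  show "AE \<omega> in M. closed (Z (\<eta> \<omega>))"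
    using good by eventually_elim (use vm in \<open>simp add: void_measurable_on_def\<close>)
  show "closed_version (\<lambda>\<omega>. Z (\<eta> \<omega>)) \<in> measurable (completion M) fell_borel"
  proof (rule measurableI)
    show "closed_version (\<lambda>\<omega>. Z (\<eta> \<omega>)) \<omega> \<in> space fell_borel" for \<omega>
      by (simp add: space_fell_borel closed_version_def)
    fix U :: "'a set set" assume "U \<in> sets fell_borel"
    then show "closed_version (\<lambda>\<omega>. Z (\<eta> \<omega>)) -` U \<inter> space (completion M) \<in> sets (completion M)"
      using void_measurable_on_event[OF vm] closed_version_vimage(1)[OF vm law good] by (metis space_completion)
  qed
qed

text \<open>This justifies the coupling: processes on different probability spaces with the same
  void probabilities yield random closed sets with the same law.\<close>

lemma closed_set_law_eq:
  fixes Z :: "'b::topological_space set \<Rightarrow> 'a::euclidean_space set"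
  assumes vm: "void_measurable_on \<G> Z"
    and law: "void_law M L \<eta>" "void_law M' L \<eta>'"
    and good: "AE \<omega> in M. \<eta> \<omega> \<in> \<G>" "AE \<omega> in M'. \<eta>' \<omega> \<in> \<G>"
  shows "closed_set_law M (\<lambda>\<omega>. Z (\<eta> \<omega>)) = closed_set_law M' (\<lambda>\<omega>. Z (\<eta>' \<omega>))"
  unfolding closed_set_law_def
proof (rule measure_eqI)
  fix U :: "'a set set" assume "U \<in> sets (distr (completion M) fell_borel (closed_version (\<lambda>\<omega>. Z (\<eta> \<omega>))))"
  then have U: "U \<in> sets fell_borel" by simp
  obtain E where E: "E \<in> sets void_algebra" "\<forall>A\<in>\<G>. A \<in> E \<longleftrightarrow> Z A \<in> U"
    using void_measurable_on_event[OF vm U] by blast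
  have "closed_version (\<lambda>\<omega>. Z (\<eta> \<omega>)) \<in> measurable (completion M) fell_borel"
    "closed_version (\<lambda>\<omega>. Z (\<eta>' \<omega>)) \<in> measurable (completion M') fell_borel"
    using random_closed_set_void[OF vm law(1) good(1)] random_closed_set_void[OF vm law(2) good(2)]
    by (auto simp: random_closed_set_def)
  then show "emeasure (distr (completion M) fell_borel (closed_version (\<lambda>\<omega>. Z (\<eta> \<omega>)))) U =
    emeasure (distr (completion M') fell_borel (closed_version (\<lambda>\<omega>. Z (\<eta>' \<omega>)))) U"
    using closed_version_vimage(2)[OF vm law(1) good(1) E] closed_version_vimage(2)[OF vm law(2) good(2) E]
      void_law_distr_eq[OF law] U by (simp add: emeasure_distr)
qed simp

lemma integral_closed_set_law:
  fixes f :: "'a::euclidean_space set \<Rightarrow> real"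
  assumes "random_closed_set M Z" "continuous_map fell_topology euclideanreal f"
  shows "(\<integral>x. f x \<partial>closed_set_law M Z) = (\<integral>\<omega>. f (closed_version Z \<omega>) \<partial>completion M)"
  unfolding closed_set_law_def
  by (rule integral_distr) (use assms fell_continuous_measurable in \<open>auto simp: random_closed_set_def\<close>)

lemma integral_closed_set_law_tendsto:
  fixes f :: "'a::euclidean_space set \<Rightarrow> real" and Z :: "nat \<Rightarrow> 'w \<Rightarrow> 'a set"
  assumes Z: "\<And>n. random_closed_set M (Z n)" and Y: "random_closed_set M Y"
    and f: "continuous_map fell_topology euclideanreal f" "bounded (f ` topspace fell_topology)"
    and conv: "AE \<omega> in M. (\<forall>n. closed (Z n \<omega>)) \<and> closed (Y \<omega>) \<and>
      (\<forall>K. compact K \<longrightarrow> Y \<omega> \<inter> K = {} \<longrightarrow> (\<forall>\<^sub>F n in sequentially. Z n \<omega> \<inter> K = {})) \<and>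
      (\<forall>G. open G \<longrightarrow> Y \<omega> \<inter> G \<noteq> {} \<longrightarrow> (\<forall>\<^sub>F n in sequentially. Z n \<omega> \<inter> G \<noteq> {}))"
  shows "(\<lambda>n. \<integral>x. f x \<partial>closed_set_law M (Z n)) \<longlonglongrightarrow> (\<integral>x. f x \<partial>closed_set_law M Y)"
proof -
  interpret prob_space M using Y by (simp add: random_closed_set_def)
  interpret C: prob_space "completion M" by (rule prob_space_completion)
  obtain b where b: "\<And>F. closed F \<Longrightarrow> \<bar>f F\<bar> \<le> b"
    using f(2) unfolding bounded_iff topspace_fell_topology by auto
  have cv: "closed (closed_version X \<omega>)" for X :: "'w \<Rightarrow> 'a set" and \<omega>
    by (simp add: closed_version_def)
  have meas: "(\<lambda>\<omega>. f (closed_version X \<omega>)) \<in> borel_measurable (completion M)" if "random_closed_set M X" for X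
    using that fell_continuous_measurable[OF f(1)] unfolding random_closed_set_def
    by (auto intro: measurable_compose)
  have "(\<lambda>n. \<integral>\<omega>. f (closed_version (Z n) \<omega>) \<partial>completion M) \<longlonglongrightarrow> (\<integral>\<omega>. f (closed_version Y \<omega>) \<partial>completion M)"
  proof (rule integral_dominated_convergence[where w = "\<lambda>_. b"])
    show "AE \<omega> in completion M. (\<lambda>n. f (closed_version (Z n) \<omega>)) \<longlonglongrightarrow> f (closed_version Y \<omega>)"
    proof (rule AE_completion, use conv in eventually_elim)
      case (elim \<omega>)
      then have "closed_version Y \<omega> = Y \<omega>" "\<And>n. closed_version (Z n) \<omega> = Z n \<omega>"
        by (auto simp: closed_version_def)
      then show ?case using elim by (simp, intro fell_continuous_tendsto[OF f(1)]) auto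
    qed
  qed (use meas Z Y b cv in auto)
  then show ?thesis unfolding integral_closed_set_law[OF Z f(1)] integral_closed_set_law[OF Y f(1)] .
qed

section \<open>Almost sure genericity\<close>

text \<open>This bound plays the role of the multivariate Mecke formula.\<close>

definition hit_bound :: "'w measure \<Rightarrow> real \<Rightarrow> ('w \<Rightarrow> 'a::euclidean_space set) \<Rightarrow> bool" where
  "hit_bound M c Z \<longleftrightarrow> prob_space M \<and> 0 \<le> c \<and> (\<forall>B\<in>sets borel. {\<omega> \<in> space M. Z \<omega> \<inter> B \<noteq> {}} \<in> sets M) \<and>
     (\<forall>(B :: nat \<Rightarrow> 'a set) n. (\<forall>i<n. B i \<in> sets borel \<and> bounded (B i)) \<and> disjoint_family_on B {..<n} \<longrightarrow>
        measure M {\<omega> \<in> space M. \<forall>i<n. Z \<omega> \<inter> B i \<noteq> {}} \<le> (\<Prod>i<n. c * measure lborel (B i)))"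

section \<open>Almost sure avoidance of relations with null fibres\<close>

lemma finite_small_partition:
  fixes C :: "'a::euclidean_space set"
  assumes "compact C" "e > 0"
  shows "\<exists>N x P. (\<forall>j<(N::nat). x j \<in> C \<and> P j \<in> sets borel \<and> P j \<subseteq> C \<inter> cball (x j) e) \<and>
    disjoint_family_on P {..<N} \<and> (\<Union>j<N. P j) = C"
proof -
  obtain k where k: "finite k" "k \<subseteq> C" "C \<subseteq> (\<Union>x\<in>k. ball x e)"
    using compactE_image[OF assms(1), of C "\<lambda>x. ball x e"] assms(2) by (metis UN_I centre_in_ball open_ball subsetI)
  obtain N and x :: "nat \<Rightarrow> 'a" where x: "k = x ` {..<N}"
    using finite_imp_nat_seg_image_inj_on[OF k(1)] by (metis lessThan_def)
  define Q where "Q j = C \<inter> cball (x j) e" for j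
  have "disjoint_family_on (disjointed Q) {..<N}"
    using disjoint_family_disjointed[of Q] by (auto simp: disjoint_family_on_def)
  moreover have "(\<Union>j<N. disjointed Q j) = C"
  proof -
    have "(\<Union>j<N. disjointed Q j) = (\<Union>j<N. Q j)"
      using finite_UN_disjointed_eq[of Q N] by (simp add: atLeast0LessThan)
    also have "\<dots> = C"
    proof
      show "C \<subseteq> (\<Union>j<N. Q j)"
      proof
        fix z assume z: "z \<in> C"
        then obtain j where "j < N" "z \<in> ball (x j) e" using k(3) x by auto
        then show "z \<in> (\<Union>j<N. Q j)" using z by (intro UN_I[of j]) (auto simp: Q_def)
      qed
    qed (auto simp: Q_def)
    finally show ?thesis .
  qed
  moreover have "disjointed Q j \<in> sets borel" for j
  proof -
    have "Q i \<in> sets borel" for i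
      using compact_imp_closed[OF assms(1)] by (auto simp: Q_def)
    then show ?thesis by (auto simp: disjointed_def)
  qed
  moreover have "disjointed Q j \<subseteq> C \<inter> cball (x j) e" for j
    using disjointed_subset[of Q j] by (auto simp: Q_def)
  moreover have "x j \<in> C" if "j < N" for j using k(2) x that by auto
  ultimately show ?thesis by blast
qed

text \<open>A substitute for integrating over tuples of points. For each \<open>p\<close> the fibre
  of bad \<open>y\<close> is null; closedness of \<open>R\<close> and compactness of the boxes make
  the fibres small uniformly over small cells of tuples. The boxes are disjoint because
  \<open>hit_bound\<close> gives a product bound for disjoint sets only.\<close>

locale closed_relation =
  fixes k :: nat and C :: "nat \<Rightarrow> 'a::euclidean_space set" and R :: "(nat \<Rightarrow> 'a) \<Rightarrow> 'a \<Rightarrow> bool"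
  assumes compact_C: "\<And>i. i \<le> k \<Longrightarrow> compact (C i)"
    and disjoint_C: "disjoint_family_on C {..k}"
    and closed_R: "\<And>ps ys p y. (\<And>i. i < k \<Longrightarrow> (\<lambda>n. ps n i) \<longlonglongrightarrow> p i) \<Longrightarrow> ys \<longlonglongrightarrow> y \<Longrightarrow>
      (\<And>n::nat. R (ps n) (ys n)) \<Longrightarrow> R p y"
    and null_R: "\<And>p. (\<And>i. i < k \<Longrightarrow> p i \<in> C i) \<Longrightarrow> negligible {y \<in> C k. R p y}"
begin

definition W :: "real \<Rightarrow> (nat \<Rightarrow> 'a) \<Rightarrow> 'a set" where
  "W e x = {y \<in> C k. \<exists>p. (\<forall>i<k. p i \<in> C i \<and> dist (p i) (x i) \<le> e) \<and> R p y}"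

lemma bounded_seq_C:
  assumes "\<And>n i. i < k \<Longrightarrow> p n i \<in> C i"
  obtains l r where "strict_mono (r :: nat \<Rightarrow> nat)" "\<And>i. i < k \<Longrightarrow> (\<lambda>n. p (r n) i) \<longlonglongrightarrow> l i" "\<And>i. i < k \<Longrightarrow> l i \<in> C i"
proof -
  have "bounded (range (\<lambda>n. p n i))" if "i \<in> {..<k}" for i
  proof (rule bounded_subset[OF compact_imp_bounded])
    show "compact (C i)" using compact_C that by simp
    show "range (\<lambda>n. p n i) \<subseteq> C i" using assms that by auto
  qed
  then obtain l r where r: "strict_mono (r :: nat \<Rightarrow> nat)" "\<And>i. i \<in> {..<k} \<Longrightarrow> (\<lambda>n. p (r n) i) \<longlonglongrightarrow> l i"
    using finite_common_subseq[of "{..<k}" p] by (metis finite_lessThan)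
  moreover have "l i \<in> C i" if "i < k" for i
    using closed_sequentially[OF compact_imp_closed[OF compact_C[of i]], of "\<lambda>n. p (r n) i" "l i"] r that assms by auto
  ultimately show thesis using that by auto
qed

lemma closed_W: "closed (W e x)"
  unfolding closed_sequential_limits
proof (intro allI impI, elim conjE)
  fix ys y assume ys: "\<forall>n. ys n \<in> W e x" "ys \<longlonglongrightarrow> y"
  have "\<forall>n. \<exists>p. (\<forall>i<k. p i \<in> C i \<and> dist (p i) (x i) \<le> e) \<and> R p (ys n)" using ys(1) unfolding W_def by blast
  then obtain p where p: "\<And>n i. i < k \<Longrightarrow> p n i \<in> C i" "\<And>n i. i < k \<Longrightarrow> dist (p n i) (x i) \<le> e" "\<And>n. R (p n) (ys n)"
    by metis
  obtain l r where r: "strict_mono (r :: nat \<Rightarrow> nat)" "\<And>i. i < k \<Longrightarrow> (\<lambda>n. p (r n) i) \<longlonglongrightarrow> l i" "\<And>i. i < k \<Longrightarrow> l i \<in> C i"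
    using bounded_seq_C[of p] p(1) by metis
  have "R l y"
    by (rule closed_R[of "p \<circ> r" l "ys \<circ> r"]) (use r p LIMSEQ_subseq_LIMSEQ[OF ys(2) r(1)] in auto)
  moreover have "dist (l i) (x i) \<le> e" if "i < k" for i
    by (rule LIMSEQ_le_const2[OF tendsto_dist[OF r(2)[OF that] tendsto_const]]) (use p that in auto)
  moreover have "y \<in> C k"
    using closed_sequentially[OF compact_imp_closed[OF compact_C[of k]], of ys y] ys by (auto simp: W_def)
  ultimately show "y \<in> W e x" using r(3) unfolding W_def by blast
qed

lemma W_subset: "W e x \<subseteq> C k"
  by (auto simp: W_def)

text \<open>Otherwise there are centres with large \<open>W\<close> at every scale, and a
  subsequence of them converges to some \<open>l\<close>. Points in infinitely many of these sets
  are related to \<open>l\<close> by closedness, so a set of measure at least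
  \<open>\<epsilon>\<close> would lie in a null fibre.\<close>

lemma W_small:
  assumes "\<epsilon> > 0"
  shows "\<exists>n::nat. \<forall>x. (\<forall>i<k. x i \<in> C i) \<longrightarrow> measure lborel (W (inverse (real (Suc n))) x) < \<epsilon>"
proof (rule ccontr)
  assume "\<not> ?thesis"
  then have "\<forall>n. \<exists>x. (\<forall>i<k. x i \<in> C i) \<and> \<epsilon> \<le> measure lborel (W (inverse (real (Suc n))) x)"
    by (simp add: not_less)
  then obtain x where x: "\<And>n i. i < k \<Longrightarrow> x n i \<in> C i"
    "\<And>n. \<epsilon> \<le> measure lborel (W (inverse (real (Suc n))) (x n))" by metis
  obtain l r where r: "strict_mono (r :: nat \<Rightarrow> nat)" "\<And>i. i < k \<Longrightarrow> (\<lambda>n. x (r n) i) \<longlonglongrightarrow> l i" "\<And>i. i < k \<Longrightarrow> l i \<in> C i"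
    using bounded_seq_C[of x] x(1) by metis
  define T where "T n = W (inverse (real (Suc (r n)))) (x (r n))" for n
  \<comment> \<open>Decreasing tails inside the compact box \<open>C k\<close>: by continuity from
    above their intersection keeps measure at least \<open>\<epsilon>\<close>.\<close>
  define V where "V m = (\<Union>n\<in>{m..}. T n)" for m
  have Tb: "T n \<in> sets lborel" for n unfolding T_def using closed_W by simp
  have Vb: "V m \<in> sets lborel" for m unfolding V_def using Tb by (intro sets.countable_UN') auto
  have VC: "V m \<subseteq> C k" for m unfolding V_def T_def using W_subset by blast
  have Cfin: "emeasure lborel (C k) < \<infinity>" using compact_C by (intro emeasure_compact_finite) auto
  then have Vfin: "emeasure lborel (V m) \<noteq> \<infinity>" for m
    using emeasure_mono[OF VC, of lborel m] compact_C[of k] by (auto simp: compact_imp_closed top.extremum_unique)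
  have "(\<lambda>m. emeasure lborel (V m)) \<longlonglongrightarrow> emeasure lborel (\<Inter>m. V m)"
  proof (rule Lim_emeasure_decseq)
    show "decseq V" unfolding decseq_def
    proof (intro allI impI)
      fix m m' :: nat assume "m \<le> m'"
      then have "{m'..} \<subseteq> {m..}" by auto
      then show "V m' \<subseteq> V m" unfolding V_def by (rule UN_mono) simp
    qed
  qed (use Vb Vfin in auto)
  moreover have "ennreal \<epsilon> \<le> emeasure lborel (V m)" for m
  proof -
    have "\<epsilon> \<le> measure lborel (T m)" using x(2) by (simp add: T_def)
    also have "ennreal (measure lborel (T m)) \<le> emeasure lborel (T m)"
      by (simp add: measure_def ennreal_enn2real_if)
    also have "\<dots> \<le> emeasure lborel (V m)" using Vb by (intro emeasure_mono) (auto simp: V_def)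
    finally show ?thesis by (simp add: ennreal_leI)
  qed
  ultimately have "ennreal \<epsilon> \<le> emeasure lborel (\<Inter>m. V m)" by (intro LIMSEQ_le_const) auto
  moreover have "emeasure lborel (\<Inter>m. V m) = 0"
  proof -
    let ?S = "{y \<in> C k. R l y}"
    have "(\<Inter>m. V m) \<subseteq> ?S"
    proof
      fix y assume y: "y \<in> (\<Inter>m. V m)"
      have "\<forall>m. \<exists>n\<ge>m. \<exists>p. (\<forall>i<k. p i \<in> C i \<and> dist (p i) (x (r n) i) \<le> inverse (real (Suc (r n)))) \<and> R p y"
      proof
        fix m
        have "y \<in> V m" using y by blast
        then obtain n where "n \<ge> m" "y \<in> T n" unfolding V_def by blast
        then show "\<exists>n\<ge>m. \<exists>p. (\<forall>i<k. p i \<in> C i \<and> dist (p i) (x (r n) i) \<le> inverse (real (Suc (r n)))) \<and> R p y"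
          unfolding T_def W_def by blast
      qed
      then obtain n p where n: "\<And>m. m \<le> n m"
        and p: "\<And>m i. i < k \<Longrightarrow> dist (p m i) (x (r (n m)) i) \<le> inverse (real (Suc (r (n m))))" "\<And>m. R (p m) y"
        by metis
      have nlim: "filterlim n at_top sequentially"
        using n by (intro filterlim_at_top_mono[OF filterlim_ident]) auto
      have rlim: "filterlim r at_top sequentially" by (rule filterlim_subseq[OF r(1)])
      have rn: "filterlim (\<lambda>m. r (n m)) at_top sequentially" by (rule filterlim_compose[OF rlim nlim])
      have "(\<lambda>m. p m i) \<longlonglongrightarrow> l i" if i: "i < k" for i
        unfolding tendsto_dist_iff[of "\<lambda>m. p m i"]
      proof (rule tendsto_sandwich[OF _ _ tendsto_const])
        show "\<forall>\<^sub>F m in sequentially. dist (p m i) (l i) \<le> inverse (real (Suc (r (n m)))) + dist (x (r (n m)) i) (l i)"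
          using p(1)[OF i] dist_triangle[of "p _ i" "l i" "x (r (n _)) i"]
          by (intro always_eventually allI) (smt (verit))
        have "(\<lambda>m. inverse (real (Suc (r (n m)))) + dist (x (r (n m)) i) (l i)) \<longlonglongrightarrow> 0 + dist (l i) (l i)"
          by (intro tendsto_intros filterlim_compose[OF LIMSEQ_inverse_real_of_nat rn]
              filterlim_compose[OF r(2)[OF i] nlim])
        then show "(\<lambda>m. inverse (real (Suc (r (n m)))) + dist (x (r (n m)) i) (l i)) \<longlonglongrightarrow> 0" by simp
      qed simp
      then have "R l y" by (rule closed_R[of p l "\<lambda>_. y"]) (use p in auto)
      moreover have "y \<in> C k" using y VC by blast
      ultimately show "y \<in> ?S" by simp
    qed
    then have "negligible (\<Inter>m. V m)" by (rule negligible_subset[rotated]) (intro null_R r(3))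
    moreover have "(\<Inter>m. V m) \<in> sets lborel" using Vb by auto
    ultimately show ?thesis by (simp add: negligible_iff_null_sets null_sets_def)
  qed
  ultimately show False using assms by simp
qed

text \<open>Cut the first \<open>k\<close> boxes into small cells. Once the cells containing
  \<open>p\<close> are chosen, \<open>y\<close> must lie in a set \<open>W\<close> of measure below
  \<open>\<epsilon>\<close>, and \<open>hit_bound\<close> bounds the probability of each
  choice.\<close>

lemma hit_measure_le:
  assumes hb: "hit_bound M c Z" and "\<epsilon> > 0"
  shows "\<exists>E\<in>sets M. measure M E \<le> (\<Prod>i<k. c * measure lborel (C i)) * (c * \<epsilon>) \<and>
    {\<omega> \<in> space M. \<exists>p y. (\<forall>i<k. p i \<in> Z \<omega> \<inter> C i) \<and> y \<in> Z \<omega> \<inter> C k \<and> R p y} \<subseteq> E"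
proof -
  interpret prob_space M using hb by (simp add: hit_bound_def)
  have c: "0 \<le> c" using hb by (simp add: hit_bound_def)
  obtain n where n: "\<And>x. (\<forall>i<k. x i \<in> C i) \<Longrightarrow> measure lborel (W (inverse (real (Suc n))) x) < \<epsilon>"
    using W_small[OF assms(2)] by blast
  let ?e = "inverse (real (Suc n))"
  have "\<forall>i. \<exists>N x P. i < k \<longrightarrow> (\<forall>j<(N::nat). x j \<in> C i \<and> P j \<in> sets borel \<and> P j \<subseteq> C i \<inter> cball (x j) ?e) \<and>
    disjoint_family_on P {..<N} \<and> (\<Union>j<N. P j) = C i"
    using finite_small_partition[OF compact_C, of _ ?e] by (metis inverse_positive_iff_positive less_imp_le of_nat_0_less_iff zero_less_Suc)
  then obtain N x P where "\<And>i. i < k \<Longrightarrow> (\<forall>j<(N i::nat). x i j \<in> C i \<and> P i j \<in> sets borel \<and> P i j \<subseteq> C i \<inter> cball (x i j) ?e) \<and>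
    disjoint_family_on (P i) {..<N i} \<and> (\<Union>j<N i. P i j) = C i"
    by metis
  then have NxP: "\<And>i j. i < k \<Longrightarrow> j < N i \<Longrightarrow> x i j \<in> C i" "\<And>i j. i < k \<Longrightarrow> j < N i \<Longrightarrow> P i j \<in> sets borel"
    "\<And>i j. i < k \<Longrightarrow> j < N i \<Longrightarrow> P i j \<subseteq> C i \<inter> cball (x i j) ?e"
    "\<And>i. i < k \<Longrightarrow> disjoint_family_on (P i) {..<N i}" "\<And>i. i < k \<Longrightarrow> (\<Union>j<N i. P i j) = C i"
    by blast+
  define G where "G = Pi\<^sub>E {..<k} (\<lambda>i. {..<N i})"
  have finG: "finite G" unfolding G_def by (intro finite_PiE) auto
  define Wg where "Wg g = W ?e (\<lambda>i. x i (g i))" for g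
  define B where "B g i = (if i < k then P i (g i) else Wg g)" for g i
  define E where "E g = {\<omega> \<in> space M. \<forall>i<Suc k. Z \<omega> \<inter> B g i \<noteq> {}}" for g
  have gi: "g i < N i" if "g \<in> G" "i < k" for g i using that by (auto simp: G_def)
  have Bb: "B g i \<in> sets borel \<and> B g i \<subseteq> C i" if "g \<in> G" "i < Suc k" for g i
  proof (cases "i < k")
    case True
    then show ?thesis using NxP(2,3)[OF True gi[OF that(1) True]] by (simp add: B_def)
  next
    case False
    then show ?thesis using that(2) closed_W W_subset[of ?e "\<lambda>i. x i (g i)"] by (simp add: B_def Wg_def less_Suc_eq)
  qed
  have Es: "E g \<in> sets M" if "g \<in> G" for g
  proof -
    have "{\<omega> \<in> space M. \<forall>i\<in>{..<Suc k}. Z \<omega> \<inter> B g i \<noteq> {}} \<in> sets M"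
    proof (rule sets.sets_Collect_finite_All)
      fix i assume "i \<in> {..<Suc k}"
      then have "B g i \<in> sets borel" by (intro Bb[OF that, THEN conjunct1] lessThan_iff[THEN iffD1])
      with hb show "{\<omega> \<in> space M. Z \<omega> \<inter> B g i \<noteq> {}} \<in> sets M" by (simp add: hit_bound_def)
    qed simp
    then show ?thesis unfolding E_def Ball_def lessThan_iff .
  qed
  have Pb: "measure M (E g) \<le> (\<Prod>i<k. c * measure lborel (P i (g i))) * (c * \<epsilon>)" if g: "g \<in> G" for g
  proof -
    have "bounded (B g i)" if "i < Suc k" for i
      using Bb[OF g that] compact_C[of i] that bounded_subset[OF compact_imp_bounded] by auto
    moreover have "disjoint_family_on (B g) {..<Suc k}"
      unfolding disjoint_family_on_def
    proof (intro ballI impI)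
      fix i j assume ij: "i \<in> {..<Suc k}" "j \<in> {..<Suc k}" "i \<noteq> j"
      then have "C i \<inter> C j = {}" using disjoint_C by (simp add: disjoint_family_on_def less_Suc_eq_le)
      moreover have "B g i \<subseteq> C i" "B g j \<subseteq> C j" using Bb[OF g] ij by auto
      ultimately show "B g i \<inter> B g j = {}" by blast
    qed
    ultimately have "measure M (E g) \<le> (\<Prod>i<Suc k. c * measure lborel (B g i))"
      using hb Bb[OF g] unfolding hit_bound_def E_def by blast
    also have "\<dots> = (\<Prod>i<k. c * measure lborel (P i (g i))) * (c * measure lborel (Wg g))"
      by (simp add: B_def)
    also have "\<dots> \<le> (\<Prod>i<k. c * measure lborel (P i (g i))) * (c * \<epsilon>)"
    proof -
      have "measure lborel (Wg g) \<le> \<epsilon>" unfolding Wg_def using n[of "\<lambda>i. x i (g i)"] NxP(1) gi[OF g] by (simp add: less_imp_le)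
      then show ?thesis using c by (intro mult_left_mono prod_nonneg) auto
    qed
    finally show ?thesis .
  qed
  have "measure M (\<Union>g\<in>G. E g) \<le> (\<Sum>g\<in>G. measure M (E g))"
    using Es by (intro finite_measure_subadditive_finite finG) auto
  also have "\<dots> \<le> (\<Sum>g\<in>G. (\<Prod>i<k. c * measure lborel (P i (g i))) * (c * \<epsilon>))" by (intro sum_mono Pb)
  also have "\<dots> = (\<Sum>g\<in>G. \<Prod>i<k. c * measure lborel (P i (g i))) * (c * \<epsilon>)" by (simp add: sum_distrib_right)
  \<comment> \<open>Summing over all choices of cells factorizes into the total measures of the
    boxes, so the number of cells does not enter the bound and the mesh may be as fine as
    \<open>\<epsilon>\<close> demands.\<close>
  also have "(\<Sum>g\<in>G. \<Prod>i<k. c * measure lborel (P i (g i))) = (\<Prod>i<k. \<Sum>j<N i. c * measure lborel (P i j))"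
    unfolding G_def by (rule prod_sum_PiE[symmetric]) auto
  also have "\<dots> = (\<Prod>i<k. c * measure lborel (C i))"
  proof (intro prod.cong refl)
    fix i assume "i \<in> {..<k}"
    then have i: "i < k" by simp
    have fin: "emeasure lborel (P i j) \<noteq> \<infinity>" if "j < N i" for j
    proof -
      have "bounded (P i j)" using NxP(3)[OF i that] compact_C[of i] i bounded_subset[OF compact_imp_bounded] by auto
      then show ?thesis using emeasure_bounded_finite[of "P i j"] by (metis infinity_ennreal_def less_irrefl)
    qed
    have "measure lborel (\<Union>j\<in>{..<N i}. P i j) = (\<Sum>j<N i. measure lborel (P i j))"
      using NxP(2,4) i fin by (intro measure_finite_Union) auto
    then show "(\<Sum>j<N i. c * measure lborel (P i j)) = c * measure lborel (C i)"
      using NxP(5)[OF i] by (simp add: sum_distrib_left)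
  qed
  finally have 1: "measure M (\<Union>g\<in>G. E g) \<le> (\<Prod>i<k. c * measure lborel (C i)) * (c * \<epsilon>)" .
  have 2: "{\<omega> \<in> space M. \<exists>p y. (\<forall>i<k. p i \<in> Z \<omega> \<inter> C i) \<and> y \<in> Z \<omega> \<inter> C k \<and> R p y} \<subseteq> (\<Union>g\<in>G. E g)"
  proof safe
    fix \<omega> p y assume \<omega>: "\<omega> \<in> space M" and p: "\<forall>i<k. p i \<in> Z \<omega> \<inter> C i" and y: "y \<in> Z \<omega>" "y \<in> C k" and R: "R p y"
    have "\<forall>i. \<exists>j. i < k \<longrightarrow> j < N i \<and> p i \<in> P i j" using p NxP(5) by blast
    then obtain g0 where g0: "\<And>i. i < k \<Longrightarrow> g0 i < N i \<and> p i \<in> P i (g0 i)" by metis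
    define g where "g = restrict g0 {..<k}"
    have g: "g \<in> G" unfolding G_def g_def using g0 by auto
    have pP: "p i \<in> P i (g i)" if "i < k" for i using g0 that by (simp add: g_def)
    have "p i \<in> C i \<and> dist (p i) (x i (g i)) \<le> ?e" if "i < k" for i
      using NxP(3)[OF that gi[OF g that]] pP[OF that] by (auto simp: dist_commute)
    then have "y \<in> Wg g" using y R unfolding Wg_def W_def by blast
    then have "Z \<omega> \<inter> B g i \<noteq> {}" if "i < Suc k" for i
      using that y p pP by (auto simp: B_def less_Suc_eq)
    then show "\<omega> \<in> (\<Union>g\<in>G. E g)" using g \<omega> by (auto simp: E_def)
  qed
  show ?thesis using 1 2 Es finG by (intro bexI[of _ "\<Union>g\<in>G. E g"]) auto
qed

text \<open>The bad set is not known to be measurable; it is enclosed in events of probability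
  tending to \<open>0\<close>, whose intersection is a null event.\<close>

lemma AE_relation_avoided:
  assumes hb: "hit_bound M c Z"
  shows "AE \<omega> in M. \<not> (\<exists>p y. (\<forall>i<k. p i \<in> Z \<omega> \<inter> C i) \<and> y \<in> Z \<omega> \<inter> C k \<and> R p y)"
proof -
  interpret prob_space M using hb by (simp add: hit_bound_def)
  let ?K = "(\<Prod>i<k. c * measure lborel (C i)) * c"
  let ?bad = "{\<omega> \<in> space M. \<exists>p y. (\<forall>i<k. p i \<in> Z \<omega> \<inter> C i) \<and> y \<in> Z \<omega> \<inter> C k \<and> R p y}"
  have "\<exists>E. E \<in> sets M \<and> measure M E \<le> ?K * inverse (real (Suc n)) \<and> ?bad \<subseteq> E" for n
  proof -
    have "0 < inverse (real (Suc n))" by simp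
    from hit_measure_le[OF hb this]
    show "\<exists>E. E \<in> sets M \<and> measure M E \<le> ?K * inverse (real (Suc n)) \<and> ?bad \<subseteq> E"
      unfolding mult.assoc by blast
  qed
  then have "\<exists>E. \<forall>n. E n \<in> sets M \<and> measure M (E n) \<le> ?K * inverse (real (Suc n)) \<and> ?bad \<subseteq> E n"
    by (intro choice allI)
  then obtain E where E: "\<forall>n. E n \<in> sets M \<and> measure M (E n) \<le> ?K * inverse (real (Suc n)) \<and> ?bad \<subseteq> E n"
    by (rule exE)
  note E = E[rule_format, THEN conjunct1] E[rule_format, THEN conjunct2, THEN conjunct1]
    E[rule_format, THEN conjunct2, THEN conjunct2]
  have lim: "(\<lambda>n. ?K * inverse (real (Suc n))) \<longlonglongrightarrow> ?K * 0" by (intro tendsto_intros LIMSEQ_inverse_real_of_nat)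
  have "measure M (\<Inter>n. E n) \<le> ?K * inverse (real (Suc n))" for n
    using E(1) by (intro order_trans[OF finite_measure_mono E(2)]) auto
  then have "measure M (\<Inter>n. E n) \<le> ?K * 0" by (intro LIMSEQ_le_const[OF lim]) blast
  then have "measure M (\<Inter>n. E n) = 0" by (simp add: measure_le_0_iff)
  then have "emeasure M (\<Inter>n. E n) = 0" by (simp add: emeasure_eq_measure)
  moreover have "?bad \<subseteq> (\<Inter>n. E n)" using E(3) by blast
  ultimately show ?thesis using E(1) by (intro AE_I[of _ _ "\<Inter>n. E n"]) auto
qed

end

section \<open>Affine independence of lifted Poisson points\<close>

text \<open>The normalization of the coefficients makes the relation closed.\<close>

definition lift_dependent :: "nat \<Rightarrow> (nat \<Rightarrow> 'a::euclidean_space) \<Rightarrow> bool" where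
  "lift_dependent k p \<longleftrightarrow> (\<exists>c. (\<Sum>i<k. \<bar>c i\<bar>) = 1 \<and> (\<Sum>i<k. c i) = 0 \<and> (\<Sum>i<k. c i *\<^sub>R lift (p i)) = 0)"

lemma tendsto_lift: "(f \<longlongrightarrow> v) F \<Longrightarrow> ((\<lambda>x. lift (f x)) \<longlongrightarrow> lift v) F"
  unfolding lift_def by (intro tendsto_intros)

lemma lift_dependent_limit:
  fixes p :: "nat \<Rightarrow> 'a::euclidean_space"
  assumes "\<And>i. i < k \<Longrightarrow> (\<lambda>n. ps n i) \<longlonglongrightarrow> p i" "\<And>n::nat. lift_dependent k (ps n)"
  shows "lift_dependent k p"
proof -
  obtain c where c: "\<And>n. (\<Sum>i<k. \<bar>c n i\<bar>) = 1" "\<And>n. (\<Sum>i<k. c n i) = 0" "\<And>n. (\<Sum>i<k. c n i *\<^sub>R lift (ps n i)) = 0"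
  proof -
    have "\<exists>c. \<forall>n. (\<Sum>i<k. \<bar>c n i\<bar>) = 1 \<and> (\<Sum>i<k. c n i) = 0 \<and> (\<Sum>i<k. c n i *\<^sub>R lift (ps n i)) = 0"
      using assms(2) unfolding lift_dependent_def by (intro choice allI)
    then show thesis using that by (elim exE) blast
  qed
  have "\<bar>c n i\<bar> \<le> 1" if "i < k" for n i
    using member_le_sum[of i "{..<k}" "\<lambda>i. \<bar>c n i\<bar>"] c(1) that by auto
  then have "bounded (range (\<lambda>n. c n i))" if "i \<in> {..<k}" for i
    using that by (auto simp: bounded_iff)
  then obtain d r where r: "strict_mono (r :: nat \<Rightarrow> nat)" "\<And>i. i \<in> {..<k} \<Longrightarrow> (\<lambda>n. c (r n) i) \<longlonglongrightarrow> d i"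
    using finite_common_subseq[of "{..<k}" c] by (metis finite_lessThan)
  have ps: "(\<lambda>n. ps (r n) i) \<longlonglongrightarrow> p i" if "i < k" for i
    using LIMSEQ_subseq_LIMSEQ[OF assms(1)[OF that] r(1)] by (simp add: o_def)
  have "(\<lambda>n. \<Sum>i<k. \<bar>c (r n) i\<bar>) \<longlonglongrightarrow> (\<Sum>i<k. \<bar>d i\<bar>)" "(\<lambda>n. \<Sum>i<k. c (r n) i) \<longlonglongrightarrow> (\<Sum>i<k. d i)"
    "(\<lambda>n. \<Sum>i<k. c (r n) i *\<^sub>R lift (ps (r n) i)) \<longlonglongrightarrow> (\<Sum>i<k. d i *\<^sub>R lift (p i))"
    by (intro tendsto_sum tendsto_rabs tendsto_scaleR tendsto_lift r(2) ps; simp)+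
  then show ?thesis unfolding lift_dependent_def c by (intro exI[of _ d]) (simp add: LIMSEQ_const_iff)
qed

text \<open>The paraboloid meets a vertical hyperplane over a hyperplane of the base space and, by
  completing the square, any other hyperplane over a sphere, possibly empty.\<close>

lemma negligible_lift_hyperplane:
  fixes a :: "'a::euclidean_space \<times> real"
  assumes "a \<noteq> 0"
  shows "negligible {y. a \<bullet> lift y = b}"
proof (cases "snd a = 0")
  case True
  then have "{y. a \<bullet> lift y = b} = {y. fst a \<bullet> y = b}" by (auto simp: lift_def inner_prod_def)
  moreover have "fst a \<noteq> 0" using True assms by (auto simp: prod_eq_iff)
  ultimately show ?thesis by (simp add: negligible_hyperplane)
next
  case False
  define u where "u = (1 / (2 * snd a)) *\<^sub>R fst a"
  have "{y. a \<bullet> lift y = b} \<subseteq> sphere (- u) (sqrt (b / snd a + (norm u)\<^sup>2))"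
  proof
    fix y assume "y \<in> {y. a \<bullet> lift y = b}"
    then have "fst a \<bullet> y + snd a * (norm y)\<^sup>2 = b" by (simp add: lift_def inner_prod_def)
    then have "(fst a \<bullet> y) / snd a + (norm y)\<^sup>2 = b / snd a" using False by (simp add: field_simps)
    moreover have "2 * (u \<bullet> y) = (fst a \<bullet> y) / snd a" by (simp add: u_def)
    ultimately have "(norm (y + u))\<^sup>2 = b / snd a + (norm u)\<^sup>2"
      by (simp add: power2_norm_eq_inner inner_add inner_commute)
    then have "norm (y + u) = sqrt (b / snd a + (norm u)\<^sup>2)" by (metis norm_ge_zero real_sqrt_unique)
    then show "y \<in> sphere (- u) (sqrt (b / snd a + (norm u)\<^sup>2))"
      using norm_minus_cancel[of "y + u"] by (simp add: dist_norm algebra_simps)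
  qed
  then show ?thesis by (rule negligible_subset[OF negligible_sphere])
qed

text \<open>At most \<open>d + 1\<close> points of the lifted space, which has dimension
  \<open>d + 1\<close>, lie in a common hyperplane. Independence of the old points forces a non-zero
  coefficient at the new one, so a dependence puts its lift into that hyperplane.\<close>

lemma negligible_lift_dependent:
  fixes p :: "nat \<Rightarrow> 'a::euclidean_space"
  assumes "\<not> lift_dependent k p" "k \<le> DIM('a) + 1"
  shows "negligible {y. lift_dependent (Suc k) (p(k := y))}"
proof -
  let ?S = "(\<lambda>i. lift (p i)) ` {..<k}"
  have "aff_dim ?S \<le> int (card ?S) - 1" by (rule aff_dim_le_card) simp
  moreover have "card ?S \<le> k" using card_image_le[of "{..<k}" "\<lambda>i. lift (p i)"] by simp
  ultimately have "aff_dim ?S < DIM('a \<times> real)" using assms(2) by simp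
  then obtain a b where ab: "a \<noteq> 0" "?S \<subseteq> {x. a \<bullet> x = b}" using aff_lowdim_subset_hyperplane by blast
  have "{y. lift_dependent (Suc k) (p(k := y))} \<subseteq> {y. a \<bullet> lift y = b}"
  proof safe
    fix y assume "lift_dependent (Suc k) (p(k := y))"
    then obtain c where c: "(\<Sum>i<k. \<bar>c i\<bar>) + \<bar>c k\<bar> = 1" "(\<Sum>i<k. c i) + c k = 0"
      "(\<Sum>i<k. c i *\<^sub>R lift (p i)) + c k *\<^sub>R lift y = 0"
      unfolding lift_dependent_def by auto
    have ck: "c k \<noteq> 0"
    proof
      assume "c k = 0"
      then have "lift_dependent k p" using c unfolding lift_dependent_def by auto
      then show False using assms(1) by simp
    qed
    have "a \<bullet> ((\<Sum>i<k. c i *\<^sub>R lift (p i)) + c k *\<^sub>R lift y) = 0" using c(3) by simp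
    then have "(\<Sum>i<k. c i * (a \<bullet> lift (p i))) + c k * (a \<bullet> lift y) = 0"
      by (simp add: inner_add_right inner_sum_right)
    moreover have "(\<Sum>i<k. c i * (a \<bullet> lift (p i))) = (\<Sum>i<k. c i) * b"
      unfolding sum_distrib_right using ab(2) by (intro sum.cong) auto
    moreover have "(\<Sum>i<k. c i) = - c k" using c(2) by simp
    ultimately have "c k * (a \<bullet> lift y - b) = 0" by (simp add: algebra_simps)
    then show "a \<bullet> lift y = b" using ck by simp
  qed
  then show ?thesis by (rule negligible_subset[OF negligible_lift_hyperplane[OF ab(1)]])
qed

text \<open>Provides, for each admissible tuple, one of countably many tuples of boxes that satisfy
  the hypotheses of \<open>closed_relation\<close>. Independence is open, being the complement of a
  closed condition, so it extends from \<open>p\<close> to whole small balls.\<close>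

lemma separating_cballs:
  fixes p :: "nat \<Rightarrow> 'a::euclidean_space"
  assumes inj: "inj_on p {..k}" and nd: "\<not> lift_dependent k p"
    and D: "\<And>X :: 'a set. open X \<Longrightarrow> X \<noteq> {} \<Longrightarrow> \<exists>d\<in>D. d \<in> X"
  obtains n :: nat and q where "q \<in> {..k} \<rightarrow>\<^sub>E D" "\<And>i. i \<le> k \<Longrightarrow> p i \<in> cball (q i) (inverse (real (Suc n)))"
    "disjoint_family_on (\<lambda>i. cball (q i) (inverse (real (Suc n)))) {..k}"
    "\<And>p'. (\<And>i. i < k \<Longrightarrow> p' i \<in> cball (q i) (inverse (real (Suc n)))) \<Longrightarrow> \<not> lift_dependent k p'"
proof -
  have "\<exists>d\<in>D. dist d x < inverse (real (Suc n))" for x n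
    using D[of "ball x (inverse (real (Suc n)))"] by (auto simp: dist_commute)
  then have "\<forall>n i. \<exists>d. d \<in> D \<and> dist d (p i) < inverse (real (Suc n))" by blast
  then obtain q where q: "\<And>n i. q n i \<in> D" "\<And>n i. dist (q n i) (p i) < inverse (real (Suc n))" by metis
  let ?e = "\<lambda>n. inverse (real (Suc n))"
  \<comment> \<open>A point common to two balls is within \<open>2 * ?e n\<close> of both
    \<open>p i\<close> and \<open>p j\<close>, one radius plus the offset of the centre each; hence
    the factor 4.\<close>
  have "\<forall>\<^sub>F n in sequentially. \<forall>i\<in>{..k}. \<forall>j\<in>{..k}. i \<noteq> j \<longrightarrow> 4 * ?e n < dist (p i) (p j)"
  proof (intro eventually_ball_finite ballI finite_atMost)
    fix i j assume ij: "i \<in> {..k}" "j \<in> {..k}"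
    show "\<forall>\<^sub>F n in sequentially. i \<noteq> j \<longrightarrow> 4 * ?e n < dist (p i) (p j)"
    proof (cases "i = j")
      case False
      then have "0 < dist (p i) (p j) / 4" using inj ij by (auto simp: inj_on_def)
      from eventually_inverse_Suc_less[OF this] show ?thesis by eventually_elim simp
    qed simp
  qed
  moreover define good where "good n \<longleftrightarrow> (\<forall>p'. (\<forall>i<k. p' i \<in> cball (q n i) (?e n)) \<longrightarrow> \<not> lift_dependent k p')" for n
  have "\<forall>\<^sub>F n in sequentially. good n"
  proof (rule ccontr)
    assume "\<not> ?thesis"
    then obtain r :: "nat \<Rightarrow> nat" where r: "strict_mono r" "\<And>n. \<not> good (r n)"
      using not_eventually_subseq[of good] by metis
    then have "\<forall>n. \<exists>p'. (\<forall>i<k. p' i \<in> cball (q (r n) i) (?e (r n))) \<and> lift_dependent k p'"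
      unfolding good_def by blast
    then obtain p' where p': "\<And>n i. i < k \<Longrightarrow> p' n i \<in> cball (q (r n) i) (?e (r n))" "\<And>n. lift_dependent k (p' n)"
      by metis
    have "(\<lambda>n. p' n i) \<longlonglongrightarrow> p i" if i: "i < k" for i
      unfolding tendsto_dist_iff[of "\<lambda>n. p' n i"]
    proof (rule tendsto_sandwich[OF _ _ tendsto_const])
      have "dist (p' n i) (p i) \<le> ?e (r n) + ?e (r n)" for n
        using p'(1)[OF i, of n] q(2)[of "r n" i] dist_triangle[of "p' n i" "p i" "q (r n) i"]
        by (simp add: dist_commute del: of_nat_Suc)
      then show "\<forall>\<^sub>F n in sequentially. dist (p' n i) (p i) \<le> ?e (r n) + ?e (r n)" by (intro always_eventually allI)
      have "(\<lambda>n. ?e (r n) + ?e (r n)) \<longlonglongrightarrow> 0 + 0"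
        by (intro tendsto_add filterlim_compose[OF LIMSEQ_inverse_real_of_nat filterlim_subseq[OF r(1)]])
      then show "(\<lambda>n. ?e (r n) + ?e (r n)) \<longlonglongrightarrow> 0" by simp
    qed simp
    then have "lift_dependent k p" by (rule lift_dependent_limit[of k p' p]) (use p' in auto)
    then show False using nd by simp
  qed
  ultimately have "\<forall>\<^sub>F n in sequentially. (\<forall>i\<in>{..k}. \<forall>j\<in>{..k}. i \<noteq> j \<longrightarrow> 4 * ?e n < dist (p i) (p j)) \<and> good n"
    by (intro eventually_conj)
  then obtain n where n: "\<forall>i\<in>{..k}. \<forall>j\<in>{..k}. i \<noteq> j \<longrightarrow> 4 * ?e n < dist (p i) (p j)"
    "\<forall>p'. (\<forall>i<k. p' i \<in> cball (q n i) (?e n)) \<longrightarrow> \<not> lift_dependent k p'"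
    using eventually_happens'[OF trivial_limit_sequentially] unfolding good_def by blast
  define q' where "q' = restrict (q n) {..k}"
  have q'i: "q' i = q n i" if "i \<le> k" for i using that by (simp add: q'_def)
  show thesis
  proof (rule that[of q' n])
    show "q' \<in> {..k} \<rightarrow>\<^sub>E D" using q(1) by (auto simp: q'_def)
    show "p i \<in> cball (q' i) (?e n)" if "i \<le> k" for i using q(2)[of n i] q'i[OF that] by (simp del: of_nat_Suc)
    show "disjoint_family_on (\<lambda>i. cball (q' i) (?e n)) {..k}"
      unfolding disjoint_family_on_def
    proof (intro ballI impI)
      fix i j assume ij: "i \<in> {..k}" "j \<in> {..k}" "i \<noteq> j"
      have "False" if z: "z \<in> cball (q' i) (?e n)" "z \<in> cball (q' j) (?e n)" for z
      proof -
        have "dist (p i) (p j) \<le> dist (p i) (q n i) + dist (q n i) z + (dist z (q n j) + dist (q n j) (p j))"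
          by (meson add_mono dist_triangle dist_triangle_le order_trans order_refl)
        also have "\<dots> \<le> 4 * ?e n" using z q(2)[of n i] q(2)[of n j] ij q'i by (simp add: dist_commute del: of_nat_Suc)
        finally show False using n(1) ij by force
      qed
      then show "cball (q' i) (?e n) \<inter> cball (q' j) (?e n) = {}" by blast
    qed
    show "\<not> lift_dependent k p'" if "\<And>i. i < k \<Longrightarrow> p' i \<in> cball (q' i) (?e n)" for p'
      using n(2) that q'i by (metis less_imp_le)
  qed
qed

text \<open>Induction on the number of points: if the first \<open>k\<close> lifts are independent,
  the next point has to avoid a null set. The bound \<open>d + 2\<close> is the largest number of
  affinely independent points in the lifted space.\<close>

lemma AE_not_lift_dependent:
  fixes Z :: "'w \<Rightarrow> 'a::euclidean_space set"
  assumes hb: "hit_bound M c Z" and "k \<le> DIM('a) + 2"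
  shows "AE \<omega> in M. \<forall>p. inj_on p {..<k} \<longrightarrow> (\<forall>i<k. p i \<in> Z \<omega>) \<longrightarrow> \<not> lift_dependent k p"
  using assms(2)
proof (induction k)
  case 0
  then show ?case by (simp add: lift_dependent_def)
next
  case (Suc k)
  obtain D :: "'a set" where D: "countable D" "\<And>X. open X \<Longrightarrow> X \<noteq> {} \<Longrightarrow> \<exists>d\<in>D. d \<in> X"
    using countable_dense_exists by blast
  let ?C = "\<lambda>n q i. cball (q i) (inverse (real (Suc n)))"
  \<comment> \<open>Independence is demanded for every tuple in the boxes, since
    \<open>null_R\<close> must hold for all of them. Countably many indices leave one null
    event.\<close>
  define I where "I = {(n :: nat, q). q \<in> {..k} \<rightarrow>\<^sub>E D \<and> disjoint_family_on (?C n q) {..k} \<and>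
    (\<forall>p'. (\<forall>i<k. p' i \<in> ?C n q i) \<longrightarrow> \<not> lift_dependent k p')}"
  have "countable ((UNIV :: nat set) \<times> ({..k} \<rightarrow>\<^sub>E D))"
    by (intro countable_SIGMA countable_PiE D(1) countableI_type) auto
  then have "countable I" by (rule countable_subset[rotated]) (auto simp: I_def)
  let ?R = "\<lambda>p y. lift_dependent (Suc k) (p(k := y))"
  have "AE \<omega> in M. \<not> (\<exists>p y. (\<forall>i<k. p i \<in> Z \<omega> \<inter> ?C n q i) \<and> y \<in> Z \<omega> \<inter> ?C n q k \<and> ?R p y)"
    if "(n, q) \<in> I" for n q
  proof -
    interpret closed_relation k "?C n q" ?R
    proof
      show "disjoint_family_on (?C n q) {..k}" using that by (simp add: I_def)
      show "?R p y" if "\<And>i. i < k \<Longrightarrow> (\<lambda>n. ps n i) \<longlonglongrightarrow> p i" "ys \<longlonglongrightarrow> y" "\<And>n::nat. ?R (ps n) (ys n)"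
        for ps ys p y
        by (rule lift_dependent_limit[of _ "\<lambda>n. (ps n)(k := ys n)"]) (use that in \<open>auto simp: less_Suc_eq\<close>)
      show "negligible {y \<in> ?C n q k. ?R p y}" if "\<And>i. i < k \<Longrightarrow> p i \<in> ?C n q i" for p
      proof -
        have "\<not> lift_dependent k p" using \<open>(n, q) \<in> I\<close> that by (simp add: I_def)
        then show ?thesis using negligible_lift_dependent[of k p] Suc.prems by (auto intro: negligible_subset)
      qed
    qed auto
    show ?thesis by (rule AE_relation_avoided[OF hb])
  qed
  then have "AE \<omega> in M. \<forall>(n, q)\<in>I. \<not> (\<exists>p y. (\<forall>i<k. p i \<in> Z \<omega> \<inter> ?C n q i) \<and> y \<in> Z \<omega> \<inter> ?C n q k \<and> ?R p y)"
    using \<open>countable I\<close> by (subst AE_ball_countable) auto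
  moreover have "AE \<omega> in M. \<forall>p. inj_on p {..<k} \<longrightarrow> (\<forall>i<k. p i \<in> Z \<omega>) \<longrightarrow> \<not> lift_dependent k p"
    using Suc by simp
  ultimately show ?case
  proof eventually_elim
    case (elim \<omega>)
    show ?case
    proof (intro allI impI notI)
      fix p assume p: "inj_on p {..<Suc k}" "\<forall>i<Suc k. p i \<in> Z \<omega>" "lift_dependent (Suc k) p"
      have "inj_on p {..<k}" by (rule inj_on_subset[OF p(1)]) auto
      then have nd: "\<not> lift_dependent k p" using elim(2) p(2) by simp
      have inj: "inj_on p {..k}" using p(1) by (simp add: lessThan_Suc_atMost)
      obtain n q where nq: "q \<in> {..k} \<rightarrow>\<^sub>E D" "\<And>i. i \<le> k \<Longrightarrow> p i \<in> ?C n q i"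
        "disjoint_family_on (?C n q) {..k}" "\<And>p'. (\<And>i. i < k \<Longrightarrow> p' i \<in> ?C n q i) \<Longrightarrow> \<not> lift_dependent k p'"
        using separating_cballs[OF inj nd D(2)] by metis
      then have "(n, q) \<in> I" by (simp add: I_def)
      moreover have "\<forall>i<k. p i \<in> Z \<omega> \<inter> ?C n q i" "p k \<in> Z \<omega> \<inter> ?C n q k" using nq(2) p(2) by auto
      moreover have "?R p (p k)" using p(3) by simp
      ultimately show False using elim(1) by blast
    qed
  qed
qed

lemma AE_lift_generic:
  fixes Z :: "'w \<Rightarrow> 'a::euclidean_space set"
  assumes hb: "hit_bound M c Z"
  shows "AE \<omega> in M. lift_generic (Z \<omega>)"
proof -
  have "AE \<omega> in M. \<forall>k\<in>{..DIM('a) + 2}. \<forall>p. inj_on p {..<k} \<longrightarrow> (\<forall>i<k. p i \<in> Z \<omega>) \<longrightarrow> \<not> lift_dependent k p"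
    using AE_not_lift_dependent[OF hb] by (subst AE_ball_countable) auto
  then show ?thesis
  proof eventually_elim
    case (elim \<omega>)
    show ?case unfolding lift_generic_def
    proof (intro allI impI notI)
      fix T assume T: "T \<subseteq> Z \<omega>" "finite T" "card T \<le> DIM('a) + 2" "affine_dependent (lift ` T)"
      obtain p where p: "bij_betw p {..<card T} T"
        using ex_bij_betw_nat_finite[OF T(2)] by (auto simp: atLeast0LessThan)
      obtain u where u: "sum u (lift ` T) = 0" "\<exists>v\<in>lift ` T. u v \<noteq> 0" "(\<Sum>v\<in>lift ` T. u v *\<^sub>R v) = 0"
        using T(2,4) affine_dependent_explicit_finite[of "lift ` T"] by auto
      define b where "b i = u (lift (p i))" for i
      define s where "s = (\<Sum>i<card T. \<bar>b i\<bar>)"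
      have 1: "(\<Sum>i<card T. b i) = 0"
        using u(1) sum.reindex_bij_betw[OF p, of "\<lambda>v. u (lift v)"] by (simp add: sum.reindex[OF inj_lift] b_def)
      have 2: "(\<Sum>i<card T. b i *\<^sub>R lift (p i)) = 0"
        using u(3) sum.reindex_bij_betw[OF p, of "\<lambda>v. u (lift v) *\<^sub>R lift v"] by (simp add: sum.reindex[OF inj_lift] b_def)
      have "\<exists>i<card T. b i \<noteq> 0"
      proof -
        obtain v where v: "v \<in> T" "u (lift v) \<noteq> 0" using u(2) by blast
        have "v \<in> p ` {..<card T}" using v(1) p by (simp add: bij_betw_def)
        then obtain i where "i < card T" "v = p i" by blast
        then show ?thesis using v by (auto simp: b_def)
      qed
      then have "s > 0" unfolding s_def by (auto simp: sum_pos2)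
      have "lift_dependent (card T) p" unfolding lift_dependent_def
      proof (intro exI[of _ "\<lambda>i. b i / s"] conjI)
        have "(\<Sum>i<card T. \<bar>b i / s\<bar>) = (\<Sum>i<card T. \<bar>b i\<bar> / s)" using \<open>s > 0\<close> by simp
        also have "\<dots> = s / s" unfolding sum_divide_distrib[symmetric] by (simp add: s_def)
        finally have "(\<Sum>i<card T. \<bar>b i / s\<bar>) = s / s" .
        then show "(\<Sum>i<card T. \<bar>b i / s\<bar>) = 1" using \<open>s > 0\<close> by simp
        show "(\<Sum>i<card T. b i / s) = 0" using 1 by (simp flip: sum_divide_distrib)
        have "(\<Sum>i<card T. (b i / s) *\<^sub>R lift (p i)) = (1 / s) *\<^sub>R (\<Sum>i<card T. b i *\<^sub>R lift (p i))"
          unfolding scaleR_sum_right by (intro sum.cong) auto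
        then show "(\<Sum>i<card T. (b i / s) *\<^sub>R lift (p i)) = 0" using 2 by simp
      qed
      moreover have "inj_on p {..<card T}" "\<forall>i<card T. p i \<in> Z \<omega>" using p T(1) by (auto simp: bij_betw_def)
      ultimately show False using elim T(3) by auto
    qed
  qed
qed

section \<open>Intensities and height transformations\<close>

lemma void_law_cong:
  assumes "void_law M L \<eta>" "\<And>B. B \<in> sets borel \<Longrightarrow> L B = L' B"
  shows "void_law M L' \<eta>"
  using assms unfolding void_law_def by auto

lemma emeasure_density_snd:
  fixes B :: "('a::euclidean_space \<times> real) set" and \<rho> :: "real \<Rightarrow> ennreal"
  assumes [measurable]: "\<rho> \<in> borel_measurable borel" "B \<in> sets borel"
  shows "emeasure (density lborel (\<lambda>(v, h). \<rho> h)) B = (\<integral>\<^sup>+v. emeasure (density lborel \<rho>) (Pair v -` B) \<partial>lborel)"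
proof -
  have Bp [measurable]: "B \<in> sets (lborel \<Otimes>\<^sub>M lborel)" using assms(2) unfolding lborel_prod by simp
  have m: "(\<lambda>x. (case x of (v, h) \<Rightarrow> \<rho> h) * indicator B x) \<in> borel_measurable (lborel \<Otimes>\<^sub>M lborel)"
    by measurable
  have m': "(\<lambda>(v::'a, h). \<rho> h) \<in> borel_measurable lborel"
    unfolding lborel_prod[symmetric] by measurable
  have "emeasure (density lborel (\<lambda>(v, h). \<rho> h)) B = (\<integral>\<^sup>+x. (case x of (v, h) \<Rightarrow> \<rho> h) * indicator B x \<partial>lborel)"
    using m' by (intro emeasure_density) auto
  also have "\<dots> = (\<integral>\<^sup>+x. (case x of (v, h) \<Rightarrow> \<rho> h) * indicator B x \<partial>(lborel \<Otimes>\<^sub>M lborel))"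
    by (simp add: lborel_prod)
  also have "\<dots> = (\<integral>\<^sup>+v. \<integral>\<^sup>+h. \<rho> h * indicator B (v, h) \<partial>lborel \<partial>lborel)"
    using lborel.nn_integral_fst[OF m] by simp
  also have "\<dots> = (\<integral>\<^sup>+v. emeasure (density lborel \<rho>) (Pair v -` B) \<partial>lborel)"
  proof (intro nn_integral_cong)
    fix v :: 'a
    have "Pair v -` B \<in> sets borel" using sets_Pair1[OF Bp, of v] by simp
    then have "emeasure (density lborel \<rho>) (Pair v -` B) = (\<integral>\<^sup>+h. \<rho> h * indicator (Pair v -` B) h \<partial>lborel)"
      by (intro emeasure_density) auto
    also have "\<dots> = (\<integral>\<^sup>+h. \<rho> h * indicator B (v, h) \<partial>lborel)"
      by (intro nn_integral_cong) (simp add: indicator_def)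
    finally show "(\<integral>\<^sup>+h. \<rho> h * indicator B (v, h) \<partial>lborel) = emeasure (density lborel \<rho>) (Pair v -` B)" by simp
  qed
  finally show ?thesis .
qed

section \<open>Height measures and their quantile maps\<close>

definition height_law :: "nat \<Rightarrow> real \<Rightarrow> real measure" where
  "height_law d \<beta> = density lborel (\<lambda>h. ennreal (indicator {0..} h * (beta_const d \<beta> * h powr \<beta>)))"

definition mass_scale :: "nat \<Rightarrow> real \<Rightarrow> real" where
  "mass_scale d \<beta> = beta_const d \<beta> / (\<beta> + 1)"

lemma sets_height_law [simp]: "sets (height_law d \<beta>) = sets borel" "space (height_law d \<beta>) = UNIV"
  by (simp_all add: height_law_def)

lemma beta_intensity_emeasure:
  fixes B :: "((real ^ 'n) \<times> real) set"
  assumes "B \<in> sets borel"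
  shows "emeasure (beta_intensity \<beta>) B = (\<integral>\<^sup>+v. emeasure (height_law CARD('n) \<beta>) (Pair v -` B) \<partial>lborel)"
  unfolding beta_intensity_def height_law_def by (rule emeasure_density_snd[OF _ assms]) measurable

lemma beta_const_pos: "\<beta> > -1 \<Longrightarrow> 0 < beta_const d \<beta>"
  unfolding beta_const_def by (intro divide_pos_pos mult_pos_pos Gamma_real_pos) auto

lemma mass_scale_pos: "\<beta> > -1 \<Longrightarrow> 0 < mass_scale d \<beta>"
  unfolding mass_scale_def by (intro divide_pos_pos beta_const_pos) auto

text \<open>Absorbing the factor \<open>\<beta> + 1\<close> into \<open>Gamma (\<beta> + 1)\<close>
  removes its pole at \<open>-1\<close>, so the limit follows from continuity of
  \<open>Gamma\<close>.\<close>

lemma mass_scale_eq: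
  assumes "\<beta> > -1"
  shows "mass_scale d \<beta> = Gamma (real d / 2 + \<beta> + 2) / (pi powr (real d / 2 + 1) * Gamma (\<beta> + 2))"
proof -
  have "Gamma (\<beta> + 1 + 1) = (\<beta> + 1) * Gamma (\<beta> + 1)" using assms by (intro Gamma_plus1) (auto elim!: nonpos_Ints_cases')
  then show ?thesis using assms by (simp add: mass_scale_def beta_const_def add.commute add.left_commute)
qed

lemma mass_scale_tendsto:
  assumes "X \<longlonglongrightarrow> -1" "\<And>n. X n > -1"
  shows "(\<lambda>n. mass_scale d (X n)) \<longlonglongrightarrow> gamma_const d"
proof -
  have np: "x \<notin> \<int>\<^sub>\<le>\<^sub>0" if "x > 0" for x :: real using that by (auto elim!: nonpos_Ints_cases')
  have "(\<lambda>n. Gamma (real d / 2 + X n + 2) / (pi powr (real d / 2 + 1) * Gamma (X n + 2))) \<longlonglongrightarrow>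
      Gamma (real d / 2 + (-1) + 2) / (pi powr (real d / 2 + 1) * Gamma ((-1) + 2))"
    by (intro tendsto_intros tendsto_Gamma assms np) auto
  moreover have "Gamma (real d / 2 + (-1) + 2) / (pi powr (real d / 2 + 1) * Gamma ((-1) + 2)) = gamma_const d"
  proof -
    have "pi powr (- (real d / 2) - 1) = inverse (pi powr (real d / 2 + 1))"
      by (metis diff_conv_add_uminus minus_add_distrib powr_minus)
    moreover have "real d / 2 + (-1) + 2 = real d / 2 + 1" "(-1) + 2 = (1::real)" by simp_all
    ultimately show ?thesis unfolding gamma_const_def by (simp only: Gamma_1 divide_inverse mult_1_right mult_1_left mult.commute)
  qed
  ultimately show ?thesis using assms(2) by (simp add: mass_scale_eq)
qed

lemma height_law_atMost:
  assumes "\<beta> > -1"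
  shows "emeasure (height_law d \<beta>) {..x} = ennreal (if x < 0 then 0 else mass_scale d \<beta> * x powr (\<beta> + 1))"
proof -
  let ?c = "beta_const d \<beta>"
  have c: "0 < ?c" by (rule beta_const_pos[OF assms])
  have 1: "emeasure (height_law d \<beta>) {..x} = (\<integral>\<^sup>+h. ennreal (indicator {0..} h * (?c * h powr \<beta>)) * indicator {..x} h \<partial>lborel)"
    unfolding height_law_def by (intro emeasure_density) auto
  show ?thesis
  proof (cases "x < 0")
    case True
    then have "(\<integral>\<^sup>+h. ennreal (indicator {0..} h * (?c * h powr \<beta>)) * indicator {..x} h \<partial>lborel) = (\<integral>\<^sup>+h. 0 \<partial>(lborel :: real measure))"
      by (intro nn_integral_cong) (auto simp: indicator_def)
    then show ?thesis using 1 True by simp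
  next
    case False
    have "((\<lambda>h. ?c * h powr \<beta>) has_integral ?c * (x powr (\<beta> + 1) / (\<beta> + 1))) {0..x}"
      using has_integral_mult_right[OF has_integral_powr_from_0[OF assms, of x]] False by simp
    moreover have "(\<lambda>h. indicator {0..x} h * (?c * h powr \<beta>)) = (\<lambda>h. if h \<in> {0..x} then ?c * h powr \<beta> else 0)"
      by (auto simp: indicator_def)
    ultimately have "((\<lambda>h. indicator {0..x} h * (?c * h powr \<beta>)) has_integral ?c * (x powr (\<beta> + 1) / (\<beta> + 1))) UNIV"
      by (simp only: has_integral_restrict_UNIV)
    then have "(\<integral>\<^sup>+h. ennreal (indicator {0..x} h * (?c * h powr \<beta>)) \<partial>lborel) = ennreal (?c * (x powr (\<beta> + 1) / (\<beta> + 1)))"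
      using c by (intro nn_integral_has_integral_lborel) auto
    moreover have "(\<integral>\<^sup>+h. ennreal (indicator {0..} h * (?c * h powr \<beta>)) * indicator {..x} h \<partial>lborel) =
        (\<integral>\<^sup>+h. ennreal (indicator {0..x} h * (?c * h powr \<beta>)) \<partial>lborel)"
      by (intro nn_integral_cong) (auto simp: indicator_def)
    ultimately show ?thesis using 1 False by (simp add: mass_scale_def)
  qed
qed

lemma height_law_singleton: "emeasure (height_law d \<beta>) {x} = 0"
proof -
  have "absolutely_continuous lborel (height_law d \<beta>)"
    unfolding height_law_def by (rule absolutely_continuousI_density) measurable
  moreover have "{x} \<in> null_sets lborel" by (intro null_setsI) auto
  ultimately have "{x} \<in> null_sets (height_law d \<beta>)" unfolding absolutely_continuous_def by blast
  then show ?thesis by (simp add: null_sets_def)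
qed

lemma height_law_lessThan:
  assumes "\<beta> > -1" "0 \<le> x"
  shows "emeasure (height_law d \<beta>) {..<x} = ennreal (mass_scale d \<beta> * x powr (\<beta> + 1))"
proof -
  have "{..x} = {..<x} \<union> {x}" by auto
  then have "emeasure (height_law d \<beta>) {..x} = emeasure (height_law d \<beta>) {..<x} + emeasure (height_law d \<beta>) {x}"
    by (simp only:) (rule plus_emeasure[symmetric], auto)
  then show ?thesis using height_law_atMost[OF assms(1), of d x] assms(2) by (simp add: height_law_singleton)
qed

text \<open>The distribution function \<open>a_0 h\<close> of the heights for parameter
  \<open>0\<close>, followed by the inverse of \<open>x \<mapsto> a_\<beta> x^(\<beta>+1)\<close>.
  The maximum with \<open>0\<close> makes the map monotone on the whole line.\<close>

definition height_map :: "nat \<Rightarrow> real \<Rightarrow> real \<Rightarrow> real" where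
  "height_map d \<beta> h = (mass_scale d 0 / mass_scale d \<beta> * max 0 h) powr (1 / (\<beta> + 1))"

lemma height_map_measurable [measurable]: "height_map d \<beta> \<in> borel_measurable borel"
  unfolding height_map_def by measurable

lemma height_map_measurable_height_law: "height_map d \<beta> \<in> measurable (height_law d' \<beta>') borel"
  using height_map_measurable by (simp add: measurable_cong_sets[OF sets_height_law(1) refl])

lemma height_map_nonneg: "0 \<le> height_map d \<beta> h"
  by (simp add: height_map_def)

lemma powr_inverse_le_iff:
  fixes x y b :: real
  assumes "0 \<le> y" "0 \<le> x" "0 < b"
  shows "y powr (1 / b) \<le> x \<longleftrightarrow> y \<le> x powr b"
proof
  assume "y powr (1 / b) \<le> x"
  then have "(y powr (1 / b)) powr b \<le> x powr b" using assms by (intro powr_mono2) auto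
  then show "y \<le> x powr b" using assms by (simp add: powr_powr)
next
  assume "y \<le> x powr b"
  then have "y powr (1 / b) \<le> (x powr b) powr (1 / b)" using assms by (intro powr_mono2) auto
  then show "y powr (1 / b) \<le> x" using assms by (simp add: powr_powr)
qed

lemma height_map_le_iff:
  assumes "\<beta> > -1" "0 \<le> x"
  shows "height_map d \<beta> h \<le> x \<longleftrightarrow> max 0 h \<le> mass_scale d \<beta> / mass_scale d 0 * x powr (\<beta> + 1)"
proof -
  let ?y = "mass_scale d 0 / mass_scale d \<beta> * max 0 h"
  have pos: "0 < mass_scale d 0" "0 < mass_scale d \<beta>" using mass_scale_pos[of 0 d] mass_scale_pos[OF assms(1)] by auto
  have y: "0 \<le> ?y" using pos by (intro mult_nonneg_nonneg divide_nonneg_nonneg) auto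
  have b: "0 < \<beta> + 1" using assms by simp
  have "?y powr (1 / (\<beta> + 1)) \<le> x \<longleftrightarrow> ?y \<le> x powr (\<beta> + 1)"
    by (rule powr_inverse_le_iff[OF y assms(2) b])
  also have "\<dots> \<longleftrightarrow> max 0 h \<le> mass_scale d \<beta> / mass_scale d 0 * x powr (\<beta> + 1)"
  proof -
    have "mass_scale d 0 / mass_scale d \<beta> * m \<le> t \<longleftrightarrow> m \<le> mass_scale d \<beta> / mass_scale d 0 * t" for m t
      using pos by (simp add: field_simps)
    then show ?thesis .
  qed
  finally show ?thesis by (simp add: height_map_def)
qed

text \<open>By monotonicity preimages of half-lines are empty or half-lines, whose masses are
  explicit. Both measures have infinite total mass, but half-lines have finite mass and exhaust the
  line.\<close>

lemma distr_height_map: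
  assumes "\<beta> > -1"
  shows "distr (height_law d 0) borel (height_map d \<beta>) = height_law d \<beta>"
proof (rule measure_eqI_generator_eq)
  let ?E = "range (atMost :: real \<Rightarrow> real set)"
  show "Int_stable ?E" by (rule Int_stableI) auto
  show "?E \<subseteq> Pow UNIV" by simp
  show "sets (distr (height_law d 0) borel (height_map d \<beta>)) = sigma_sets UNIV ?E" "sets (height_law d \<beta>) = sigma_sets UNIV ?E"
    by (simp_all add: borel_eq_atMost sets_measure_of)
  show "range (\<lambda>i::nat. {..real i}) \<subseteq> ?E" by auto
  show "(\<Union>i::nat. {..real i}) = UNIV" using real_arch_simple by auto
  show eq: "emeasure (distr (height_law d 0) borel (height_map d \<beta>)) X = emeasure (height_law d \<beta>) X" if "X \<in> ?E" for X
  proof -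
    obtain x where X: "X = {..x}" using \<open>X \<in> ?E\<close> by auto
    have "emeasure (distr (height_law d 0) borel (height_map d \<beta>)) X = emeasure (height_law d 0) (height_map d \<beta> -` {..x})"
      unfolding X by (subst emeasure_distr[OF height_map_measurable_height_law]) auto
    also have "\<dots> = emeasure (height_law d \<beta>) {..x}"
    proof (cases "x < 0")
      case True
      then have "height_map d \<beta> -` {..x} = {}" using order_trans[OF height_map_nonneg[of d \<beta>]] by fastforce
      then show ?thesis using True by (simp add: height_law_atMost[OF assms])
    next
      case False
      define z where "z = mass_scale d \<beta> / mass_scale d 0 * x powr (\<beta> + 1)"
      have pos: "0 < mass_scale d 0" "0 < mass_scale d \<beta>" using mass_scale_pos[of 0 d] mass_scale_pos[OF assms] by auto
      have z: "0 \<le> z" using pos by (simp add: z_def)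
      have "height_map d \<beta> h \<le> x \<longleftrightarrow> max 0 h \<le> z" for h
        unfolding z_def by (rule height_map_le_iff[OF assms]) (use False in simp)
      then have "height_map d \<beta> -` {..x} = {..z}" using z by auto
      moreover have "mass_scale d 0 * z = mass_scale d \<beta> * x powr (\<beta> + 1)" using pos by (simp add: z_def)
      ultimately show ?thesis using False z by (simp add: height_law_atMost[OF assms] height_law_atMost)
    qed
    finally show ?thesis by (simp add: X)
  qed
  show "emeasure (distr (height_law d 0) borel (height_map d \<beta>)) {..real i} \<noteq> \<infinity>" for i :: nat
    using eq[of "{..real i}"] by (simp add: height_law_atMost[OF assms])
qed

section \<open>Far orthants have infinite mass\<close>

definition orthant :: "nat \<Rightarrow> 'a::euclidean_space set \<Rightarrow> 'a set" where
  "orthant N \<sigma> = {v. \<forall>b\<in>Basis. if b \<in> \<sigma> then real N \<le> v \<bullet> b else v \<bullet> b \<le> - real N}"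

lemma closed_orthant: "closed (orthant N \<sigma>)"
proof -
  have "closed {v. if b \<in> \<sigma> then real N \<le> v \<bullet> b else v \<bullet> b \<le> - real N}" for b :: 'a
    by (cases "b \<in> \<sigma>") (simp_all add: closed_Collect_le continuous_on_inner)
  then have "closed (\<Inter>b\<in>Basis. {v. if b \<in> \<sigma> then real N \<le> v \<bullet> b else v \<bullet> b \<le> - real N})" by (intro closed_INT) auto
  moreover have "orthant N \<sigma> = (\<Inter>b\<in>Basis. {v. if b \<in> \<sigma> then real N \<le> v \<bullet> b else v \<bullet> b \<le> - real N})"
    unfolding orthant_def by auto
  ultimately show ?thesis by simp
qed

lemma emeasure_orthant: "emeasure lborel (orthant N \<sigma> :: 'a::euclidean_space set) = \<infinity>"
proof -
  have "of_nat m \<le> emeasure lborel (orthant N \<sigma> :: 'a set)" for m :: nat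
  proof -
  \<comment> \<open>A cube of side \<open>L\<close> inside the orthant has volume at least
    \<open>L\<close>, because \<open>L\<close> is at least 1, and \<open>L\<close> exceeds
    \<open>m\<close>.\<close>
  define L where "L = real m + 1"
  define l u :: 'a where "l = (\<Sum>b\<in>Basis. (if b \<in> \<sigma> then real N else - real N - L) *\<^sub>R b)"
    and "u = (\<Sum>b\<in>Basis. (if b \<in> \<sigma> then real N + L else - real N) *\<^sub>R b)"
  have lb: "l \<bullet> b = (if b \<in> \<sigma> then real N else - real N - L)" and ub: "u \<bullet> b = (if b \<in> \<sigma> then real N + L else - real N)"
    if "b \<in> Basis" for b using that by (simp_all add: l_def u_def)
  have L: "1 \<le> L" "real m \<le> L" by (simp_all add: L_def)
  have sub: "cbox l u \<subseteq> orthant N \<sigma>"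
    unfolding orthant_def mem_box using lb ub by (auto simp: cbox_def split: if_splits)
  have "(\<Prod>b\<in>Basis. (u - l) \<bullet> b) = L ^ DIM('a)"
  proof -
    have "(\<Prod>b\<in>Basis. (u - l) \<bullet> b) = (\<Prod>b\<in>(Basis :: 'a set). L)"
      by (intro prod.cong) (auto simp: inner_diff_left lb ub)
    then show ?thesis by simp
  qed
  moreover have "l \<bullet> b \<le> u \<bullet> b" if "b \<in> Basis" for b using that L by (simp add: lb ub)
  ultimately have "emeasure lborel (cbox l u) = ennreal (L ^ DIM('a))" by (simp add: emeasure_lborel_cbox_eq)
  moreover have "L \<le> L ^ DIM('a)" using L by (intro self_le_power) auto
  ultimately have "ennreal (real m) \<le> emeasure lborel (cbox l u)" using L by (simp add: ennreal_leI)
  also have "\<dots> \<le> emeasure lborel (orthant N \<sigma> :: 'a set)" using sub closed_orthant[of N \<sigma>] by (intro emeasure_mono) auto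
  finally show ?thesis by (simp add: ennreal_of_nat_eq_real_of_nat)
  qed
  then show ?thesis using ennreal_Ex_less_of_nat by (metis infinity_ennreal_def leD top.not_eq_extremum)
qed

section \<open>Coupling and convergence\<close>

lemma spread_iff_orthants:
  "spread A \<longleftrightarrow> (\<forall>N. \<forall>\<sigma>\<subseteq>Basis. A \<inter> (orthant N \<sigma> \<times> UNIV) \<noteq> {})"
proof -
  have "A \<inter> (S \<times> UNIV) \<noteq> {} \<longleftrightarrow> (\<exists>p\<in>A. fst p \<in> S)" for S by force
  then show ?thesis unfolding spread_def orthant_def by simp
qed

lemma AE_spread:
  fixes \<eta> :: "'w \<Rightarrow> ('a::euclidean_space \<times> real) set"
  assumes "void_law M L \<eta>" "\<And>N \<sigma>. \<sigma> \<subseteq> Basis \<Longrightarrow> L (orthant N \<sigma> \<times> UNIV) = \<infinity>"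
  shows "AE \<omega> in M. spread (\<eta> \<omega>)"
proof -
  have "AE \<omega> in M. \<forall>\<sigma>\<in>Pow Basis. \<eta> \<omega> \<inter> (orthant N \<sigma> \<times> UNIV) \<noteq> {}" for N
  proof (intro AE_finite_allI)
    fix \<sigma> :: "'a set" assume "\<sigma> \<in> Pow Basis"
    moreover have "orthant N \<sigma> \<times> (UNIV :: real set) \<in> sets borel"
      by (intro borel_closed closed_Times closed_orthant) auto
    ultimately show "AE \<omega> in M. \<eta> \<omega> \<inter> (orthant N \<sigma> \<times> UNIV) \<noteq> {}"
      using assms(2) by (intro void_law_AE_hit[OF assms(1)]) auto
  qed simp
  then have "AE \<omega> in M. \<forall>N. \<forall>\<sigma>\<in>Pow Basis. \<eta> \<omega> \<inter> (orthant N \<sigma> \<times> UNIV) \<noteq> {}"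
    unfolding AE_all_countable by blast
  then show ?thesis by eventually_elim (simp add: spread_iff_orthants)
qed

lemma emeasure_beta_intensity_times:
  fixes U :: "(real ^ 'n) set"
  assumes "U \<in> sets borel" "S \<in> sets borel"
  shows "emeasure (beta_intensity \<beta>) (U \<times> S) = emeasure (height_law CARD('n) \<beta>) S * emeasure lborel U"
proof -
  have "U \<times> S \<in> sets (borel \<Otimes>\<^sub>M borel)" using assms by auto
  then have "U \<times> S \<in> sets borel" unfolding borel_prod .
  then have "emeasure (beta_intensity \<beta>) (U \<times> S) = (\<integral>\<^sup>+v. emeasure (height_law CARD('n) \<beta>) (Pair v -` (U \<times> S)) \<partial>lborel)"
    by (rule beta_intensity_emeasure)
  also have "\<dots> = (\<integral>\<^sup>+v. emeasure (height_law CARD('n) \<beta>) S * indicator U v \<partial>lborel)"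
    by (intro nn_integral_cong) (simp add: indicator_def)
  also have "\<dots> = emeasure (height_law CARD('n) \<beta>) S * emeasure lborel U"
    using assms(1) by (intro nn_integral_cmult_indicator) simp
  finally show ?thesis .
qed

lemma times_borel: "U \<in> sets borel \<Longrightarrow> S \<in> sets borel \<Longrightarrow> U \<times> S \<in> sets (borel :: ('a::second_countable_topology \<times> 'b::second_countable_topology) measure)"
  unfolding borel_prod[symmetric] by auto

lemma height_law_nonpos: "\<beta> > -1 \<Longrightarrow> emeasure (height_law d \<beta>) {..<0} = 0"
  using height_law_lessThan[of \<beta> 0 d] by simp

lemma height_law_UNIV_pos: "\<beta> > -1 \<Longrightarrow> emeasure (height_law d \<beta>) UNIV \<noteq> 0"
proof
  assume \<beta>: "\<beta> > -1" and "emeasure (height_law d \<beta>) UNIV = 0"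
  then have "emeasure (height_law d \<beta>) {..1} = 0" using emeasure_mono[of "{..1}" UNIV "height_law d \<beta>"] by simp
  then show False using height_law_atMost[OF \<beta>, of d 1] mass_scale_pos[OF \<beta>, of d] by simp
qed

lemma poisson_AE_admissible:
  fixes \<eta> :: "'w \<Rightarrow> ((real ^ 'n) \<times> real) set"
  assumes "poisson_process M (beta_intensity \<beta>) \<eta>" "\<beta> > -1"
  shows "AE \<omega> in M. admissible (\<eta> \<omega>)"
proof -
  have "AE \<omega> in M. \<eta> \<omega> \<inter> (UNIV \<times> {..<0}) = {}"
  proof (rule void_law_AE_miss[OF poisson_void_law[OF assms(1)]])
    show "emeasure (beta_intensity \<beta>) (UNIV \<times> {..<0} :: ((real ^ 'n) \<times> real) set) = 0"
      by (simp add: emeasure_beta_intensity_times height_law_nonpos[OF assms(2)])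
  qed (intro times_borel; simp)
  then show ?thesis using AE_space
  proof eventually_elim
    case (elim \<omega>)
    then have "finite (\<eta> \<omega> \<inter> K)" if "compact K" for K
      using assms(1) that by (auto simp: poisson_process_def point_process_def)
    moreover have "0 \<le> snd p" if "p \<in> \<eta> \<omega>" for p
      using elim(1) that by (cases p) (force simp: not_less[symmetric])
    ultimately show ?case by (simp add: admissible_def)
  qed
qed

definition good_configs :: "('a::euclidean_space \<times> real) set set" where
  "good_configs = {A. admissible A \<and> spread A}"

lemma poisson_AE_good:
  fixes \<eta> :: "'w \<Rightarrow> ((real ^ 'n) \<times> real) set"
  assumes "poisson_process M (beta_intensity \<beta>) \<eta>" "\<beta> > -1"
  shows "AE \<omega> in M. \<eta> \<omega> \<in> good_configs"
proof -
  have "emeasure (beta_intensity \<beta>) (orthant N \<sigma> \<times> UNIV :: ((real ^ 'n) \<times> real) set) = \<infinity>" for N \<sigma>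
    using height_law_UNIV_pos[OF assms(2)]
    by (subst emeasure_beta_intensity_times) (auto simp: closed_orthant emeasure_orthant ennreal_mult_eq_top_iff)
  then have "AE \<omega> in M. spread (\<eta> \<omega>)" by (intro AE_spread[OF poisson_void_law[OF assms(1)]])
  with poisson_AE_admissible[OF assms] show ?thesis
    by eventually_elim (simp add: good_configs_def)
qed

lemma void_measurable_voronoi: "void_measurable_on good_configs (\<lambda>A. skel (laguerre_diagram A))"
  unfolding void_measurable_on_def
proof (intro conjI ballI allI impI)
  fix A :: "('a \<times> real) set" assume "A \<in> good_configs"
  then show "closed (skel (laguerre_diagram A))"
    by (simp add: good_configs_def skel_laguerre_diagram closed_voronoi_skel)
next
  fix K :: "'a set" assume "compact K"
  then have "closed_cond 2 (\<lambda>p w. w \<in> K)" by (intro closed_cond_voronoi compact_imp_closed)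
  then obtain E where "E \<in> sets void_algebra" "\<forall>A. admissible A \<longrightarrow> (A \<in> E \<longleftrightarrow> cluster 2 (\<lambda>p w. w \<in> K) A)"
    using cluster_measurable by blast
  then show "\<exists>E\<in>sets void_algebra. \<forall>A\<in>good_configs. A \<in> E \<longleftrightarrow> skel (laguerre_diagram A) \<inter> K \<noteq> {}"
    by (intro bexI[of _ E]) (simp_all add: good_configs_def skel_laguerre_diagram voronoi_skel_hits_iff)
qed

lemma void_measurable_delaunay: "void_measurable_on good_configs (\<lambda>A. skel (laguerre_dual A))"
  unfolding void_measurable_on_def
proof (intro conjI ballI allI impI)
  fix A :: "('a \<times> real) set" assume "A \<in> good_configs"
  then show "closed (skel (laguerre_dual A))" by (simp add: good_configs_def closed_delaunay_skel)
next
  fix K :: "'a set" assume "compact K"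
  from cluster_measurable[OF closed_cond_delaunay[OF this]]
  obtain E where "E \<in> sets void_algebra"
    "\<forall>A. admissible A \<longrightarrow> (A \<in> E \<longleftrightarrow> cluster (DIM('a) + 1) (\<lambda>p w. \<exists>x\<in>K. on_facet x p) A)" by blast
  then show "\<exists>E\<in>sets void_algebra. \<forall>A\<in>good_configs. A \<in> E \<longleftrightarrow> skel (laguerre_dual A) \<inter> K \<noteq> {}"
    by (intro bexI[of _ E]) (simp_all add: good_configs_def delaunay_skel_hits_iff)
qed

section \<open>The coupled process and its ground points\<close>

definition map_height :: "(real \<Rightarrow> real) \<Rightarrow> 'a \<times> real \<Rightarrow> 'a \<times> real" where
  "map_height g = (\<lambda>(v, h). (v, g h))"

lemma map_height_measurable:
  assumes "g \<in> borel_measurable borel"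
  shows "(map_height g :: ('a::euclidean_space \<times> real) \<Rightarrow> _) \<in> borel_measurable borel"
proof -
  have "(\<lambda>x. (fst x, g (snd x))) \<in> measurable (borel \<Otimes>\<^sub>M borel) ((borel :: 'a measure) \<Otimes>\<^sub>M borel)"
    using assms by measurable
  then show ?thesis unfolding map_height_def case_prod_beta borel_prod .
qed

text \<open>Only heights move, so by Fubini the comparison of intensities reduces to the height
  measures on each vertical line.\<close>

lemma poisson_height_transform:
  fixes \<eta> :: "'w \<Rightarrow> ((real ^ 'n) \<times> real) set"
  assumes "poisson_process M (beta_intensity 0) \<eta>" "\<beta> > -1"
  shows "void_law M (emeasure (beta_intensity \<beta>)) (\<lambda>\<omega>. map_height (height_map CARD('n) \<beta>) ` \<eta> \<omega>)"
proof -
  let ?f = "map_height (height_map CARD('n) \<beta>) :: (real ^ 'n) \<times> real \<Rightarrow> _"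
  have f: "?f \<in> borel_measurable borel" by (rule map_height_measurable[OF height_map_measurable])
  have "void_law M (\<lambda>B. emeasure (beta_intensity 0) (?f -` B \<inter> UNIV)) (\<lambda>\<omega>. ?f ` (\<eta> \<omega> \<inter> UNIV))"
    by (rule void_law_image[OF poisson_void_law[OF assms(1)] f]) simp
  then show ?thesis unfolding Int_UNIV_right
  proof (rule void_law_cong)
    fix B :: "((real ^ 'n) \<times> real) set" assume B: "B \<in> sets borel"
    have fB: "?f -` B \<in> sets borel" using measurable_sets[OF f B] by simp
    have "emeasure (height_law CARD('n) 0) (Pair v -` (?f -` B)) = emeasure (height_law CARD('n) \<beta>) (Pair v -` B)" for v
    proof -
      have "B \<in> sets (borel \<Otimes>\<^sub>M borel)" using B unfolding borel_prod .
      then have Bv: "Pair v -` B \<in> sets borel" by (rule sets_Pair1)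
      have "Pair v -` (?f -` B) = height_map CARD('n) \<beta> -` (Pair v -` B)" by (auto simp: map_height_def)
      then have "emeasure (height_law CARD('n) 0) (Pair v -` (?f -` B)) =
          emeasure (distr (height_law CARD('n) 0) borel (height_map CARD('n) \<beta>)) (Pair v -` B)"
        using emeasure_distr[OF height_map_measurable_height_law Bv] by simp
      then show ?thesis by (simp add: distr_height_map[OF assms(2)])
    qed
    then show "emeasure (beta_intensity 0) (?f -` B) = emeasure (beta_intensity \<beta>) B"
      by (simp add: beta_intensity_emeasure[OF B] beta_intensity_emeasure[OF fB])
  qed
qed

text \<open>Solves \<open>a_0 h = \<gamma>_d\<close>: at \<open>\<beta> = 0\<close> the heights
  below this value carry mass \<open>\<gamma>_d\<close> per unit of base volume.\<close>

definition ground_height :: "nat \<Rightarrow> real" where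
  "ground_height d = gamma_const d / mass_scale d 0"

lemma gamma_const_pos: "0 < gamma_const d"
  unfolding gamma_const_def by (intro mult_pos_pos Gamma_real_pos) auto

lemma ground_height_pos: "0 < ground_height d"
  unfolding ground_height_def by (intro divide_pos_pos gamma_const_pos mass_scale_pos) simp

lemma height_law_ground: "emeasure (height_law d 0) {..<ground_height d} = ennreal (gamma_const d)"
  using height_law_lessThan[of 0 "ground_height d" d] ground_height_pos[of d] mass_scale_pos[of 0 d] gamma_const_pos[of d]
  by (simp add: ground_height_def)

definition ground_points :: "nat \<Rightarrow> ('a \<times> real) set \<Rightarrow> ('a \<times> real) set" where
  "ground_points d P = {p \<in> P. snd p < ground_height d}"

text \<open>Shared by the projected low points of the coupling and by the embedded homogeneous
  process, which therefore have the same law on \<open>void_algebra\<close>.\<close>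

definition ground_law :: "nat \<Rightarrow> ('a::euclidean_space \<times> real) set \<Rightarrow> ennreal" where
  "ground_law d B = ennreal (gamma_const d) * emeasure lborel ((\<lambda>v. (v, 0)) -` B)"

lemma embed_measurable: "(\<lambda>v. (v, 0)) \<in> measurable borel (borel :: ('a::euclidean_space \<times> real) measure)"
  unfolding borel_prod[symmetric] by measurable

lemma poisson_ground_transform:
  fixes \<eta> :: "'w \<Rightarrow> ((real ^ 'n) \<times> real) set"
  assumes "poisson_process M (beta_intensity 0) \<eta>"
  shows "void_law M (ground_law CARD('n)) (\<lambda>\<omega>. (\<lambda>(v, h). (v, 0)) ` ground_points CARD('n) (\<eta> \<omega>))"
proof -
  let ?f = "map_height (\<lambda>_. 0) :: (real ^ 'n) \<times> real \<Rightarrow> _"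
  let ?S = "UNIV \<times> {..<ground_height CARD('n)} :: ((real ^ 'n) \<times> real) set"
  have f: "?f \<in> borel_measurable borel" by (rule map_height_measurable) simp
  have S: "?S \<in> sets borel" by (intro times_borel) auto
  have "void_law M (\<lambda>B. emeasure (beta_intensity 0) (?f -` B \<inter> ?S)) (\<lambda>\<omega>. ?f ` (\<eta> \<omega> \<inter> ?S))"
    by (rule void_law_image[OF poisson_void_law[OF assms] f S])
  moreover have "?f ` (\<eta> \<omega> \<inter> ?S) = (\<lambda>(v, h). (v, 0)) ` ground_points CARD('n) (\<eta> \<omega>)" for \<omega>
    unfolding map_height_def ground_points_def by (intro image_cong) auto
  ultimately have "void_law M (\<lambda>B. emeasure (beta_intensity 0) (?f -` B \<inter> ?S)) (\<lambda>\<omega>. (\<lambda>(v, h). (v, 0)) ` ground_points CARD('n) (\<eta> \<omega>))"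
    by simp
  then show ?thesis
  proof (rule void_law_cong)
    fix B :: "((real ^ 'n) \<times> real) set" assume B: "B \<in> sets borel"
    let ?B0 = "(\<lambda>v. (v, 0 :: real)) -` B"
    have B0: "?B0 \<in> sets borel" using measurable_sets[OF embed_measurable B] by simp
    have "?f -` B \<inter> ?S = ?B0 \<times> {..<ground_height CARD('n)}" by (auto simp: map_height_def)
    then show "emeasure (beta_intensity 0) (?f -` B \<inter> ?S) = ground_law CARD('n) B"
      by (simp add: emeasure_beta_intensity_times[OF B0] height_law_ground ground_law_def)
  qed
qed

lemma poisson_embed:
  fixes \<zeta> :: "'u \<Rightarrow> (real ^ 'n) set"
  assumes "poisson_process N (density lborel (\<lambda>_. ennreal (gamma_const CARD('n)))) \<zeta>"
  shows "void_law N (ground_law CARD('n)) (\<lambda>\<omega>. embed0 (\<zeta> \<omega>))"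
proof -
  let ?L = "density lborel (\<lambda>_. ennreal (gamma_const CARD('n))) :: (real ^ 'n) measure"
  have "void_law N (\<lambda>B. emeasure ?L ((\<lambda>v. (v, 0 :: real)) -` B)) (\<lambda>\<omega>. (\<lambda>v. (v, 0)) ` \<zeta> \<omega>)"
    unfolding void_law_def
  proof (intro conjI ballI)
    show "prob_space N" using assms by (simp add: poisson_process_def point_process_def)
    fix B :: "((real ^ 'n) \<times> real) set" assume B: "B \<in> sets borel"
    let ?B0 = "(\<lambda>v. (v, 0 :: real)) -` B"
    have B0: "?B0 \<in> sets borel" using measurable_sets[OF embed_measurable B] by simp
    have eq: "(\<lambda>v. (v, 0)) ` \<zeta> \<omega> \<inter> B = {} \<longleftrightarrow> \<zeta> \<omega> \<inter> ?B0 = {}" for \<omega> by auto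
    show "{\<omega> \<in> space N. (\<lambda>v. (v, 0)) ` \<zeta> \<omega> \<inter> B = {}} \<in> sets N"
      "measure N {\<omega> \<in> space N. (\<lambda>v. (v, 0)) ` \<zeta> \<omega> \<inter> B = {}} =
        (if emeasure ?L ?B0 = \<infinity> then 0 else exp (- enn2real (emeasure ?L ?B0)))"
      unfolding eq using poisson_void_law[OF assms, unfolded void_law_def, THEN conjunct2, rule_format, OF B0] by simp_all
  qed
  then show ?thesis unfolding embed0_def
  proof (rule void_law_cong)
    fix B :: "((real ^ 'n) \<times> real) set" assume B: "B \<in> sets borel"
    then have "(\<lambda>v. (v, 0 :: real)) -` B \<in> sets borel" using measurable_sets[OF embed_measurable B] by simp
    then show "emeasure ?L ((\<lambda>v. (v, 0)) -` B) = ground_law CARD('n) B"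
      unfolding ground_law_def by (intro emeasure_density_const) simp
  qed
qed

lemma ground_law_orthant: "ground_law d (orthant N \<sigma> \<times> UNIV :: ('a::euclidean_space \<times> real) set) = \<infinity>"
proof -
  have "(\<lambda>v. (v, 0 :: real)) -` (orthant N \<sigma> \<times> UNIV) = (orthant N \<sigma> :: 'a set)" by auto
  then show ?thesis using gamma_const_pos[of d]
    by (simp add: ground_law_def emeasure_orthant ennreal_mult_eq_top_iff)
qed

lemma embed_AE_good:
  fixes \<zeta> :: "'u \<Rightarrow> (real ^ 'n) set"
  assumes "poisson_process N (density lborel (\<lambda>_. ennreal (gamma_const CARD('n)))) \<zeta>"
  shows "AE \<omega> in N. embed0 (\<zeta> \<omega>) \<in> good_configs"
proof -
  have "AE \<omega> in N. spread (embed0 (\<zeta> \<omega>))"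
    by (rule AE_spread[OF poisson_embed[OF assms]]) (rule ground_law_orthant)
  then show ?thesis using AE_space
  proof eventually_elim
    case (elim \<omega>)
    have "finite (embed0 (\<zeta> \<omega>) \<inter> K)" if "compact K" for K
    proof -
      have "compact (fst ` K)" using that by (intro compact_continuous_image continuous_on_fst continuous_on_id)
      then have "finite (\<zeta> \<omega> \<inter> fst ` K)"
        using assms elim(2) by (auto simp: poisson_process_def point_process_def)
      moreover have "embed0 (\<zeta> \<omega>) \<inter> K \<subseteq> (\<lambda>v. (v, 0)) ` (\<zeta> \<omega> \<inter> fst ` K)" by (force simp: embed0_def)
      ultimately show ?thesis by (meson finite_imageI finite_subset)
    qed
    then show ?case using elim(1) by (auto simp: good_configs_def admissible_def embed0_def)
  qed
qed

lemma poisson_hits_prod: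
  fixes B :: "nat \<Rightarrow> 'b::euclidean_space set"
  assumes P: "poisson_process M \<Lambda> \<eta>" and B: "\<And>i. i < n \<Longrightarrow> B i \<in> sets borel" "disjoint_family_on B {..<n}"
  shows "measure M {\<omega> \<in> space M. \<forall>i<n. \<eta> \<omega> \<inter> B i \<noteq> {}} = (\<Prod>i<n. measure M {\<omega> \<in> space M. \<eta> \<omega> \<inter> B i \<noteq> {}})"
proof -
  interpret prob_space M using P by (simp add: poisson_process_def point_process_def)
  show ?thesis
  \<comment> \<open>The product rule for independent variables is applied to a non-empty index set;
    an empty intersection would also not be confined to \<open>space M\<close>.\<close>
  proof (cases "n = 0")
    case True
    then show ?thesis by (simp add: prob_space)
  next
    case False
    have ind: "indep_vars (\<lambda>_. borel) (\<lambda>i. num_points \<eta> (B i)) {..<n}"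
      using P B unfolding poisson_process_def by blast
    have vim: "num_points \<eta> (B i) -` (- {0}) \<inter> space M = {\<omega> \<in> space M. \<eta> \<omega> \<inter> B i \<noteq> {}}" for i
      using num_points_eq_0[of \<eta> "B i"] by auto
    have "{\<omega> \<in> space M. \<forall>i<n. \<eta> \<omega> \<inter> B i \<noteq> {}} = (\<Inter>i\<in>{..<n}. num_points \<eta> (B i) -` (- {0}) \<inter> space M)"
      unfolding vim using False by auto
    then show ?thesis
      using indep_varsD_finite[OF ind, of "\<lambda>_. - {0}"] False unfolding vim by auto
  qed
qed

text \<open>Products of disjoint sets with the common height strip remain disjoint, so their hits
  are independent, and each has probability \<open>1 - exp (- x)\<close>, at most the intensity mass
  \<open>x\<close>.\<close>

lemma hit_bound_ground:
  fixes \<eta> :: "'w \<Rightarrow> ((real ^ 'n) \<times> real) set"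
  assumes P: "poisson_process M (beta_intensity 0) \<eta>"
  shows "hit_bound M (gamma_const CARD('n)) (\<lambda>\<omega>. fst ` ground_points CARD('n) (\<eta> \<omega>))"
proof -
  let ?Z = "\<lambda>\<omega>. fst ` ground_points CARD('n) (\<eta> \<omega>)" and ?g = "{..<ground_height CARD('n)}"
  let ?c = "gamma_const CARD('n)"
  interpret prob_space M using P by (simp add: poisson_process_def point_process_def)
  have c: "0 \<le> ?c" using gamma_const_pos[of "CARD('n)"] by simp
  have eq: "?Z \<omega> \<inter> B \<noteq> {} \<longleftrightarrow> \<eta> \<omega> \<inter> (B \<times> ?g) \<noteq> {}" for \<omega> and B :: "(real ^ 'n) set"
    unfolding ground_points_def by fastforce
  have Bg: "B \<times> ?g \<in> sets borel" if "B \<in> sets borel" for B :: "(real ^ 'n) set"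
    using that by (intro times_borel) auto
  have le: "prob {\<omega> \<in> space M. \<eta> \<omega> \<inter> (B \<times> ?g) \<noteq> {}} \<le> ?c * measure lborel B"
    if B: "B \<in> sets borel" "bounded B" for B :: "(real ^ 'n) set"
  proof -
    have fin: "emeasure lborel B < \<infinity>" using emeasure_bounded_finite[OF B(2)] by simp
    have L: "emeasure (beta_intensity 0) (B \<times> ?g) = ennreal ?c * emeasure lborel B"
      using B(1) by (simp add: emeasure_beta_intensity_times height_law_ground)
    also have "\<dots> = ennreal (?c * measure lborel B)"
      using fin c by (simp add: emeasure_eq_ennreal_measure ennreal_mult less_top)
    finally have L: "emeasure (beta_intensity 0) (B \<times> ?g) = ennreal (?c * measure lborel B)" .
    have "prob {\<omega> \<in> space M. \<eta> \<omega> \<inter> (B \<times> ?g) = {}} = exp (- (?c * measure lborel B))"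
      using poisson_void_law[OF P] Bg[OF B(1)] c unfolding void_law_def by (simp add: L)
    moreover have "prob {\<omega> \<in> space M. \<not> \<eta> \<omega> \<inter> (B \<times> ?g) = {}} = 1 - prob {\<omega> \<in> space M. \<eta> \<omega> \<inter> (B \<times> ?g) = {}}"
      using poisson_hit_measurable(2)[OF P Bg[OF B(1)]] by (rule prob_neg)
    moreover have "1 - ?c * measure lborel B \<le> exp (- (?c * measure lborel B))"
      using exp_ge_add_one_self[of "- (?c * measure lborel B)"] by simp
    ultimately show ?thesis by simp
  qed
  show ?thesis unfolding hit_bound_def eq
  proof (intro conjI ballI allI impI)
    show "prob_space M" by (rule prob_space_axioms)
    show "{\<omega> \<in> space M. \<eta> \<omega> \<inter> (B \<times> ?g) \<noteq> {}} \<in> sets M" if "B \<in> sets borel" for B :: "(real ^ 'n) set"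
      by (rule poisson_hit_measurable(1)[OF P Bg[OF that]])
    fix B :: "nat \<Rightarrow> (real ^ 'n) set" and n
    assume B: "(\<forall>i<n. B i \<in> sets borel \<and> bounded (B i)) \<and> disjoint_family_on B {..<n}"
    have "disjoint_family_on (\<lambda>i. B i \<times> ?g) {..<n}" using B by (fastforce simp: disjoint_family_on_def)
    then have "prob {\<omega> \<in> space M. \<forall>i<n. \<eta> \<omega> \<inter> (B i \<times> ?g) \<noteq> {}} = (\<Prod>i<n. prob {\<omega> \<in> space M. \<eta> \<omega> \<inter> (B i \<times> ?g) \<noteq> {}})"
      using B Bg by (intro poisson_hits_prod[OF P, of n "\<lambda>i. B i \<times> ?g"]) auto
    also have "\<dots> \<le> (\<Prod>i<n. ?c * measure lborel (B i))"
      using B le by (intro prod_mono) auto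
    finally show "prob {\<omega> \<in> space M. \<forall>i<n. \<eta> \<omega> \<inter> (B i \<times> ?g) \<noteq> {}} \<le> (\<Prod>i<n. ?c * measure lborel (B i))" .
  qed (rule c)
qed

section \<open>Almost sure convergence of the coupled configurations\<close>

lemma admissible_map_height:
  assumes A: "admissible A" and nonneg: "\<And>h. 0 \<le> g h" and proper: "\<And>R. \<exists>H. \<forall>h. g h \<le> R \<longrightarrow> h \<le> H"
  shows "admissible (map_height g ` A)"
  unfolding admissible_def
proof (intro conjI allI impI ballI)
  fix K :: "('a \<times> real) set" assume "compact K"
  then obtain R where R: "\<And>x. x \<in> K \<Longrightarrow> norm x \<le> R" using compact_imp_bounded[OF \<open>compact K\<close>] unfolding bounded_iff by blast
  obtain H where H: "\<And>h. g h \<le> R \<Longrightarrow> h \<le> H" using proper by blast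
  have "map_height g ` A \<inter> K \<subseteq> map_height g ` (A \<inter> cball 0 R \<times> {0..H})"
  proof
    fix x assume x: "x \<in> map_height g ` A \<inter> K"
    then obtain v h where vh: "(v, h) \<in> A" "x = (v, g h)" by (auto simp: map_height_def)
    then have "norm (v, g h) \<le> R" using x R by auto
    then have "norm v \<le> R" "g h \<le> R" using norm_fst_le[of v "g h"] norm_snd_le[of "g h" v] by auto
    moreover have "0 \<le> h" using A vh by (auto simp: admissible_def)
    ultimately have "(v, h) \<in> A \<inter> cball 0 R \<times> {0..H}" using vh(1) H by simp
    then show "x \<in> map_height g ` (A \<inter> cball 0 R \<times> {0..H})" unfolding vh(2)
      by (intro image_eqI[of _ _ "(v, h)"]) (simp_all add: map_height_def)
  qed
  moreover have "compact (cball 0 R \<times> {0..H} :: ('a \<times> real) set)" by (intro compact_Times) auto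
  then have "finite (A \<inter> cball 0 R \<times> {0..H})" using A unfolding admissible_def by blast
  ultimately show "finite (map_height g ` A \<inter> K)" by (meson finite_imageI finite_subset)
qed (auto simp: map_height_def nonneg)

lemma admissible_height_map:
  assumes "admissible A" "\<beta> > -1"
  shows "admissible (map_height (height_map d \<beta>) ` A)"
proof (rule admissible_map_height[OF assms(1) height_map_nonneg])
  fix R
  have "h \<le> mass_scale d \<beta> / mass_scale d 0 * max 0 R powr (\<beta> + 1)" if "height_map d \<beta> h \<le> R" for h
  proof -
    have "height_map d \<beta> h \<le> max 0 R" using that by simp
    then have "max 0 h \<le> mass_scale d \<beta> / mass_scale d 0 * max 0 R powr (\<beta> + 1)"
      by (subst (asm) height_map_le_iff[OF assms(2)]) auto
    then show ?thesis by simp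
  qed
  then show "\<exists>H. \<forall>h. height_map d \<beta> h \<le> R \<longrightarrow> h \<le> H" by blast
qed

lemma fst_map_height: "fst (map_height g p) = fst p"
  by (simp add: map_height_def case_prod_beta)

lemma spread_map_height: "spread A \<Longrightarrow> spread (map_height g ` A)"
  by (simp add: spread_def fst_map_height cong: if_cong split del: if_split)

text \<open>The base of the power tends to \<open>a_0 h / \<gamma>_d\<close>, which is below 1
  exactly when \<open>h\<close> is below \<open>ground_height d\<close>, while the exponent tends to
  infinity. As the base varies with \<open>n\<close>, it is compared with a constant
  \<open>\<rho>\<close> strictly between its limit and 1.\<close>

lemma height_map_tendsto:
  assumes X: "X \<longlonglongrightarrow> -1" "\<And>n. X n > -1"
  shows "\<lbrakk>0 \<le> h; h < ground_height d\<rbrakk> \<Longrightarrow> (\<lambda>n. height_map d (X n) h) \<longlonglongrightarrow> 0"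
    and "ground_height d < h \<Longrightarrow> filterlim (\<lambda>n. height_map d (X n) h) at_top sequentially"
proof -
  have ms: "(\<lambda>n. mass_scale d 0 / mass_scale d (X n) * h) \<longlonglongrightarrow> mass_scale d 0 / gamma_const d * h"
    using gamma_const_pos[of d] by (intro tendsto_intros mass_scale_tendsto X) auto
  have "(\<lambda>n. X n + 1) \<longlonglongrightarrow> -1 + 1" by (intro tendsto_intros X)
  then have "filterlim (\<lambda>n. X n + 1) (at_right 0) sequentially"
  proof (intro tendsto_imp_filterlim_at_right always_eventually allI)
    show "0 < X n + 1" for n using X(2)[of n] by linarith
  qed simp
  then have inv: "filterlim (\<lambda>n. 1 / (X n + 1)) at_top sequentially"
    using filterlim_compose[OF filterlim_inverse_at_top_right] by (simp add: inverse_eq_divide)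
  have pos: "0 < mass_scale d 0" "0 < gamma_const d" "\<And>n. 0 < mass_scale d (X n)"
    using mass_scale_pos[of 0 d] gamma_const_pos mass_scale_pos[OF X(2)] by auto
  show "(\<lambda>n. height_map d (X n) h) \<longlonglongrightarrow> 0" if h: "0 \<le> h" "h < ground_height d"
  proof -
    have "mass_scale d 0 / gamma_const d * h < 1" using h(2) pos by (simp add: ground_height_def field_simps)
    then obtain \<rho> where \<rho>: "mass_scale d 0 / gamma_const d * h < \<rho>" "\<rho> < 1" using dense by blast
    have "0 \<le> mass_scale d 0 / gamma_const d * h" using h(1) pos by simp
    then have "0 < \<rho>" using \<rho>(1) by linarith
    have "((\<lambda>y. exp (ln \<rho> * y)) \<longlongrightarrow> 0) at_top"
      using \<open>0 < \<rho>\<close> \<rho>(2)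
      by (intro filterlim_compose[OF exp_at_bot] filterlim_tendsto_neg_mult_at_bot[OF tendsto_const] filterlim_ident) auto
    then have "(\<lambda>n. exp (ln \<rho> * (1 / (X n + 1)))) \<longlonglongrightarrow> 0" by (rule filterlim_compose[OF _ inv])
    then have lim: "(\<lambda>n. \<rho> powr (1 / (X n + 1))) \<longlonglongrightarrow> 0" using \<open>0 < \<rho>\<close> by (simp add: powr_def)
    have "\<forall>\<^sub>F n in sequentially. mass_scale d 0 / mass_scale d (X n) * h < \<rho>" using order_tendstoD(2)[OF ms \<rho>(1)] .
    then have up: "\<forall>\<^sub>F n in sequentially. height_map d (X n) h \<le> \<rho> powr (1 / (X n + 1))"
    proof eventually_elim
      case (elim n)
      have "0 \<le> mass_scale d 0 / mass_scale d (X n) * h" using h(1) pos(1) pos(3)[of n] by simp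
      moreover have "0 \<le> 1 / (X n + 1)" using X(2)[of n] by simp
      ultimately show ?case unfolding height_map_def using elim h(1) by (simp add: max_absorb2 powr_mono2)
    qed
    show ?thesis
      by (rule tendsto_sandwich[OF _ up tendsto_const lim]) (simp add: height_map_nonneg)
  qed
  show "filterlim (\<lambda>n. height_map d (X n) h) at_top sequentially" if h: "ground_height d < h"
  proof -
    have "1 < mass_scale d 0 / gamma_const d * h" using h pos by (simp add: ground_height_def field_simps)
    then obtain \<rho> where \<rho>: "1 < \<rho>" "\<rho> < mass_scale d 0 / gamma_const d * h" using dense by blast
    have h0: "0 \<le> h" using h ground_height_pos[of d] by simp
    have "filterlim (\<lambda>y. exp (ln \<rho> * y)) at_top at_top"
      using \<rho>(1) by (intro filterlim_compose[OF exp_at_top] filterlim_tendsto_pos_mult_at_top[OF tendsto_const] filterlim_ident) auto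
    then have "filterlim (\<lambda>n. exp (ln \<rho> * (1 / (X n + 1)))) at_top sequentially" by (rule filterlim_compose[OF _ inv])
    then have lim: "filterlim (\<lambda>n. \<rho> powr (1 / (X n + 1))) at_top sequentially" using \<rho>(1) by (simp add: powr_def)
    have "\<forall>\<^sub>F n in sequentially. \<rho> < mass_scale d 0 / mass_scale d (X n) * h" using order_tendstoD(1)[OF ms \<rho>(2)] .
    then have "\<forall>\<^sub>F n in sequentially. \<rho> powr (1 / (X n + 1)) \<le> height_map d (X n) h"
    proof eventually_elim
      case (elim n)
      have "0 \<le> 1 / (X n + 1)" using X(2)[of n] by simp
      then show ?case unfolding height_map_def using elim h0 \<rho>(1) by (simp add: max_absorb2 powr_mono2)
    qed
    then show ?thesis by (rule filterlim_at_top_mono[OF lim])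
  qed
qed

lemma height_map_mono:
  assumes "\<beta> > -1" "h \<le> h'"
  shows "height_map d \<beta> h \<le> height_map d \<beta> h'"
  unfolding height_map_def
  using mass_scale_pos[of 0 d] mass_scale_pos[OF assms(1), of d] assms
  by (intro powr_mono2 mult_left_mono mult_nonneg_nonneg) auto

text \<open>Collects all random input in one null event that does not depend on the test sets; what
  follows for a fixed outcome is deterministic.\<close>

lemma AE_config_conv:
  fixes \<eta> :: "'w \<Rightarrow> ((real ^ 'n) \<times> real) set"
  assumes P: "poisson_process M (beta_intensity 0) \<eta>" and X: "X \<longlonglongrightarrow> -1" "\<And>n. X n > -1"
  defines "Y \<equiv> \<lambda>\<omega>. (\<lambda>(v, h). (v, 0)) ` ground_points CARD('n) (\<eta> \<omega>)"
  shows "AE \<omega> in M. (\<forall>n. map_height (height_map CARD('n) (X n)) ` \<eta> \<omega> \<in> good_configs) \<and> Y \<omega> \<in> good_configs \<and>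
    config_conv (\<lambda>n. map_height (height_map CARD('n) (X n)) ` \<eta> \<omega>) (Y \<omega>) \<and> lift_generic (fst ` Y \<omega>)"
proof -
  let ?hs = "ground_height CARD('n)"
  \<comment> \<open>At the threshold height the base of the power tends to 1 and its power may
    behave in any way; almost surely no point has this height.\<close>
  have "AE \<omega> in M. \<eta> \<omega> \<inter> (UNIV \<times> {?hs}) = {}"
  proof (rule void_law_AE_miss[OF poisson_void_law[OF P]])
    show "emeasure (beta_intensity 0) (UNIV \<times> {?hs} :: ((real ^ 'n) \<times> real) set) = 0"
      by (simp add: emeasure_beta_intensity_times height_law_singleton)
  qed (intro times_borel; simp)
  moreover have "AE \<omega> in M. \<eta> \<omega> \<in> good_configs" by (rule poisson_AE_good[OF P]) simp
  moreover have "AE \<omega> in M. spread (Y \<omega>)"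
    unfolding Y_def by (rule AE_spread[OF poisson_ground_transform[OF P]]) (rule ground_law_orthant)
  moreover have "AE \<omega> in M. lift_generic (fst ` ground_points CARD('n) (\<eta> \<omega>))"
    by (rule AE_lift_generic[OF hit_bound_ground[OF P]])
  ultimately show ?thesis
  proof eventually_elim
    case (elim \<omega>)
    have adm: "admissible (\<eta> \<omega>)" and spr: "spread (\<eta> \<omega>)" using elim(2) by (auto simp: good_configs_def)
    have admn: "admissible (map_height (height_map CARD('n) (X n)) ` \<eta> \<omega>)" for n
      by (rule admissible_height_map[OF adm X(2)])
    have "Y \<omega> \<noteq> {}" using elim(3) by (auto simp: spread_def)
    then obtain p0 where p0: "p0 \<in> \<eta> \<omega>" "snd p0 < ?hs" by (auto simp: Y_def ground_points_def)
    have "config_conv (\<lambda>n. (\<lambda>(v, h). (v, height_map CARD('n) (X n) h)) ` \<eta> \<omega>) ((\<lambda>(v, h). (v, 0)) ` {p \<in> \<eta> \<omega>. snd p < ?hs})"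
    proof (rule flat_config_conv[OF adm _ p0])
      show "snd p \<noteq> ?hs" if "p \<in> \<eta> \<omega>" for p using elim(1) that by (cases p) auto
      show "(\<lambda>n. height_map CARD('n) (X n) h) \<longlonglongrightarrow> 0" if "0 \<le> h" "h < ?hs" for h
        by (rule height_map_tendsto(1)[OF X that])
      show "filterlim (\<lambda>n. height_map CARD('n) (X n) h) at_top sequentially" if "?hs < h" for h
        by (rule height_map_tendsto(2)[OF X that])
      show "height_map CARD('n) (X n) h \<le> height_map CARD('n) (X n) h'" if "h \<le> h'" for n h h'
        by (rule height_map_mono[OF X(2) that])
      show "admissible ((\<lambda>(v, h). (v, height_map CARD('n) (X n) h)) ` \<eta> \<omega>)" for n
        using admn[of n] unfolding map_height_def .
    qed
    then have conv: "config_conv (\<lambda>n. map_height (height_map CARD('n) (X n)) ` \<eta> \<omega>) (Y \<omega>)"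
      unfolding map_height_def Y_def ground_points_def .
    moreover have "admissible (Y \<omega>)" using conv by (simp add: config_conv_def)
    moreover have "fst ` Y \<omega> = fst ` ground_points CARD('n) (\<eta> \<omega>)"
      unfolding Y_def image_image by (intro image_cong) auto
    ultimately show ?case
      using elim(3,4) admn spread_map_height[OF spr] by (simp add: good_configs_def)
  qed
qed

text \<open>The functional \<open>Z\<close> is abstract, so the two skeletons share the coupling and
  the passage to laws and differ only in the deterministic inputs \<open>miss\<close> and
  \<open>hit\<close>.\<close>

lemma skeletons_converge_weakly:
  fixes M :: "real \<Rightarrow> 'w measure" and \<eta> :: "real \<Rightarrow> 'w \<Rightarrow> ((real ^ 'n) \<times> real) set"
    and N :: "'u measure" and \<zeta> :: "'u \<Rightarrow> (real ^ 'n) set" and Z :: "((real ^ 'n) \<times> real) set \<Rightarrow> (real ^ 'n) set"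
  assumes \<eta>: "\<And>\<beta>. \<beta> > -1 \<Longrightarrow> poisson_process (M \<beta>) (beta_intensity \<beta>) (\<eta> \<beta>)"
    and \<zeta>: "poisson_process N (density lborel (\<lambda>_. ennreal (gamma_const CARD('n)))) \<zeta>"
    and Z: "void_measurable_on good_configs Z"
    and miss: "\<And>As A K. config_conv As A \<Longrightarrow> A \<in> good_configs \<Longrightarrow> compact K \<Longrightarrow> Z A \<inter> K = {} \<Longrightarrow>
      \<forall>\<^sub>F n in sequentially. Z (As n) \<inter> K = {}"
    and hit: "\<And>As A G. config_conv As A \<Longrightarrow> A \<in> good_configs \<Longrightarrow> (\<And>p. p \<in> A \<Longrightarrow> snd p = 0) \<Longrightarrow>
      lift_generic (fst ` A) \<Longrightarrow> open G \<Longrightarrow> Z A \<inter> G \<noteq> {} \<Longrightarrow> \<forall>\<^sub>F n in sequentially. Z (As n) \<inter> G \<noteq> {}"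
  shows "random_closed_sets_converge_weakly M (\<lambda>\<beta> \<omega>. Z (\<eta> \<beta> \<omega>)) N (\<lambda>\<omega>. Z (embed0 (\<zeta> \<omega>))) (at_right (-1))"
  unfolding random_closed_sets_converge_weakly_def weak_convergence_def
proof (intro allI impI, elim conjE)
  fix f :: "(real ^ 'n) set \<Rightarrow> real"
  assume f: "continuous_map fell_topology euclideanreal f" "bounded (f ` topspace fell_topology)"
  have P0: "poisson_process (M 0) (beta_intensity 0) (\<eta> 0)" by (rule \<eta>) simp
  let ?d = "CARD('n)"
  let ?A = "\<lambda>\<beta> \<omega>. map_height (height_map ?d \<beta>) ` \<eta> 0 \<omega>"
  let ?Y = "\<lambda>\<omega>. (\<lambda>(v, h). (v, 0)) ` ground_points ?d (\<eta> 0 \<omega>)"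
  show "((\<lambda>\<beta>. \<integral>x. f x \<partial>closed_set_law (M \<beta>) (\<lambda>\<omega>. Z (\<eta> \<beta> \<omega>))) \<longlongrightarrow>
      (\<integral>x. f x \<partial>closed_set_law N (\<lambda>\<omega>. Z (embed0 (\<zeta> \<omega>))))) (at_right (-1))"
    \<comment> \<open>Passing to sequences leaves countably many parameters, for which the almost
      sure properties hold simultaneously.\<close>
    unfolding tendsto_at_iff_sequentially
  proof (intro allI impI)
    fix X :: "nat \<Rightarrow> real" assume "\<forall>i. X i \<in> {-1<..} - {-1}" and Xlim: "X \<longlonglongrightarrow> -1"
    then have X: "\<And>n. X n > -1" by auto
    note conv = AE_config_conv[OF P0 Xlim X]
    have good: "AE \<omega> in M 0. ?A (X n) \<omega> \<in> good_configs" "AE \<omega> in M 0. ?Y \<omega> \<in> good_configs" for n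
      using conv by (auto elim!: eventually_mono)
    have lawA: "void_law (M 0) (emeasure (beta_intensity (X n))) (?A (X n))" for n
      by (rule poisson_height_transform[OF P0 X])
    have lawY: "void_law (M 0) (ground_law ?d) ?Y" by (rule poisson_ground_transform[OF P0])
    have eqA: "closed_set_law (M (X n)) (\<lambda>\<omega>. Z (\<eta> (X n) \<omega>)) = closed_set_law (M 0) (\<lambda>\<omega>. Z (?A (X n) \<omega>))" for n
      by (rule closed_set_law_eq[OF Z poisson_void_law[OF \<eta>[OF X]] lawA poisson_AE_good[OF \<eta>[OF X] X] good(1)])
    have eqY: "closed_set_law N (\<lambda>\<omega>. Z (embed0 (\<zeta> \<omega>))) = closed_set_law (M 0) (\<lambda>\<omega>. Z (?Y \<omega>))"
      by (rule closed_set_law_eq[OF Z poisson_embed[OF \<zeta>] lawY embed_AE_good[OF \<zeta>] good(2)])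
    have "(\<lambda>n. \<integral>x. f x \<partial>closed_set_law (M 0) (\<lambda>\<omega>. Z (?A (X n) \<omega>))) \<longlonglongrightarrow> (\<integral>x. f x \<partial>closed_set_law (M 0) (\<lambda>\<omega>. Z (?Y \<omega>)))"
    proof (rule integral_closed_set_law_tendsto[OF _ _ f])
      show "random_closed_set (M 0) (\<lambda>\<omega>. Z (?A (X n) \<omega>))" for n
        by (rule random_closed_set_void[OF Z lawA good(1)])
      show "random_closed_set (M 0) (\<lambda>\<omega>. Z (?Y \<omega>))"
        by (rule random_closed_set_void[OF Z lawY good(2)])
      show "AE \<omega> in M 0. (\<forall>n. closed (Z (?A (X n) \<omega>))) \<and> closed (Z (?Y \<omega>)) \<and>
          (\<forall>K. compact K \<longrightarrow> Z (?Y \<omega>) \<inter> K = {} \<longrightarrow> (\<forall>\<^sub>F n in sequentially. Z (?A (X n) \<omega>) \<inter> K = {})) \<and>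
          (\<forall>G. open G \<longrightarrow> Z (?Y \<omega>) \<inter> G \<noteq> {} \<longrightarrow> (\<forall>\<^sub>F n in sequentially. Z (?A (X n) \<omega>) \<inter> G \<noteq> {}))"
        using conv
      proof eventually_elim
        case (elim \<omega>)
        have flat: "snd p = 0" if "p \<in> ?Y \<omega>" for p using that by auto
        have cl: "closed (Z A)" if "A \<in> good_configs" for A using Z that by (simp add: void_measurable_on_def)
        show ?case
        proof (intro conjI allI impI)
          show "closed (Z (?A (X n) \<omega>))" for n using elim cl by blast
          show "closed (Z (?Y \<omega>))" using elim cl by blast
          show "\<forall>\<^sub>F n in sequentially. Z (?A (X n) \<omega>) \<inter> K = {}" if "compact K" "Z (?Y \<omega>) \<inter> K = {}" for K
            by (rule miss[OF _ _ that]) (use elim in auto)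
          show "\<forall>\<^sub>F n in sequentially. Z (?A (X n) \<omega>) \<inter> G \<noteq> {}" if "open G" "Z (?Y \<omega>) \<inter> G \<noteq> {}" for G
            by (rule hit[OF _ _ flat _ that]) (use elim in auto)
        qed
      qed
    qed
    then show "((\<lambda>\<beta>. \<integral>x. f x \<partial>closed_set_law (M \<beta>) (\<lambda>\<omega>. Z (\<eta> \<beta> \<omega>))) \<circ> X) \<longlonglongrightarrow>
        (\<integral>x. f x \<partial>closed_set_law N (\<lambda>\<omega>. Z (embed0 (\<zeta> \<omega>))))"
      by (simp only: o_def eqA eqY)
  qed
qed

theorem corollary3p17:
  fixes M :: "real \<Rightarrow> 'w measure" and \<eta> :: "real \<Rightarrow> 'w \<Rightarrow> ((real ^ 'n) \<times> real) set"
    and N :: "'u measure" and \<zeta> :: "'u \<Rightarrow> (real ^ 'n) set"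
  assumes "CARD('n) \<ge> 2"
    and "\<And>\<beta>. \<beta> > -1 \<Longrightarrow> poisson_process (M \<beta>) (beta_intensity \<beta>) (\<eta> \<beta>)"
    and "poisson_process N (density lborel (\<lambda>_. ennreal (gamma_const CARD('n)))) \<zeta>"
  shows "(\<forall>\<beta>>-1. random_closed_set (M \<beta>) (\<lambda>\<omega>. skel (laguerre_diagram (\<eta> \<beta> \<omega>))) \<and>
                  random_closed_set (M \<beta>) (\<lambda>\<omega>. skel (laguerre_dual (\<eta> \<beta> \<omega>)))) \<and>
         random_closed_set N (\<lambda>\<omega>. skel (laguerre_diagram (embed0 (\<zeta> \<omega>)))) \<and>
         random_closed_set N (\<lambda>\<omega>. skel (laguerre_dual (embed0 (\<zeta> \<omega>)))) \<and>
         random_closed_sets_converge_weakly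
           M (\<lambda>\<beta> \<omega>. skel (laguerre_diagram (\<eta> \<beta> \<omega>)))
           N (\<lambda>\<omega>. skel (laguerre_diagram (embed0 (\<zeta> \<omega>)))) (at_right (-1)) \<and>
         random_closed_sets_converge_weakly
           M (\<lambda>\<beta> \<omega>. skel (laguerre_dual (\<eta> \<beta> \<omega>)))
           N (\<lambda>\<omega>. skel (laguerre_dual (embed0 (\<zeta> \<omega>)))) (at_right (-1))"
proof (intro conjI allI impI)
  note \<eta> = assms(2) and \<zeta> = assms(3)
  fix \<beta> :: real assume \<beta>: "-1 < \<beta>"
  show "random_closed_set (M \<beta>) (\<lambda>\<omega>. skel (laguerre_diagram (\<eta> \<beta> \<omega>)))"
    by (rule random_closed_set_void[OF void_measurable_voronoi poisson_void_law[OF \<eta>[OF \<beta>]] poisson_AE_good[OF \<eta>[OF \<beta>] \<beta>]])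
  show "random_closed_set (M \<beta>) (\<lambda>\<omega>. skel (laguerre_dual (\<eta> \<beta> \<omega>)))"
    by (rule random_closed_set_void[OF void_measurable_delaunay poisson_void_law[OF \<eta>[OF \<beta>]] poisson_AE_good[OF \<eta>[OF \<beta>] \<beta>]])
next
  show "random_closed_set N (\<lambda>\<omega>. skel (laguerre_diagram (embed0 (\<zeta> \<omega>))))"
    by (rule random_closed_set_void[OF void_measurable_voronoi poisson_embed[OF assms(3)] embed_AE_good[OF assms(3)]])
  show "random_closed_set N (\<lambda>\<omega>. skel (laguerre_dual (embed0 (\<zeta> \<omega>))))"
    by (rule random_closed_set_void[OF void_measurable_delaunay poisson_embed[OF assms(3)] embed_AE_good[OF assms(3)]])
  show "random_closed_sets_converge_weakly M (\<lambda>\<beta> \<omega>. skel (laguerre_diagram (\<eta> \<beta> \<omega>)))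
      N (\<lambda>\<omega>. skel (laguerre_diagram (embed0 (\<zeta> \<omega>)))) (at_right (-1))"
  proof (rule skeletons_converge_weakly[OF assms(2,3) void_measurable_voronoi])
    fix As and A :: "((real ^ 'n) \<times> real) set" assume conv: "config_conv As A"
    then have sk: "skel (laguerre_diagram A) = voronoi_skel A" "skel (laguerre_diagram (As n)) = voronoi_skel (As n)" for n
      by (simp_all add: config_conv_def skel_laguerre_diagram)
    show "\<forall>\<^sub>F n in sequentially. skel (laguerre_diagram (As n)) \<inter> K = {}"
      if "compact K" "skel (laguerre_diagram A) \<inter> K = {}" for K
      using voronoi_skel_eventually_misses[OF conv] that unfolding sk by blast
    show "\<forall>\<^sub>F n in sequentially. skel (laguerre_diagram (As n)) \<inter> G \<noteq> {}"
      if "open G" "skel (laguerre_diagram A) \<inter> G \<noteq> {}" for G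
      using voronoi_skel_eventually_hits[OF conv] that unfolding sk by blast
  qed
  show "random_closed_sets_converge_weakly M (\<lambda>\<beta> \<omega>. skel (laguerre_dual (\<eta> \<beta> \<omega>)))
      N (\<lambda>\<omega>. skel (laguerre_dual (embed0 (\<zeta> \<omega>)))) (at_right (-1))"
  proof (rule skeletons_converge_weakly[OF assms(2,3) void_measurable_delaunay])
    fix As and A :: "((real ^ 'n) \<times> real) set" assume conv: "config_conv As A" and good: "A \<in> good_configs"
    show "\<forall>\<^sub>F n in sequentially. skel (laguerre_dual (As n)) \<inter> K = {}"
      if "compact K" "skel (laguerre_dual A) \<inter> K = {}" for K
      using delaunay_skel_eventually_misses[OF conv _ that] good by (simp add: good_configs_def)
    show "\<forall>\<^sub>F n in sequentially. skel (laguerre_dual (As n)) \<inter> G \<noteq> {}"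
      if "\<And>p. p \<in> A \<Longrightarrow> snd p = 0" "lift_generic (fst ` A)" "open G" "skel (laguerre_dual A) \<inter> G \<noteq> {}" for G
      by (rule delaunay_skel_eventually_hits[OF conv that(1,2,4)])
  qed
qed

end
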